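(* There exist constants $\eta_1>0$ and $C_{\rm nrg}>0$, depending only on the potential $V$, such that the following holds. Let $0<\varepsilon\le1$ and let $u_\varepsilon$ be a solution of $-\Delta u_\varepsilon=-\varepsilon^{-2}\nabla_uV(u_\varepsilon)$ on $D^2$. If $$E_\varepsilon(u_\varepsilon,D^2)\le2\eta_1,$$ then there exists some $\sigma\in\Sigma$ such that $$|u_\varepsilon(x)-\sigma|\le\frac{\mu_0}{2}\quad\text{for every }x\in D^2(\tfrac34).$$ Moreover, we have the energy estimate $$E_\varepsilon\big(u_\varepsilon,D^2(\tfrac58)\big)\le C_{\rm nrg}\,\varepsilon\,E_\varepsilon(u_\varepsilon,D^2).$$
   Context: $V:\mathbb R^k\to\mathbb R$ ($k\ge1$) is smooth with $\inf V=0$ and satisfies: (1) the zero set $\Sigma=\{V=0\}=\{\sigma_1,\dots,\sigma_q\}$ is finite with $q\ge2$; (2) $\nabla^2V(\sigma_i)$ is positive definite, with smallest and largest eigenvalues $\lambda_i^->0$ and $\lambda_i^+$; (3) there are $\alpha_\infty,R_\infty>0$ with $y\cdot\nabla V(y)\ge\alpha_\infty|y|^2$ if $|y|>R_\infty$, and $V(y)\to+\infty$ as $|y|\to+\infty$. $\mu_0>0$ is a fixed constant (depending only on $V$), chosen sufficiently small so that $B^k(\sigma_i,2\mu_0)\cap B^k(\sigma_j,2\mu_0)=\emptyset$ for $i\ne j$ and $\frac12\lambda_i^-{\rm Id}\le\nabla^2V(y)\le2\lambda_i^+{\rm Id}$ for all $i$ and all $y\in B^k(\sigma_i,2\mu_0)$.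 $D^2(r)$ is the open disk of $\mathbb R^2$ of radius $r$ centered at $0$ and $D^2=D^2(1)$. For $G\subset\mathbb R^2$, $E_\varepsilon(u,G)=\int_Ge_\varepsilon(u)dx$ with $e_\varepsilon(u)=\varepsilon\frac{|\nabla u|^2}{2}+\frac1\varepsilon V(u)$. Solutions are $H^1$ maps with values in $\mathbb R^k$, smooth in the open disk. *)

theory Defs
  imports "HOL-Analysis.Analysis"
begin

definition partial_diff :: "'n::finite \<Rightarrow> (real^'n \<Rightarrow> 'b::real_normed_vector) \<Rightarrow> real^'n \<Rightarrow> 'b"
  where "partial_diff i f x = frechet_derivative f (at x) (axis i 1)"

definition grad :: "(real^'n \<Rightarrow> real) \<Rightarrow> real^'n \<Rightarrow> real^'n"
  where "grad f x = (\<chi> i. partial_diff i f x)"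

definition hessian :: "(real^'n \<Rightarrow> real) \<Rightarrow> real^'n \<Rightarrow> real^'n^'n"
  where "hessian f x = (\<chi> i j. partial_diff i (partial_diff j f) x)"

definition laplacian :: "(real^'n \<Rightarrow> 'b::real_normed_vector) \<Rightarrow> real^'n \<Rightarrow> 'b"
  where "laplacian f x = (\<Sum>i\<in>UNIV. partial_diff i (partial_diff i f) x)"

(* Meant for open S: all derivatives are the two-sided ones, taken at points of S. *)
primrec Ck_on :: "nat \<Rightarrow> (real^'n) set \<Rightarrow> (real^'n \<Rightarrow> 'b::real_normed_vector) \<Rightarrow> bool"
  where
    "Ck_on 0 S f \<longleftrightarrow> continuous_on S f"
  | "Ck_on (Suc m) S f \<longleftrightarrow>
       (\<forall>x\<in>S. f differentiable (at x)) \<and> (\<forall>i. Ck_on m S (partial_diff i f))"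

definition smooth_on :: "(real^'n) set \<Rightarrow> (real^'n \<Rightarrow> 'b::real_normed_vector) \<Rightarrow> bool"
  where "smooth_on S f \<longleftrightarrow> (\<forall>m. Ck_on m S f)"

definition eigenvalues :: "real^'n^'n \<Rightarrow> real set"
  where "eigenvalues A = {c. \<exists>v. v \<noteq> 0 \<and> A *v v = c *\<^sub>R v}"

(* Used for symmetric matrices only, whose spectrum is real, finite and nonempty, so that the
   LEAST and GREATEST below exist. *)
definition min_eigenvalue :: "real^'n^'n \<Rightarrow> real"
  where "min_eigenvalue A = (LEAST c. c \<in> eigenvalues A)"

definition max_eigenvalue :: "real^'n^'n \<Rightarrow> real"
  where "max_eigenvalue A = (GREATEST c. c \<in> eigenvalues A)"

definition pos_definite :: "real^'n^'n \<Rightarrow> bool"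
  where "pos_definite A \<longleftrightarrow> (\<forall>v. v \<noteq> 0 \<longrightarrow> v \<bullet> (A *v v) > 0)"

(* The order of quadratic forms; the matrices compared below are symmetric. *)
definition loewner_le :: "real^'n^'n \<Rightarrow> real^'n^'n \<Rightarrow> bool"
  where "loewner_le A B \<longleftrightarrow> (\<forall>v. v \<bullet> (A *v v) \<le> v \<bullet> (B *v v))"

definition zero_set :: "('a \<Rightarrow> real) \<Rightarrow> 'a set"
  where "zero_set V = {y. V y = 0}"

(* bdd_below excludes the unspecified value of Inf on sets that are not bounded below. *)
definition multi_well_potential :: "(real^'k \<Rightarrow> real) \<Rightarrow> bool"
  where "multi_well_potential V \<longleftrightarrow>
    smooth_on UNIV V \<and>
    bdd_below (range V) \<and> (INF y. V y) = 0 \<and>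
    finite (zero_set V) \<and> card (zero_set V) \<ge> 2 \<and>
    (\<forall>\<sigma>\<in>zero_set V. pos_definite (hessian V \<sigma>)) \<and>
    (\<exists>\<alpha>>0. \<exists>R>0. \<forall>y. norm y > R \<longrightarrow> y \<bullet> grad V y \<ge> \<alpha> * (norm y)\<^sup>2) \<and>
    filterlim V at_top at_infinity"

definition well_radius :: "(real^'k \<Rightarrow> real) \<Rightarrow> real \<Rightarrow> bool"
  where "well_radius V \<mu> \<longleftrightarrow>
    \<mu> > 0 \<and>
    (\<forall>\<sigma>\<in>zero_set V. \<forall>\<tau>\<in>zero_set V. \<sigma> \<noteq> \<tau> \<longrightarrow> ball \<sigma> (2 * \<mu>) \<inter> ball \<tau> (2 * \<mu>) = {}) \<and>
    (\<forall>\<sigma>\<in>zero_set V. \<forall>y\<in>ball \<sigma> (2 * \<mu>).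
       loewner_le ((min_eigenvalue (hessian V \<sigma>) / 2) *\<^sub>R mat 1) (hessian V y) \<and>
       loewner_le (hessian V y) ((2 * max_eigenvalue (hessian V \<sigma>)) *\<^sub>R mat 1))"

definition test_function_on :: "(real^'n) set \<Rightarrow> (real^'n \<Rightarrow> real) \<Rightarrow> bool"
  where "test_function_on \<Omega> \<phi> \<longleftrightarrow>
    smooth_on UNIV \<phi> \<and> compact (closure {x. \<phi> x \<noteq> 0}) \<and> closure {x. \<phi> x \<noteq> 0} \<subseteq> \<Omega>"

definition L2_on :: "(real^'n) set \<Rightarrow> (real^'n \<Rightarrow> 'b::euclidean_space) \<Rightarrow> bool"
  where "L2_on \<Omega> f \<longleftrightarrow>
    set_borel_measurable lebesgue \<Omega> f \<and> set_integrable lebesgue \<Omega> (\<lambda>x. (norm (f x))\<^sup>2)"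

definition weak_partial_on ::
    "(real^'n) set \<Rightarrow> 'n \<Rightarrow> (real^'n \<Rightarrow> 'b::euclidean_space) \<Rightarrow> (real^'n \<Rightarrow> 'b) \<Rightarrow> bool"
  where "weak_partial_on \<Omega> i f g \<longleftrightarrow>
    (\<forall>\<phi>. test_function_on \<Omega> \<phi> \<longrightarrow>
       set_lebesgue_integral lebesgue \<Omega> (\<lambda>x. partial_diff i \<phi> x *\<^sub>R f x) =
       - set_lebesgue_integral lebesgue \<Omega> (\<lambda>x. \<phi> x *\<^sub>R g x))"

definition H1_on :: "(real^'n) set \<Rightarrow> (real^'n \<Rightarrow> 'b::euclidean_space) \<Rightarrow> bool"
  where "H1_on \<Omega> f \<longleftrightarrow>
    L2_on \<Omega> f \<and> (\<forall>i. \<exists>g. L2_on \<Omega> g \<and> weak_partial_on \<Omega> i f g)"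

definition energy_density ::
    "real \<Rightarrow> (real^'k \<Rightarrow> real) \<Rightarrow> (real^'n \<Rightarrow> real^'k) \<Rightarrow> real^'n \<Rightarrow> real"
  where "energy_density \<epsilon> V u x =
    \<epsilon> * (\<Sum>i\<in>UNIV. (norm (partial_diff i u x))\<^sup>2) / 2 + V (u x) / \<epsilon>"

(* The density is nonnegative for the potentials considered.  The integral takes values in
   [0, infinity]: an H1 map may have infinite potential energy, as V has no upper growth bound.
   Classical partial derivatives suffice, as the energy is only taken of maps smooth on G. *)
definition energy ::
    "real \<Rightarrow> (real^'k \<Rightarrow> real) \<Rightarrow> (real^'n \<Rightarrow> real^'k) \<Rightarrow> (real^'n) set \<Rightarrow> ennreal"
  where "energy \<epsilon> V u G = (\<integral>\<^sup>+x\<in>G. ennreal (energy_density \<epsilon> V u x) \<partial>lebesgue)"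

abbreviation disk :: "real \<Rightarrow> (real^2) set"
  where "disk r \<equiv> ball 0 r"

definition solution_on ::
    "(real^'n) set \<Rightarrow> real \<Rightarrow> (real^'k \<Rightarrow> real) \<Rightarrow> (real^'n \<Rightarrow> real^'k) \<Rightarrow> bool"
  where "solution_on \<Omega> \<epsilon> V u \<longleftrightarrow>
    H1_on \<Omega> u \<and> smooth_on \<Omega> u \<and>
    (\<forall>x\<in>\<Omega>. - laplacian u x = - ((1 / \<epsilon>\<^sup>2) *\<^sub>R grad V (u x)))"

end

theory Submission
  imports Defs
begin

text \<open>
  The proof avoids comparison maps and uses only identities tested with compactly supported weights.
  Coercivity of the potential and the mean value inequality for \<open>\<bar>u\<bar>\<^sup>2\<close> give a polynomial bound in
  \<open>1/\<epsilon>\<close>, which a barrier improves to a uniform bound \<open>\<bar>u\<bar> \<le> M\<close>; Bernstein's method then gives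
  \<open>\<bar>\<nabla>u\<bar>\<^sup>2 \<le> G/\<epsilon>\<^sup>2\<close>. Testing the equation with \<open>w\<^sup>2 \<nabla>V(u)\<close> controls the weighted energy by the
  potential on the bad set \<open>{V(u) > c/2}\<close> up to errors \<open>\<epsilon>\<^sup>2 \<bar>\<nabla>w\<bar>\<^sup>2\<close>.

  Since a point of the bad set carries energy at least \<open>\<kappa> \<epsilon>\<close> at scale \<open>\<epsilon>\<close>, the projections of the bad set to
  the two axes, thickened by \<open>K \<epsilon>\<close>, have measure at most a multiple of \<open>K\<close> times the energy \<open>E\<close>. Testing the divergence free
  stress-energy tensor with vector fields \<open>(\<phi>(x\<^sub>1), 0)\<close> and \<open>(0, \<phi>(x\<^sub>2))\<close>, whose slope is 1 on the respective
  projection and whose size is bounded by its measure, bounds the potential energy of the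
  bad set by \<open>O(K E\<^sup>2 + E/K\<^sup>2)\<close>. Hence small energy at scale \<open>r\<close> is at least halved at scale \<open>r/2\<close>;
  iterating down to \<open>r\<close> comparable to \<open>\<epsilon>\<close> shows that the bad set is empty in the interior.
\<close>

subsection \<open>Partial derivatives along coordinate lines\<close>

text \<open>The Laplacian of V(u) is |grad V(u)|^2 / \<epsilon>^2 plus the Hessian form of V on the
  partial derivatives of u. Near any well both summands are coercive: convexity controls |grad u|^2,
  and |grad V|^2 \<ge> 2 \<theta> V controls the potential. Hence only the bad set obstructs decay,
  and its potential energy must be bounded by something of higher order in E. The trace of the
  stress-energy tensor in two dimensions is 2 V(u) / \<epsilon>, because the gradient terms cancel.
  The usual radial test field has size r, so cutting it off at scale r costs a multiple of E and
  nothing is gained. A field that grows only over the thickened projections has size of order K E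
  instead, and its cutoff costs K E^2 / r. If E \<le> \<eta> r, this is a small multiple of E, and
  the condition survives when both E and r are halved. Where the slope of the field differs from 1
  the tensor is not controlled by its trace; but the factor by which the slope fails to be 1 is the
  square of a weight that vanishes on the bad set and varies at scale K \<epsilon>, so the first
  identity bounds this part by E / K^2.\<close>

definition has_pd :: "'n::finite \<Rightarrow> (real^'n \<Rightarrow> 'b::real_normed_vector) \<Rightarrow> 'b \<Rightarrow> real^'n \<Rightarrow> bool"
  where "has_pd i f d x \<longleftrightarrow> ((\<lambda>t. f (x + t *\<^sub>R axis i 1)) has_vector_derivative d) (at 0)"

lemma has_pd_shift:
  assumes "has_pd i f d (x + s *\<^sub>R axis i 1)"
  shows "((\<lambda>t. f (x + t *\<^sub>R axis i 1)) has_vector_derivative d) (at s)"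
proof -
  have "((\<lambda>t. f (x + s *\<^sub>R axis i 1 + t *\<^sub>R axis i 1)) has_vector_derivative d) (at (s - s))"
    using assms by (simp add: has_pd_def)
  then have "((\<lambda>t. f (x + s *\<^sub>R axis i 1 + t *\<^sub>R axis i 1)) \<circ> (\<lambda>t. t - s) has_vector_derivative 1 *\<^sub>R d) (at s)"
    by (intro vector_diff_chain_at) (auto intro!: derivative_eq_intros)
  then show ?thesis
    by (simp add: o_def algebra_simps)
qed

lemma has_pd_partial_diff:
  assumes "f differentiable (at x)"
  shows "has_pd i f (partial_diff i f x) x"
proof -
  have f: "(f has_derivative frechet_derivative f (at x)) (at x)"
    using assms by (simp add: frechet_derivative_works)
  have "((\<lambda>t. x + t *\<^sub>R axis i 1) has_derivative (\<lambda>t. t *\<^sub>R axis i 1)) (at (0::real))"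
    by (auto intro!: derivative_eq_intros)
  then have "(f \<circ> (\<lambda>t. x + t *\<^sub>R axis i 1) has_derivative frechet_derivative f (at x) \<circ> (\<lambda>t. t *\<^sub>R axis i 1)) (at 0)"
    by (rule diff_chain_at) (use f in simp)
  moreover have "frechet_derivative f (at x) \<circ> (\<lambda>t. t *\<^sub>R axis i 1) = (\<lambda>t. t *\<^sub>R partial_diff i f x)"
    using linear_frechet_derivative[OF assms] by (auto simp: partial_diff_def linear_cmul o_def)
  ultimately show ?thesis
    by (simp add: has_pd_def has_vector_derivative_def o_def)
qed

lemma frechet_derivative_eq_sum_partial:
  fixes f :: "real^'n \<Rightarrow> 'b::real_normed_vector"
  assumes "f differentiable (at x)"
  shows "frechet_derivative f (at x) v = (\<Sum>i\<in>UNIV. v $ i *\<^sub>R partial_diff i f x)"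
proof -
  have "v = (\<Sum>i\<in>UNIV. v $ i *\<^sub>R axis i 1)"
    by (simp add: vec_eq_iff sum_component axis_def if_distrib cong: if_cong)
  then have "frechet_derivative f (at x) v = frechet_derivative f (at x) (\<Sum>i\<in>UNIV. v $ i *\<^sub>R axis i 1)"
    by simp
  also have "\<dots> = (\<Sum>i\<in>UNIV. v $ i *\<^sub>R partial_diff i f x)"
    using linear_frechet_derivative[OF assms]
    by (simp add: linear_sum linear_cmul partial_diff_def)
  finally show ?thesis .
qed

lemma has_derivative_partial:
  fixes f :: "real^'n \<Rightarrow> 'b::real_normed_vector"
  assumes "f differentiable (at x)"
  shows "(f has_derivative (\<lambda>v. \<Sum>i\<in>UNIV. v $ i *\<^sub>R partial_diff i f x)) (at x)"
  using assms frechet_derivative_works frechet_derivative_eq_sum_partial[OF assms]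
  by (metis (no_types, lifting) ext)

lemma has_pd_unique: "has_pd i f d x \<Longrightarrow> has_pd i f d' x \<Longrightarrow> d = d'"
  unfolding has_pd_def by (rule vector_derivative_unique_at)

lemma has_pd_compose_DERIV:
  assumes "has_pd i f d x" and "(g has_real_derivative g') (at (f x))"
  shows "has_pd i (\<lambda>x. g (f x)) (g' * d) x"
proof -
  have "(g \<circ> (\<lambda>t. f (x + t *\<^sub>R axis i 1)) has_vector_derivative d * g') (at 0)"
    using assms unfolding has_pd_def has_real_derivative_iff_has_vector_derivative
    by (metis add.right_neutral field_vector_diff_chain_at has_real_derivative_iff_has_vector_derivative scale_zero_left vector_diff_chain_at real_scaleR_def)
  then show ?thesis by (simp add: has_pd_def o_def mult.commute)
qed

lemma has_pd_const: "has_pd i (\<lambda>x. c) 0 x"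
  by (simp add: has_pd_def)

lemma has_pd_add: "has_pd i f f' x \<Longrightarrow> has_pd i g g' x \<Longrightarrow> has_pd i (\<lambda>x. f x + g x) (f' + g') x"
  unfolding has_pd_def by (rule has_vector_derivative_add)

lemma has_pd_diff: "has_pd i f f' x \<Longrightarrow> has_pd i g g' x \<Longrightarrow> has_pd i (\<lambda>x. f x - g x) (f' - g') x"
  unfolding has_pd_def by (rule has_vector_derivative_diff)

lemma has_pd_sum: "(\<And>j. j \<in> J \<Longrightarrow> has_pd i (f j) (f' j) x) \<Longrightarrow> has_pd i (\<lambda>x. \<Sum>j\<in>J. f j x) (\<Sum>j\<in>J. f' j) x"
  unfolding has_pd_def by (rule has_vector_derivative_sum)

lemma has_pd_mult:
  fixes f g :: "real^'n \<Rightarrow> real"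
  shows "has_pd i f f' x \<Longrightarrow> has_pd i g g' x \<Longrightarrow> has_pd i (\<lambda>x. f x * g x) (f x * g' + f' * g x) x"
  unfolding has_pd_def by (drule (1) has_vector_derivative_mult) simp

lemma has_pd_inner:
  fixes f g :: "real^'n \<Rightarrow> 'b::real_inner"
  assumes "has_pd i f f' x" "has_pd i g g' x"
  shows "has_pd i (\<lambda>x. f x \<bullet> g x) (f x \<bullet> g' + f' \<bullet> g x) x"
  using bounded_bilinear.has_vector_derivative[OF bounded_bilinear_inner assms[unfolded has_pd_def]]
  by (simp add: has_pd_def)

lemma has_pd_cmult:
  fixes f :: "real^'n \<Rightarrow> real"
  shows "has_pd i f f' x \<Longrightarrow> has_pd i (\<lambda>x. c * f x) (c * f') x"
  using has_pd_mult[OF has_pd_const[of i c]] by fastforce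

lemma has_pd_component:
  fixes f :: "real^'n \<Rightarrow> real^'m"
  shows "has_pd i f f' x \<Longrightarrow> has_pd i (\<lambda>x. f x $ j) (f' $ j) x"
  using has_pd_inner[OF _ has_pd_const, of i f f' x "axis j 1"] by (simp add: inner_axis)

lemma has_pd_coord: "has_pd i (\<lambda>x. x $ j) (if i = j then 1 else 0) x"
proof -
  have "has_pd i (\<lambda>x::real^'a. x) (axis i 1) x"
    unfolding has_pd_def by (auto intro!: derivative_eq_intros)
  from has_pd_component[OF this, of j] show ?thesis by (auto simp: axis_def split: if_splits)
qed

lemma has_pd_transform:
  assumes "has_pd i f d x" "open U" "x \<in> U" "\<And>y. y \<in> U \<Longrightarrow> f y = g y"
  shows "has_pd i g d x"
proof -
  have S: "open ((\<lambda>t::real. x + t *\<^sub>R axis i 1) -` U)"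
    by (intro open_vimage assms continuous_intros)
  show ?thesis
    unfolding has_pd_def
    by (rule has_vector_derivative_transform_within_open[OF assms(1)[unfolded has_pd_def] S])
       (use assms in auto)
qed

lemma has_pd_norm_sq_diff:
  fixes x0 :: "real^'n"
  shows "has_pd i (\<lambda>x. (norm (x - x0))\<^sup>2) (2 * (x $ i - x0 $ i)) x"
proof -
  have "has_pd i (\<lambda>x::real^'n. x - x0) (axis i 1) x"
    unfolding has_pd_def by (auto intro!: derivative_eq_intros)
  from has_pd_inner[OF this this] show ?thesis
    by (simp add: power2_norm_eq_inner inner_axis inner_axis' algebra_simps)
qed

section \<open>Smooth maps and the symmetry of mixed partial derivatives\<close>

lemma smooth_on_partial_diff: "smooth_on S f \<Longrightarrow> smooth_on S (partial_diff i f)"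
  unfolding smooth_on_def by (metis Ck_on.simps(2))

lemma smooth_on_differentiable: "smooth_on S f \<Longrightarrow> x \<in> S \<Longrightarrow> f differentiable (at x)"
  unfolding smooth_on_def by (metis Ck_on.simps(2))

lemma smooth_on_continuous_on: "smooth_on S f \<Longrightarrow> continuous_on S f"
  unfolding smooth_on_def by (metis Ck_on.simps(1))

lemma smooth_on_has_pd: "smooth_on S f \<Longrightarrow> x \<in> S \<Longrightarrow> has_pd i f (partial_diff i f x) x"
  by (simp add: smooth_on_differentiable has_pd_partial_diff)

lemma mvt_real_vector:
  fixes g :: "real \<Rightarrow> real"
  assumes "a < b" "\<And>t. a \<le> t \<Longrightarrow> t \<le> b \<Longrightarrow> (g has_vector_derivative g' t) (at t)"
  shows "\<exists>t. a < t \<and> t < b \<and> g b - g a = (b - a) * g' t"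
  using MVT2[OF assms(1), of g g'] assms(2)
  by (simp add: has_real_derivative_iff_has_vector_derivative)

text \<open>The mean value theorem is applied in direction \<open>i\<close> to the increment of
  \<open>f\<close> over a step \<open>h\<close> in direction \<open>j\<close>, and then in direction
  \<open>j\<close> to \<open>fi\<close>. The second difference itself is symmetric in the two
  directions, so exchanging their roles expresses it by the other mixed derivative.\<close>

lemma second_difference:
  fixes f :: "real^'n \<Rightarrow> real"
  assumes h: "h > 0"
    and U: "\<And>s t. 0 \<le> s \<Longrightarrow> s \<le> h \<Longrightarrow> 0 \<le> t \<Longrightarrow> t \<le> h \<Longrightarrow> x + s *\<^sub>R axis i 1 + t *\<^sub>R axis j 1 \<in> U"
    and f1: "\<And>y. y \<in> U \<Longrightarrow> has_pd i f (fi y) y"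
    and f2: "\<And>y. y \<in> U \<Longrightarrow> has_pd j fi (fij y) y"
  obtains s t where "0 < s" "s < h" "0 < t" "t < h"
    "f (x + h *\<^sub>R axis i 1 + h *\<^sub>R axis j 1) - f (x + h *\<^sub>R axis i 1) - f (x + h *\<^sub>R axis j 1) + f x
      = h\<^sup>2 * fij (x + s *\<^sub>R axis i 1 + t *\<^sub>R axis j 1)"
proof -
  define g where "g s = f (x + h *\<^sub>R axis j 1 + s *\<^sub>R axis i 1) - f (x + s *\<^sub>R axis i 1)" for s
  have "\<exists>s. 0 < s \<and> s < h \<and> g h - g 0 = (h - 0) * (fi (x + h *\<^sub>R axis j 1 + s *\<^sub>R axis i 1) - fi (x + s *\<^sub>R axis i 1))"
  proof (rule mvt_real_vector[OF h])
    fix s assume s: "0 \<le> s" "s \<le> h"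
    have "x + h *\<^sub>R axis j 1 + s *\<^sub>R axis i 1 \<in> U" "x + s *\<^sub>R axis i 1 \<in> U"
      using U[OF s, of h] U[OF s, of 0] h by (simp_all add: algebra_simps)
    then show "(g has_vector_derivative fi (x + h *\<^sub>R axis j 1 + s *\<^sub>R axis i 1) - fi (x + s *\<^sub>R axis i 1)) (at s)"
      unfolding g_def by (intro has_vector_derivative_diff has_pd_shift f1)
  qed
  then obtain s where s: "0 < s" "s < h"
    and gs: "g h - g 0 = h * (fi (x + h *\<^sub>R axis j 1 + s *\<^sub>R axis i 1) - fi (x + s *\<^sub>R axis i 1))"
    by auto
  define k where "k t = fi (x + s *\<^sub>R axis i 1 + t *\<^sub>R axis j 1)" for t
  have "\<exists>t. 0 < t \<and> t < h \<and> k h - k 0 = (h - 0) * fij (x + s *\<^sub>R axis i 1 + t *\<^sub>R axis j 1)"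
  proof (rule mvt_real_vector[OF h])
    fix t assume "0 \<le> t" "t \<le> h"
    then show "(k has_vector_derivative fij (x + s *\<^sub>R axis i 1 + t *\<^sub>R axis j 1)) (at t)"
      unfolding k_def using s by (intro has_pd_shift f2 U) auto
  qed
  then obtain t where t: "0 < t" "t < h" and kt: "k h - k 0 = h * fij (x + s *\<^sub>R axis i 1 + t *\<^sub>R axis j 1)"
    by auto
  have "g h - g 0 = h * (k h - k 0)" using gs by (simp add: k_def algebra_simps)
  then have "g h - g 0 = h\<^sup>2 * fij (x + s *\<^sub>R axis i 1 + t *\<^sub>R axis j 1)"
    using kt by (simp add: power2_eq_square)
  then show ?thesis
    using that[OF s t] by (simp add: g_def algebra_simps)
qed

text \<open>Schwarz's theorem. One second difference is evaluated in both orders, which makes the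
  two mixed derivatives agree at two points of a small square; by continuity each differs from its
  value at \<open>x\<close> by less than half of the supposed gap.\<close>

lemma mixed_pd_eq:
  fixes f :: "real^'n \<Rightarrow> real"
  assumes U: "open U" "x \<in> U"
    and fi: "\<And>y. y \<in> U \<Longrightarrow> has_pd i f (fi y) y" and fij: "\<And>y. y \<in> U \<Longrightarrow> has_pd j fi (fij y) y"
    and fj: "\<And>y. y \<in> U \<Longrightarrow> has_pd j f (fj y) y" and fji: "\<And>y. y \<in> U \<Longrightarrow> has_pd i fj (fji y) y"
    and c: "continuous_on U fij" "continuous_on U fji"
  shows "fij x = fji x"
proof (rule ccontr)
  assume "fij x \<noteq> fji x"
  define e where "e = \<bar>fij x - fji x\<bar> / 2"
  have e: "e > 0" using \<open>fij x \<noteq> fji x\<close> by (simp add: e_def)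
  have "isCont fij x" "isCont fji x"
    using c U by (auto simp: continuous_on_eq_continuous_at)
  then obtain d1 d2 where d1: "d1 > 0" "\<And>y. dist y x < d1 \<Longrightarrow> dist (fij y) (fij x) < e"
    and d2: "d2 > 0" "\<And>y. dist y x < d2 \<Longrightarrow> dist (fji y) (fji x) < e"
    using e unfolding continuous_at_eps_delta by metis
  obtain d3 where d3: "d3 > 0" "ball x d3 \<subseteq> U" using U by (meson openE)
  define h where "h = min d1 (min d2 d3) / 4"
  have h: "h > 0" "4 * h \<le> d1" "4 * h \<le> d2" "4 * h \<le> d3" using d1 d2 d3 by (auto simp: h_def)
  have near: "dist (x + s *\<^sub>R axis a 1 + t *\<^sub>R axis b 1) x < 4 * h"
    if "0 \<le> s" "s \<le> h" "0 \<le> t" "t \<le> h" for s t and a b :: 'n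
  proof -
    have "norm (s *\<^sub>R axis a 1 + t *\<^sub>R axis b (1::real) :: real^'n) \<le> s + t"
      using that norm_triangle_ineq[of "s *\<^sub>R axis a (1::real) :: real^'n" "t *\<^sub>R axis b 1"] by simp
    then show ?thesis using that h by (simp add: dist_norm add.assoc)
  qed
  have inU: "x + s *\<^sub>R axis a 1 + t *\<^sub>R axis b 1 \<in> U" if "0 \<le> s" "s \<le> h" "0 \<le> t" "t \<le> h" for s t and a b :: 'n
    using near[OF that, of a b] d3 h by (auto simp: dist_commute subset_iff)
  obtain s t where st: "0 < s" "s < h" "0 < t" "t < h" and
    1: "f (x + h *\<^sub>R axis i 1 + h *\<^sub>R axis j 1) - f (x + h *\<^sub>R axis i 1) - f (x + h *\<^sub>R axis j 1) + f x
      = h\<^sup>2 * fij (x + s *\<^sub>R axis i 1 + t *\<^sub>R axis j 1)"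
    using second_difference[OF h(1) inU fi fij] by blast
  obtain s' t' where st': "0 < s'" "s' < h" "0 < t'" "t' < h" and
    2: "f (x + h *\<^sub>R axis j 1 + h *\<^sub>R axis i 1) - f (x + h *\<^sub>R axis j 1) - f (x + h *\<^sub>R axis i 1) + f x
      = h\<^sup>2 * fji (x + s' *\<^sub>R axis j 1 + t' *\<^sub>R axis i 1)"
    using second_difference[OF h(1) inU fj fji] by blast
  have "h\<^sup>2 * fij (x + s *\<^sub>R axis i 1 + t *\<^sub>R axis j 1) = h\<^sup>2 * fji (x + s' *\<^sub>R axis j 1 + t' *\<^sub>R axis i 1)"
    using 1 2 by (simp add: algebra_simps)
  then have "fij (x + s *\<^sub>R axis i 1 + t *\<^sub>R axis j 1) = fji (x + s' *\<^sub>R axis j 1 + t' *\<^sub>R axis i 1)"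
    using h by simp
  moreover have "dist (fij (x + s *\<^sub>R axis i 1 + t *\<^sub>R axis j 1)) (fij x) < e"
    using near[of s t i j] st h d1(2) by auto
  moreover have "dist (fji (x + s' *\<^sub>R axis j 1 + t' *\<^sub>R axis i 1)) (fji x) < e"
    using near[of s' t' j i] st' h d2(2) by auto
  ultimately have "dist (fij x) (fji x) < 2 * e"
    using dist_triangle_lt[of "fij x"] by (smt (verit) dist_commute dist_triangle)
  then show False by (simp add: e_def dist_real_def)
qed

lemma mixed_partial_diff:
  fixes f :: "real^'n \<Rightarrow> real^'m"
  assumes f: "smooth_on U f" and U: "open U" "x \<in> U"
  shows "partial_diff j (partial_diff i f) x = partial_diff i (partial_diff j f) x"
proof (rule vec_eq_iff[THEN iffD2], rule allI)
  fix k
  note s = f smooth_on_partial_diff[OF f] smooth_on_partial_diff[OF smooth_on_partial_diff[OF f]]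
  show "partial_diff j (partial_diff i f) x $ k = partial_diff i (partial_diff j f) x $ k"
    by (rule mixed_pd_eq[OF U, where f="\<lambda>x. f x $ k" and fi="\<lambda>x. partial_diff i f x $ k" and fj="\<lambda>x. partial_diff j f x $ k" and i=i and j=j])
       (use s(1) in \<open>auto intro!: has_pd_component smooth_on_has_pd smooth_on_partial_diff\<close>,
        (intro continuous_on_component smooth_on_continuous_on s)+)
qed

subsection \<open>Interior maxima\<close>

text \<open>The first derivative vanishes at the maximum; were \<open>d\<close> positive, it would
  be positive just to the right and \<open>f\<close> would exceed its maximum there. Summed over the
  directions this is the maximum principle for the barrier and for Bernstein's method.\<close>

lemma interior_max_second_pd:
  fixes f :: "real^'n \<Rightarrow> real"
  assumes U: "open U" "x \<in> U" and mx: "\<And>y. y \<in> U \<Longrightarrow> f y \<le> f x"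
    and f1: "\<And>y. y \<in> U \<Longrightarrow> has_pd i f (f1 y) y" and f2: "has_pd i f1 d x"
  shows "d \<le> 0"
proof (rule ccontr)
  assume "\<not> d \<le> 0"
  then have d: "d > 0" by simp
  obtain r where r: "r > 0" "ball x r \<subseteq> U" using U by (meson openE)
  have inU: "x + t *\<^sub>R axis i 1 \<in> U" if "\<bar>t\<bar> < r" for t
    using that r by (auto simp: dist_norm subset_iff)
  define g where "g t = f (x + t *\<^sub>R axis i 1)" for t
  define g1 where "g1 t = f1 (x + t *\<^sub>R axis i 1)" for t
  have g: "(g has_real_derivative g1 t) (at t)" if "\<bar>t\<bar> < r" for t
    unfolding g_def g1_def has_real_derivative_iff_has_vector_derivative
    by (intro has_pd_shift f1 inU that)
  have g1: "(g1 has_real_derivative d) (at 0)"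
    using f2 unfolding g1_def has_pd_def has_real_derivative_iff_has_vector_derivative .
  have "g1 0 = 0"
    by (rule DERIV_local_max[OF g[of 0] r(1)]) (use r mx inU in \<open>auto simp: g_def\<close>)
  obtain e where e: "e > 0" "\<And>h. 0 < h \<Longrightarrow> h < e \<Longrightarrow> g1 0 < g1 (0 + h)"
    using DERIV_pos_inc_right[OF g1 d] by auto
  define b where "b = min r e / 2"
  have b: "0 < b" "b < r" "b < e" using r e by (auto simp: b_def)
  obtain t where t: "0 < t" "t < b" "g b - g 0 = (b - 0) * g1 t"
    using MVT2[OF b(1), of g g1] g b by fastforce
  have "g1 t > 0" using e(2)[of t] t b \<open>g1 0 = 0\<close> by simp
  then have "g b > g 0" using t b by (simp add: algebra_simps zero_less_mult_iff)
  moreover have "g b \<le> g 0" using mx[OF inU[of b]] b by (simp add: g_def)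
  ultimately show False by simp
qed

subsection \<open>Integration by parts\<close>

lemma lborel_integral_translate:
  fixes f :: "real^'n \<Rightarrow> real"
  assumes "f \<in> borel_measurable borel"
  shows "(LBINT x. f (x + c)) = integral\<^sup>L lborel f"
proof -
  have "integral\<^sup>L lborel f = integral\<^sup>L (distr lborel borel ((+) c)) f"
    by (simp add: lborel_distr_plus)
  also have "\<dots> = (LBINT x. f (c + x))"
    by (rule integral_distr) (use assms in auto)
  finally show ?thesis by (simp add: add.commute)
qed

text \<open>Difference quotients of \<open>f\<close> have integral 0 by translation invariance. The
  mean value theorem bounds them by \<open>G\<close> and they live on a ball of radius
  \<open>R + 1\<close>, so dominated convergence passes to the derivative.\<close>

lemma integral_pd_eq_0:
  fixes f g :: "real^'n \<Rightarrow> real"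
  assumes der: "\<And>x. has_pd i f (g x) x" and G: "\<And>x. \<bar>g x\<bar> \<le> G"
    and supp: "\<And>x. norm x > R \<Longrightarrow> f x = 0"
    and f[measurable]: "f \<in> borel_measurable borel" and g[measurable]: "g \<in> borel_measurable borel"
  shows "integral\<^sup>L lborel g = 0"
proof -
  define h where "h n = 1 / (real n + 1)" for n
  have h: "0 < h n" "h n \<le> 1" for n by (auto simp: h_def)
  have h0: "h \<longlonglongrightarrow> 0" unfolding h_def using LIMSEQ_inverse_real_of_nat by (simp add: inverse_eq_divide add.commute)
  define q where "q n x = (f (x + h n *\<^sub>R axis i 1) - f x) / h n" for n x
  have qm[measurable]: "q n \<in> borel_measurable borel" for n unfolding q_def by measurable
  have G0: "G \<ge> 0" using G[of 0] by linarith
  have bound: "\<bar>q n x\<bar> \<le> G" for n x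
  proof -
    obtain t where "0 < t" "t < h n" "f (x + h n *\<^sub>R axis i 1) - f (x + 0 *\<^sub>R axis i 1) = (h n - 0) * g (x + t *\<^sub>R axis i 1)"
      using mvt_real_vector[OF h(1)[of n], of "\<lambda>t. f (x + t *\<^sub>R axis i 1)" "\<lambda>t. g (x + t *\<^sub>R axis i 1)"]
        has_pd_shift[OF der] by blast
    then have "q n x = g (x + t *\<^sub>R axis i 1)" using h(1)[of n] by (simp add: q_def)
    then show ?thesis using G by simp
  qed
  have qsupp: "q n x = 0" if "norm x > R + 1" for n x
  proof -
    have "norm x - norm (h n *\<^sub>R axis i (1::real) :: real^'n) \<le> norm (x + h n *\<^sub>R axis i 1)"
      using norm_diff_ineq by blast
    then have "norm (x + h n *\<^sub>R axis i 1) > R" using that h[of n] by simp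
    then show ?thesis using supp that by (simp add: q_def)
  qed
  have fi: "integrable lborel f"
  proof (rule Bochner_Integration.integrable_bound[OF borel_integrable_compact[of "cball 0 R" "\<lambda>_. (2 * \<bar>R\<bar> + 2) * G"]])
    show "AE x in lborel. norm (f x) \<le> norm (indicat_real (cball 0 R) x *\<^sub>R ((2 * \<bar>R\<bar> + 2) * G))"
    proof (rule AE_I2)
      fix x :: "real^'n"
      show "norm (f x) \<le> norm (indicat_real (cball 0 R) x *\<^sub>R ((2 * \<bar>R\<bar> + 2) * G))"
      proof (cases "norm x \<le> R")
        case True
        \<comment> \<open>A shift by \<open>T\<close> leaves the ball of radius \<open>R\<close>
          from any of its points, so \<open>f x\<close> is minus an increment along a segment of
          length \<open>T\<close>; this bounds \<open>f\<close>.\<close>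
        define T where "T = 2 * \<bar>R\<bar> + 2"
        have T: "T > 0" by (simp add: T_def)
        obtain t where "f (x + T *\<^sub>R axis i 1) - f (x + 0 *\<^sub>R axis i 1) = (T - 0) * g (x + t *\<^sub>R axis i 1)"
          using mvt_real_vector[OF T, of "\<lambda>t. f (x + t *\<^sub>R axis i 1)" "\<lambda>t. g (x + t *\<^sub>R axis i 1)"]
            has_pd_shift[OF der] by blast
        moreover have "norm (T *\<^sub>R axis i (1::real) :: real^'n) - norm x \<le> norm (x + T *\<^sub>R axis i 1)"
          using norm_diff_ineq[of "T *\<^sub>R axis i (1::real) :: real^'n" x] by (simp add: add.commute)
        then have "f (x + T *\<^sub>R axis i 1) = 0" using True T by (intro supp) (simp add: T_def)
        ultimately have "f x = - (T * g (x + t *\<^sub>R axis i 1))" by simp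
        then have "\<bar>f x\<bar> = T * \<bar>g (x + t *\<^sub>R axis i 1)\<bar>" using T by (simp add: abs_mult)
        also have "\<dots> \<le> T * G" using T G by (intro mult_left_mono) auto
        finally show ?thesis using True G0 by (simp add: T_def)
      qed (use supp in auto)
    qed
  qed auto
  have "(\<lambda>n. integral\<^sup>L lborel (q n)) \<longlonglongrightarrow> integral\<^sup>L lborel g"
  proof (rule integral_dominated_convergence)
    show "integrable lborel (\<lambda>x. indicator (cball 0 (R + 1)) x *\<^sub>R G)"
      by (rule borel_integrable_compact) auto
    show "AE x in lborel. norm (q n x) \<le> indicator (cball 0 (R + 1)) x *\<^sub>R G" for n
      by (rule AE_I2) (use bound qsupp G0 in \<open>auto simp: indicator_def not_le\<close>)
    show "AE x in lborel. (\<lambda>n. q n x) \<longlonglongrightarrow> g x"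
    proof (rule AE_I2)
      fix x
      have "((\<lambda>t. f (x + t *\<^sub>R axis i 1)) has_real_derivative g x) (at 0)"
        using der[of x] by (simp add: has_pd_def has_real_derivative_iff_has_vector_derivative)
      then have "((\<lambda>t. (f (x + t *\<^sub>R axis i 1) - f x) / t) \<longlongrightarrow> g x) (at 0)"
        by (simp add: has_field_derivative_iff)
      moreover have "filterlim h (at 0) sequentially"
        using h h0 by (auto simp: filterlim_at intro!: always_eventually) (metis less_irrefl)
      ultimately show "(\<lambda>n. q n x) \<longlonglongrightarrow> g x"
        unfolding q_def by (rule filterlim_compose)
    qed
  qed auto
  moreover have "integral\<^sup>L lborel (q n) = 0" for n
  proof -
    have "integrable lborel (\<lambda>x. f (x + h n *\<^sub>R axis i 1))"
      using fi integrable_distr_eq[of "(+) (h n *\<^sub>R axis i 1)" lborel borel f]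
      by (simp add: lborel_distr_plus add.commute)
    then have "integral\<^sup>L lborel (q n) = ((LBINT x. f (x + h n *\<^sub>R axis i 1)) - integral\<^sup>L lborel f) / h n"
      unfolding q_def using fi by simp
    then show ?thesis using lborel_integral_translate[OF f] by simp
  qed
  ultimately have "(\<lambda>n. 0) \<longlonglongrightarrow> integral\<^sup>L lborel g" by simp
  then show ?thesis by (simp add: LIMSEQ_const_iff)
qed

text \<open>The weights come from squared positive parts and from antiderivatives, so one continuous
  derivative is all they are guaranteed to have. Carrying the partial derivatives as an explicit
  family keeps product rules and supports computable.\<close>

definition C1_fun :: "(real^'n::finite \<Rightarrow> real) \<Rightarrow> ('n \<Rightarrow> real^'n \<Rightarrow> real) \<Rightarrow> bool"
  where "C1_fun w w' \<longleftrightarrow> continuous_on UNIV w \<and>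
    (\<forall>i. continuous_on UNIV (w' i) \<and> (\<forall>x. has_pd i w (w' i x) x))"

lemma C1_fun_mult:
  assumes "C1_fun w w'" "C1_fun z z'"
  shows "C1_fun (\<lambda>x. w x * z x) (\<lambda>i x. w x * z' i x + w' i x * z x)"
  using assms unfolding C1_fun_def by (auto intro!: continuous_intros has_pd_mult)

lemma C1_fun_pd_eq_0:
  assumes "C1_fun w w'" "closed K" "\<And>x. x \<notin> K \<Longrightarrow> w x = 0" "x \<notin> K"
  shows "w' i x = 0"
proof -
  have "has_pd i w 0 x"
    by (rule has_pd_transform[OF has_pd_const, of "- K" x 0]) (use assms in auto)
  moreover have "has_pd i w (w' i x) x" using assms by (simp add: C1_fun_def)
  ultimately show ?thesis by (metis has_pd_unique)
qed

text \<open>The open sets \<open>U\<close> and \<open>- K\<close> cover the space and the product is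
  continuous on each, being zero on the second. This lets functions controlled only inside the disk
  be integrated over the whole plane.\<close>

lemma continuous_on_cutoff_mult:
  fixes w h :: "'a::topological_space \<Rightarrow> real"
  assumes "open U" "closed K" "K \<subseteq> U" "continuous_on UNIV w" "\<And>x. x \<notin> K \<Longrightarrow> w x = 0" "continuous_on U h"
  shows "continuous_on UNIV (\<lambda>x. w x * h x)"
proof -
  have "continuous_on U (\<lambda>x. w x * h x)"
    by (intro continuous_intros assms continuous_on_subset[OF assms(4)]) auto
  moreover have "continuous_on (- K) (\<lambda>x. w x * h x)"
    by (rule continuous_on_eq[of _ "\<lambda>_. 0"]) (use assms in auto)
  ultimately have "continuous_on (U \<union> - K) (\<lambda>x. w x * h x)"
    by (intro continuous_on_open_Un) (use assms in auto)
  moreover have "U \<union> - K = UNIV" using assms by auto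
  ultimately show ?thesis by simp
qed

lemma integrable_continuous_compact_support:
  fixes f :: "'a::euclidean_space \<Rightarrow> real"
  assumes "compact K" "continuous_on UNIV f" "\<And>x. x \<notin> K \<Longrightarrow> f x = 0"
  shows "integrable lborel f"
proof -
  have "integrable lborel (\<lambda>x. indicator K x *\<^sub>R f x)"
    by (rule borel_integrable_compact[OF assms(1) continuous_on_subset[OF assms(2)]]) simp
  moreover have "(\<lambda>x. indicator K x *\<^sub>R f x) = f" by (rule ext) (use assms(3) in \<open>auto simp: indicator_def\<close>)
  ultimately show ?thesis by simp
qed

lemma integrable_cutoff_mult:
  fixes w h :: "'a::euclidean_space \<Rightarrow> real"
  assumes "open U" "compact K" "K \<subseteq> U" "continuous_on UNIV w" "\<And>x. x \<notin> K \<Longrightarrow> w x = 0" "continuous_on U h"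
  shows "integrable lborel (\<lambda>x. w x * h x)"
  using assms
  by (intro integrable_continuous_compact_support[of K] continuous_on_cutoff_mult[of U K] compact_imp_closed) auto

lemma cutoff_integration_by_parts:
  fixes w h :: "real^'n \<Rightarrow> real"
  assumes U: "open U" and K: "compact K" "K \<subseteq> U" and w: "C1_fun w w'" "\<And>x. x \<notin> K \<Longrightarrow> w x = 0"
    and h: "continuous_on U h" "continuous_on U h'" "\<And>x. x \<in> U \<Longrightarrow> has_pd i h (h' x) x"
  shows "(LBINT x. w x * h' x) = - (LBINT x. w' i x * h x)"
proof -
  have w'0: "w' j x = 0" if "x \<notin> K" for j x
    using C1_fun_pd_eq_0[OF w(1) compact_imp_closed[OF K(1)] w(2) that] .
  note c = w(1)[unfolded C1_fun_def, THEN conjunct1] w(1)[unfolded C1_fun_def, THEN conjunct2, rule_format, THEN conjunct1]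
  define g where "g x = w x * h' x + w' i x * h x" for x
  have i: "integrable lborel (\<lambda>x. w x * h' x)" "integrable lborel (\<lambda>x. w' i x * h x)"
    using U K w w'0 h c by (auto intro!: integrable_cutoff_mult[of U K])
  have cl: "closed K" using K compact_imp_closed by auto
  have gc: "continuous_on UNIV g" unfolding g_def
    by (intro continuous_on_add continuous_on_cutoff_mult[OF U cl K(2)] c w(2) w'0 h) auto
  have fc: "continuous_on UNIV (\<lambda>x. w x * h x)"
    by (intro continuous_on_cutoff_mult[OF U cl K(2)] c w(2) h) auto
  have g0: "g x = 0" if "x \<notin> K" for x using that w(2) w'0 by (simp add: g_def)
  have "bounded (g ` K)"
    using gc K by (meson compact_continuous_image compact_imp_bounded continuous_on_subset subset_UNIV)
  then obtain G where G: "\<And>x. x \<in> K \<Longrightarrow> \<bar>g x\<bar> \<le> G" unfolding bounded_iff by auto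
  obtain R where R: "\<And>x. x \<in> K \<Longrightarrow> norm x \<le> R"
    using K(1) compact_imp_bounded bounded_iff by metis
  have "integral\<^sup>L lborel g = 0"
  proof (rule integral_pd_eq_0)
    show "has_pd i (\<lambda>x. w x * h x) (g x) x" for x
    proof (cases "x \<in> K")
      case True
      then show ?thesis unfolding g_def
        by (intro has_pd_mult h) (use K w in \<open>auto simp: C1_fun_def\<close>)
    next
      case False
      have "has_pd i (\<lambda>x. w x * h x) 0 x"
        by (rule has_pd_transform[OF has_pd_const, of "- K" x 0]) (use cl w(2) False in auto)
      then show ?thesis using g0 False by simp
    qed
    show "\<bar>g x\<bar> \<le> max 0 G" for x using g0[of x] G[of x] by (cases "x \<in> K") auto
    show "norm x > R \<Longrightarrow> w x * h x = 0" for x using R[of x] w(2)[of x] by (cases "x \<in> K") auto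
  qed (use gc fc borel_measurable_continuous_onI in auto)
  then show ?thesis using i unfolding g_def by simp
qed

subsection \<open>A mean value inequality\<close>

lemma DERIV_pos_part_sq: "((\<lambda>s. (max 0 s)\<^sup>2) has_real_derivative 2 * max 0 s) (at (s::real))"
proof -
  consider "s > 0" | "s < 0" | "s = 0" by linarith
  then show ?thesis
  proof cases
    case 1
    have "((\<lambda>s. s\<^sup>2) has_real_derivative 2 * s) (at s)" by (auto intro!: derivative_eq_intros)
    then show ?thesis
      by (rule DERIV_cong_ev[THEN iffD1, OF refl _ _ , rotated 2])
         (use 1 eventually_nhds_in_open[of "{0<..}" s] in \<open>auto elim: eventually_mono\<close>)
  next
    case 2
    have "((\<lambda>s. 0) has_real_derivative 0) (at s)" by simp
    then show ?thesis
      by (rule DERIV_cong_ev[THEN iffD1, OF refl _ _ , rotated 2])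
         (use 2 eventually_nhds_in_open[of "{..<0}" s] in \<open>auto elim: eventually_mono\<close>)
  next
    case 3
    have "((\<lambda>h. (max 0 h)\<^sup>2 / h) \<longlongrightarrow> 0) (at (0::real))"
    proof (rule Lim_null_comparison)
      show "\<forall>\<^sub>F h in at (0::real). norm ((max 0 h)\<^sup>2 / h) \<le> \<bar>h\<bar>"
        by (rule always_eventually) (auto simp: max_def power2_eq_square)
    qed (auto intro!: tendsto_eq_intros)
    then show ?thesis using 3 by (simp add: has_field_derivative_iff)
  qed
qed

text \<open>The point of this profile is that the gradient of its square is -4 y
  \<open>bump \<rho> y\<close>. Thus the square is C^1 across the sphere, and the field y
  \<open>bump \<rho> y\<close> is a gradient, as the mean value inequality requires.\<close>

definition bump :: "real \<Rightarrow> real^'n \<Rightarrow> real"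
  where "bump \<rho> y = max 0 (\<rho>\<^sup>2 - (norm y)\<^sup>2)"

lemma bump_nonneg: "bump \<rho> y \<ge> 0" by (simp add: bump_def)

lemma bump_le: "bump \<rho> y \<le> \<rho>\<^sup>2" by (simp add: bump_def)

lemma bump_eq_0: "\<rho> \<ge> 0 \<Longrightarrow> y \<notin> ball 0 \<rho> \<Longrightarrow> bump \<rho> y = 0"
  by (auto simp: bump_def not_less intro!: power_mono)

lemma continuous_on_bump: "continuous_on A (bump \<rho>)"
  unfolding bump_def by (intro continuous_intros)

lemma has_pd_bump_sq:
  "has_pd i (\<lambda>x. (bump \<rho> (x - x0))\<^sup>2) (- 4 * (x $ i - x0 $ i) * bump \<rho> (x - x0)) x"
proof -
  have "has_pd i (\<lambda>x. \<rho>\<^sup>2 - (norm (x - x0))\<^sup>2) (0 - 2 * (x $ i - x0 $ i)) x"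
    by (intro has_pd_diff has_pd_const has_pd_norm_sq_diff)
  from has_pd_compose_DERIV[OF this DERIV_pos_part_sq] show ?thesis
    unfolding bump_def by (simp add: algebra_simps)
qed

lemma C1_fun_bump_sq:
  "C1_fun (\<lambda>x. (bump \<rho> (x - x0))\<^sup>2) (\<lambda>i x. - 4 * (x $ i - x0 $ i) * bump \<rho> (x - x0))"
  unfolding C1_fun_def
  by (intro conjI allI has_pd_bump_sq continuous_intros continuous_on_compose2[OF continuous_on_bump[of UNIV]]) auto

lemma bump_integral_pos:
  assumes "\<rho> > 0"
  shows "integral\<^sup>L lborel (bump \<rho> :: real^'n \<Rightarrow> real) > 0"
proof -
  have int: "integrable lborel (bump \<rho> :: real^'n \<Rightarrow> real)"
    by (rule integrable_continuous_compact_support[of "cball 0 \<rho>"])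
       (use assms continuous_on_bump in \<open>auto intro!: bump_eq_0\<close>)
  have "0 < \<rho>\<^sup>2 / 2 * measure lborel (ball (0::real^'n) (\<rho> / 2))"
    using assms content_ball_pos[of "\<rho>/2" "0::real^'n"] by simp
  also have "\<dots> = (LBINT x::real^'n. \<rho>\<^sup>2 / 2 * indicator (ball 0 (\<rho> / 2)) x)"
    by simp
  also have "\<dots> \<le> integral\<^sup>L lborel (bump \<rho> :: real^'n \<Rightarrow> real)"
  proof (rule integral_mono[OF _ int])
    fix x :: "real^'n"
    have "\<rho>\<^sup>2 / 2 \<le> \<rho>\<^sup>2 - (norm x)\<^sup>2" if "norm x < \<rho> / 2"
    proof -
      have "(norm x)\<^sup>2 \<le> (\<rho> / 2)\<^sup>2" using that by (intro power_mono) auto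
      then have "(norm x)\<^sup>2 \<le> \<rho>\<^sup>2 / 4" by (simp add: power_divide)
      then show ?thesis using zero_le_power2[of \<rho>] by linarith
    qed
    moreover have "\<rho>\<^sup>2 - (norm x)\<^sup>2 \<le> bump \<rho> x" by (simp add: bump_def)
    ultimately show "\<rho>\<^sup>2 / 2 * indicator (ball 0 (\<rho> / 2)) x \<le> bump \<rho> x"
      using bump_nonneg[of \<rho> x] by (cases "norm x < \<rho> / 2") auto
  next
    show "integrable lborel (\<lambda>x::real^'n. \<rho>\<^sup>2 / 2 * indicator (ball 0 (\<rho> / 2)) x)"
      by (intro integrable_mult_right integrable_real_indicator) (use emeasure_lborel_ball_finite in auto)
  qed
  finally show ?thesis .
qed

lemma has_pd_affine:
  assumes "has_pd i g d (x0 + r *\<^sub>R y)"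
  shows "has_pd i (\<lambda>y. g (x0 + r *\<^sub>R y)) (r *\<^sub>R d) y"
proof -
  have "((\<lambda>t. g (x0 + r *\<^sub>R y + t *\<^sub>R axis i 1)) has_vector_derivative d) (at (r * 0))"
    using assms by (simp add: has_pd_def)
  then have "((\<lambda>t. g (x0 + r *\<^sub>R y + t *\<^sub>R axis i 1)) \<circ> (\<lambda>t. r * t) has_vector_derivative r *\<^sub>R d) (at 0)"
    by (intro vector_diff_chain_at) (auto intro!: derivative_eq_intros)
  then show ?thesis by (simp add: has_pd_def o_def algebra_simps)
qed

lemma integral_cbox_eq_lborel:
  fixes f :: "'a::euclidean_space \<Rightarrow> real"
  assumes "continuous_on UNIV f" "\<And>x. x \<notin> cbox a b \<Longrightarrow> f x = 0"
  shows "integral (cbox a b) f = integral\<^sup>L lborel f"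
proof -
  have "integrable lborel f" using assms by (intro integrable_continuous_compact_support[of "cbox a b"]) auto
  moreover have eq: "(\<lambda>x. indicator (cbox a b) x *\<^sub>R f x) = f" using assms(2) by (auto simp: indicator_def fun_eq_iff)
  ultimately have "set_integrable lborel (cbox a b) f" by (simp add: set_integrable_def)
  from set_borel_integral_eq_integral(2)[OF this] show ?thesis
    by (simp only: set_lebesgue_integral_def eq)
qed

text \<open>Let I(r) be the integral of \<open>bump \<rho> y * f (x0 + r *\<^sub>R y)\<close>. Its
  derivative is the integral of \<open>bump \<rho> y\<close> times y . grad f; since y
  \<open>bump \<rho> y\<close> is -1/4 of the gradient of the squared bump, integration by parts
  turns it into r/4 times the integral of the squared bump against the Laplacian. Integrating the
  lower bound from r = 0 to r = 1 gives the claim.\<close>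

lemma mean_value_inequality:
  fixes f :: "real^'n \<Rightarrow> real"
  assumes \<rho>: "\<rho> > 0" and U: "open U"
    and inU: "\<And>y. (\<forall>i. \<bar>y $ i\<bar> \<le> \<rho>) \<Longrightarrow> x0 + y \<in> U"
    and fd: "\<And>y. y \<in> U \<Longrightarrow> (f has_derivative (\<lambda>v. \<Sum>i\<in>UNIV. v $ i * f1 i y)) (at y)"
    and f1: "\<And>i. continuous_on U (f1 i)" "\<And>i y. y \<in> U \<Longrightarrow> has_pd i (f1 i) (f2 i y) y"
    and f2: "\<And>i. continuous_on U (f2 i)" "\<And>y. y \<in> U \<Longrightarrow> (\<Sum>i\<in>UNIV. f2 i y) \<ge> - L" and L: "L \<ge> 0"
  shows "f x0 * integral\<^sup>L lborel (bump \<rho> :: real^'n \<Rightarrow> real) \<le>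
    (LBINT y. bump \<rho> y * f (x0 + y)) +
    L * (LBINT y::real^'n. (bump \<rho> y)\<^sup>2 / 4)"
proof -
  \<comment> \<open>Differentiation under the integral sign is performed over a box; the bump
    vanishes outside the inscribed ball, so nothing changes.\<close>
  define a where "a = (\<chi> i. - \<rho> :: real^'n)"
  define b where "b = (\<chi> i. \<rho> :: real^'n)"
  have box: "y \<in> cbox a b \<longleftrightarrow> (\<forall>i. \<bar>y $ i\<bar> \<le> \<rho>)" for y
    unfolding a_def b_def mem_box_cart by (auto simp: abs_le_iff minus_le_iff)
  have cbox: "y \<in> cbox a b" if "y \<in> cball 0 \<rho>" for y
    using that component_le_norm_cart[of y] order_trans by (fastforce simp: box)
  have zero: "bump \<rho> y = 0" if "y \<notin> cball 0 \<rho>" for y :: "real^'n"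
    using bump_eq_0[of \<rho> y] that \<rho> by auto
  have fc: "continuous_on U f"
    by (intro continuous_at_imp_continuous_on ballI has_derivative_continuous[OF fd])
  define Ur where "Ur r = (\<lambda>y. x0 + r *\<^sub>R y) -` U" for r :: real
  have Uro: "open (Ur r)" for r unfolding Ur_def by (intro open_vimage U continuous_intros)
  have inUr: "x0 + r *\<^sub>R y \<in> U" if "r \<in> {0..1}" "y \<in> cbox a b" for r y
    by (rule inU) (use that in \<open>auto simp: box abs_mult intro!: order_trans[OF mult_left_le_one_le]\<close>)
  have KUr: "cball 0 \<rho> \<subseteq> Ur r" if "r \<in> {0..1}" for r
    using inUr[OF that] cbox by (auto simp: Ur_def)
  have cUr: "continuous_on (Ur r) (\<lambda>y. k (x0 + r *\<^sub>R y))" if "continuous_on U k" for k :: "real^'n \<Rightarrow> real" and r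
    by (rule continuous_on_compose2[OF that]) (auto intro!: continuous_intros simp: Ur_def)
  have cprod: "continuous_on ({0..1} \<times> cbox a b) (\<lambda>z. k (x0 + fst z *\<^sub>R snd z))" if "continuous_on U k" for k :: "real^'n \<Rightarrow> real"
    by (rule continuous_on_compose2[OF that]) (auto intro!: continuous_intros inUr)
  define F' where "F' r y = bump \<rho> y * (\<Sum>i\<in>UNIV. y $ i * f1 i (x0 + r *\<^sub>R y))" for r y
  define I where "I r = integral (cbox a b) (\<lambda>y. bump \<rho> y * f (x0 + r *\<^sub>R y))" for r
  have I_eq: "I r = (LBINT y. bump \<rho> y * f (x0 + r *\<^sub>R y))" if r: "r \<in> {0..1}" for r
    unfolding I_def
    by (rule integral_cbox_eq_lborel, rule continuous_on_cutoff_mult[OF Uro[of r] _ KUr[OF r]])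
       (use zero cbox continuous_on_bump cUr[OF fc] in auto)
  have dI: "(I has_real_derivative integral (cbox a b) (F' r)) (at r within {0..1})" if r: "r \<in> {0..1}" for r
    unfolding I_def
  proof (rule leibniz_rule_field_derivative[OF _ _ _ r])
    fix r y assume r: "r \<in> {0..1::real}" and y: "y \<in> cbox a b"
    have "((\<lambda>r. x0 + r *\<^sub>R y) has_derivative (\<lambda>h. h *\<^sub>R y)) (at r)"
      by (auto intro!: derivative_eq_intros)
    then have "(f \<circ> (\<lambda>r. x0 + r *\<^sub>R y) has_derivative (\<lambda>v. \<Sum>i\<in>UNIV. v $ i * f1 i (x0 + r *\<^sub>R y)) \<circ> (\<lambda>h. h *\<^sub>R y)) (at r)"
      by (rule diff_chain_at) (rule fd[OF inUr[OF r y]])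
    moreover have "(\<lambda>v. \<Sum>i\<in>UNIV. v $ i * f1 i (x0 + r *\<^sub>R y)) \<circ> (\<lambda>h. h *\<^sub>R y) = (*) (\<Sum>i\<in>UNIV. y $ i * f1 i (x0 + r *\<^sub>R y))"
      by (auto simp: fun_eq_iff sum_distrib_left sum_distrib_right algebra_simps)
    ultimately have "((\<lambda>r. f (x0 + r *\<^sub>R y)) has_real_derivative (\<Sum>i\<in>UNIV. y $ i * f1 i (x0 + r *\<^sub>R y))) (at r)"
      by (simp add: has_field_derivative_def o_def)
    then show "((\<lambda>r. bump \<rho> y * f (x0 + r *\<^sub>R y)) has_real_derivative F' r y) (at r within {0..1})"
      unfolding F'_def by (intro DERIV_cmult) (rule has_field_derivative_at_within)
  next
    fix r :: real assume r: "r \<in> {0..1}"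
    have "continuous_on UNIV (\<lambda>y. bump \<rho> y * f (x0 + r *\<^sub>R y))"
      by (rule continuous_on_cutoff_mult[OF Uro[of r] _ KUr[OF r]])
         (use zero continuous_on_bump cUr[OF fc] in auto)
    then show "(\<lambda>y. bump \<rho> y * f (x0 + r *\<^sub>R y)) integrable_on cbox a b"
      by (intro integrable_continuous) (rule continuous_on_subset, auto)
  next
    have "continuous_on ({0..1} \<times> cbox a b) (\<lambda>z. bump \<rho> (snd z))"
      by (rule continuous_on_compose2[OF continuous_on_bump[of UNIV]]) (auto intro!: continuous_intros)
    then show "continuous_on ({0..1} \<times> cbox a b) (\<lambda>(r, y). F' r y)"
      unfolding F'_def case_prod_beta by (intro continuous_intros cprod f1)
  qed auto
  define J where "J = (LBINT y::real^'n. (bump \<rho> y)\<^sup>2 / 4)"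
  have w: "C1_fun (\<lambda>y::real^'n. (bump \<rho> y)\<^sup>2) (\<lambda>i y. - 4 * y $ i * bump \<rho> y)"
    using C1_fun_bump_sq[of \<rho> 0] by simp
  have J0: "J \<ge> 0" unfolding J_def by (intro integral_nonneg_AE) auto
  have F'_ge: "integral (cbox a b) (F' r) \<ge> - L * J" if r: "r \<in> {0..1}" for r
  proof -
    have int1: "integrable lborel (\<lambda>y. (- 4 * y $ i * bump \<rho> y) * f1 i (x0 + r *\<^sub>R y))" for i
      by (rule integrable_cutoff_mult[OF Uro[of r] _ KUr[OF r]])
         (use zero w cUr[OF f1(1)] in \<open>auto simp: C1_fun_def\<close>)
    have int2: "integrable lborel (\<lambda>y. (bump \<rho> y)\<^sup>2 * (r * f2 i (x0 + r *\<^sub>R y)))" for i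
      by (rule integrable_cutoff_mult[OF Uro[of r] _ KUr[OF r]])
         (use zero w cUr[OF f2(1)] in \<open>auto simp: C1_fun_def intro!: continuous_intros\<close>)
    have F'c: "continuous_on UNIV (F' r)" unfolding F'_def
      by (rule continuous_on_cutoff_mult[OF Uro[of r] _ KUr[OF r]])
         (use zero cUr[OF f1(1)] continuous_on_bump in \<open>auto intro!: continuous_intros\<close>)
    \<comment> \<open>The factor -1/4 exposes the partial derivatives of the squared bump as
      weights.\<close>
    have F'_eq: "F' r = (\<lambda>y. \<Sum>i\<in>UNIV. - (1/4) * ((- 4 * y $ i * bump \<rho> y) * f1 i (x0 + r *\<^sub>R y)))"
      unfolding F'_def by (auto simp: fun_eq_iff sum_distrib_left algebra_simps)
    have "integral (cbox a b) (F' r) = integral\<^sup>L lborel (F' r)"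
      by (rule integral_cbox_eq_lborel[OF F'c]) (use zero cbox in \<open>auto simp: F'_def\<close>)
    also have "integral\<^sup>L lborel (F' r) = (\<Sum>i\<in>UNIV. - (1/4) * (LBINT y. (- 4 * y $ i * bump \<rho> y) * f1 i (x0 + r *\<^sub>R y)))"
      unfolding F'_eq
      by (subst Bochner_Integration.integral_sum; (intro integrable_mult_right int1)?)
         (simp only: integral_mult_right_zero)
    also have "\<dots> = (\<Sum>i\<in>UNIV. 1/4 * (LBINT y. (bump \<rho> y)\<^sup>2 * (r * f2 i (x0 + r *\<^sub>R y))))"
    proof (rule sum.cong[OF refl])
      fix i
      have "(LBINT y. (bump \<rho> y)\<^sup>2 * (r * f2 i (x0 + r *\<^sub>R y)))
        = - (LBINT y. (- 4 * y $ i * bump \<rho> y) * f1 i (x0 + r *\<^sub>R y))"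
      proof (rule cutoff_integration_by_parts[OF Uro[of r] _ KUr[OF r] w])
        show "has_pd i (\<lambda>y. f1 i (x0 + r *\<^sub>R y)) (r * f2 i (x0 + r *\<^sub>R y)) y" if "y \<in> Ur r" for y
          using has_pd_affine[OF f1(2)] that by (simp add: Ur_def)
      qed (use zero cUr[OF f1(1)] cUr[OF f2(1)] in \<open>auto intro!: continuous_intros\<close>)
      then show "- (1/4) * (LBINT y. (- 4 * y $ i * bump \<rho> y) * f1 i (x0 + r *\<^sub>R y)) =
        1/4 * (LBINT y. (bump \<rho> y)\<^sup>2 * (r * f2 i (x0 + r *\<^sub>R y)))" by simp
    qed
    also have "\<dots> = (LBINT y. \<Sum>i\<in>UNIV. 1/4 * ((bump \<rho> y)\<^sup>2 * (r * f2 i (x0 + r *\<^sub>R y))))"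
      using int2 by (subst Bochner_Integration.integral_sum) auto
    also have "\<dots> \<ge> (LBINT y::real^'n. - L * ((bump \<rho> y)\<^sup>2 / 4))"
    proof (rule integral_mono)
      show "integrable lborel (\<lambda>y::real^'n. - L * ((bump \<rho> y)\<^sup>2 / 4))"
        by (rule integrable_continuous_compact_support[of "cball 0 \<rho>"])
           (use zero continuous_on_bump in \<open>auto intro!: continuous_intros\<close>)
      show "integrable lborel (\<lambda>y. \<Sum>i\<in>UNIV. 1/4 * ((bump \<rho> y)\<^sup>2 * (r * f2 i (x0 + r *\<^sub>R y))))"
        using int2 by auto
      fix y :: "real^'n"
      show "- L * ((bump \<rho> y)\<^sup>2 / 4) \<le> (\<Sum>i\<in>UNIV. 1/4 * ((bump \<rho> y)\<^sup>2 * (r * f2 i (x0 + r *\<^sub>R y))))"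
      proof (cases "y \<in> cball 0 \<rho>")
        case True
        have "r * (\<Sum>i\<in>UNIV. f2 i (x0 + r *\<^sub>R y)) \<ge> r * (- L)"
          using r f2(2)[OF inUr[OF r cbox[OF True]]] by (intro mult_left_mono) auto
        also have "r * (- L) \<ge> - L" using r L mult_right_mono[of r 1 L] by simp
        finally have "(bump \<rho> y)\<^sup>2 / 4 * (- L) \<le> (bump \<rho> y)\<^sup>2 / 4 * (r * (\<Sum>i\<in>UNIV. f2 i (x0 + r *\<^sub>R y)))"
          by (intro mult_left_mono) auto
        moreover have "(\<Sum>i\<in>UNIV. 1/4 * ((bump \<rho> y)\<^sup>2 * (r * f2 i (x0 + r *\<^sub>R y))))
          = (bump \<rho> y)\<^sup>2 / 4 * (r * (\<Sum>i\<in>UNIV. f2 i (x0 + r *\<^sub>R y)))"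
          by (simp add: sum_distrib_left)
        ultimately show ?thesis by (simp add: mult.commute)
      qed (use zero in auto)
    qed
    finally show ?thesis by (simp add: J_def)
  qed
  have "\<exists>r\<in>{0..1}. I 1 - I 0 = integral (cbox a b) (F' r) * (1 - 0)"
    using mvt_very_simple[of 0 1 I "\<lambda>r. (*) (integral (cbox a b) (F' r))"] dI
    by (auto simp: has_field_derivative_def)
  then have "I 1 - I 0 \<ge> - L * J" using F'_ge by fastforce
  moreover have "I 0 = f x0 * integral\<^sup>L lborel (bump \<rho> :: real^'n \<Rightarrow> real)"
    by (subst I_eq) (auto simp: mult.commute)
  ultimately show ?thesis using I_eq[of 1] by (simp add: J_def)
qed

subsection \<open>The potential\<close>

lemma continuous_on_compact_bounded:
  assumes "compact K" "continuous_on K f"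
  obtains B where "\<And>y. y \<in> K \<Longrightarrow> norm (f y) \<le> B"
  using compact_imp_bounded[OF compact_continuous_image[OF assms(2,1)]] unfolding bounded_iff
  by (metis imageI)

lemma grad_inner:
  assumes "V differentiable (at y)"
  shows "grad V y \<bullet> v = (\<Sum>i\<in>UNIV. v $ i *\<^sub>R partial_diff i V y)"
  by (simp add: grad_def inner_vec_def mult.commute)

lemma smooth_grad_continuous:
  assumes "smooth_on UNIV V"
  shows "continuous_on A (grad V)"
  unfolding grad_def
  by (rule continuous_on_subset[of UNIV], intro continuous_on_vec_lambda)
     (auto intro: smooth_on_continuous_on smooth_on_partial_diff assms)

lemma smooth_hessian_continuous:
  assumes "smooth_on UNIV V"
  shows "continuous_on A (\<lambda>y. hessian V y $ i $ j)"
  unfolding hessian_def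
  by (rule continuous_on_subset[of UNIV])
     (auto intro: smooth_on_continuous_on smooth_on_partial_diff assms)

lemma has_vector_derivative_grad_chain:
  assumes V: "smooth_on UNIV V" and c: "(c has_vector_derivative c') (at t)"
  shows "((\<lambda>t. V (c t)) has_real_derivative grad V (c t) \<bullet> c') (at t)"
    and "((\<lambda>t. grad V (c t)) has_vector_derivative c' v* hessian V (c t)) (at t)"
proof -
  have *: "((\<lambda>t. f (c t)) has_vector_derivative (\<Sum>i\<in>UNIV. c' $ i *\<^sub>R partial_diff i f (c t))) (at t)"
    if f: "smooth_on UNIV f" for f :: "real^'a \<Rightarrow> real"
  proof -
    have "f differentiable (at (c t))" using f by (simp add: smooth_on_differentiable)
    from has_derivative_partial[OF this]
    have "(f \<circ> c has_derivative (\<lambda>v. \<Sum>i\<in>UNIV. v $ i *\<^sub>R partial_diff i f (c t)) \<circ> (\<lambda>h. h *\<^sub>R c')) (at t)"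
      using c unfolding has_vector_derivative_def by (intro diff_chain_at)
    moreover have "(\<lambda>v. \<Sum>i\<in>UNIV. v $ i *\<^sub>R partial_diff i f (c t)) \<circ> (\<lambda>h. h *\<^sub>R c') =
      (\<lambda>h. h *\<^sub>R (\<Sum>i\<in>UNIV. c' $ i *\<^sub>R partial_diff i f (c t)))"
      by (auto simp: fun_eq_iff sum_distrib_left algebra_simps)
    ultimately show ?thesis by (simp add: has_vector_derivative_def o_def)
  qed
  show "((\<lambda>t. V (c t)) has_real_derivative grad V (c t) \<bullet> c') (at t)"
    using *[OF V] grad_inner[of V "c t" c'] V
    by (simp add: smooth_on_differentiable has_real_derivative_iff_has_vector_derivative)
  have "((\<lambda>t. \<chi> j. partial_diff j V (c t)) has_vector_derivative
      (\<chi> j. \<Sum>i\<in>UNIV. c' $ i *\<^sub>R partial_diff i (partial_diff j V) (c t))) (at t)"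
    using *[OF smooth_on_partial_diff[OF V]] unfolding has_vector_derivative_def
    by (subst has_derivative_componentwise_within) (auto simp: Basis_vec_def inner_axis)
  then show "((\<lambda>t. grad V (c t)) has_vector_derivative c' v* hessian V (c t)) (at t)"
    by (simp add: grad_def vector_matrix_mult_def hessian_def mult.commute)
qed

lemma has_pd_compose_potential:
  assumes "smooth_on UNIV V" "has_pd i u a x"
  shows "has_pd i (\<lambda>x. V (u x)) (grad V (u x) \<bullet> a) x"
    and "has_pd i (\<lambda>x. grad V (u x)) (a v* hessian V (u x)) x"
  using has_vector_derivative_grad_chain[OF assms(1) assms(2)[unfolded has_pd_def]]
  by (auto simp: has_pd_def has_real_derivative_iff_has_vector_derivative)

lemma multi_well_nonneg:
  assumes "multi_well_potential V"
  shows "V y \<ge> 0"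
  using assms cInf_lower[of "V y" "range V"] by (auto simp: multi_well_potential_def)

text \<open>Along a ray the derivative of V is at least \<alpha> s once the coercivity condition
  applies, so integration from a fixed radius, where V \<ge> 0, gives quadratic growth. The constant
  \<open>Q\<close> absorbs what happens on a compact ball.\<close>

lemma multi_well_growth:
  fixes V :: "real^'k \<Rightarrow> real"
  assumes V: "multi_well_potential V"
  obtains \<alpha> Q where "\<alpha> > 0" "Q \<ge> 0" "\<And>y. y \<bullet> grad V y \<ge> \<alpha> * (norm y)\<^sup>2 - Q"
    "\<And>y. V y \<ge> \<alpha> / 2 * (norm y)\<^sup>2 - Q"
proof -
  have sm: "smooth_on UNIV V" using V by (simp add: multi_well_potential_def)
  obtain \<alpha> R where \<alpha>: "\<alpha> > 0" and R: "R > 0"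
    and co: "\<And>y. norm y > R \<Longrightarrow> y \<bullet> grad V y \<ge> \<alpha> * (norm y)\<^sup>2"
    using V by (auto simp: multi_well_potential_def)
  have "continuous_on (cball 0 R) (\<lambda>y. y \<bullet> grad V y)"
    by (intro continuous_intros smooth_grad_continuous sm)
  from continuous_on_compact_bounded[OF compact_cball this]
  obtain Q1 where "\<And>y. y \<in> cball 0 R \<Longrightarrow> norm (y \<bullet> grad V y) \<le> Q1" by blast
  then have Q1: "\<And>y. norm y \<le> R \<Longrightarrow> \<bar>y \<bullet> grad V y\<bar> \<le> Q1" by simp
  have Q10: "Q1 \<ge> 0" using Q1[of 0] R by simp
  \<comment> \<open>Coercivity holds only for norms strictly above \<open>R\<close>, so the radial
    integration starts at a larger radius, where it also covers the endpoint.\<close>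
  define R' where "R' = R + 1"
  define Q where "Q = Q1 + \<alpha> * R'\<^sup>2"
  have R': "R' > R" "R' > 0" using R by (auto simp: R'_def)
  have Q: "Q \<ge> Q1" "Q \<ge> \<alpha> * R'\<^sup>2" using \<alpha> Q10 by (auto simp: Q_def)
  have a: "y \<bullet> grad V y \<ge> \<alpha> * (norm y)\<^sup>2 - Q" for y
  proof (cases "norm y > R")
    case True
    then show ?thesis using co[OF True] Q Q10 by linarith
  next
    case False
    then have "\<alpha> * (norm y)\<^sup>2 \<le> \<alpha> * R'\<^sup>2" using \<alpha> R' by (intro mult_left_mono power_mono) auto
    then show ?thesis using Q1[of y] False by (auto simp: Q_def)
  qed
  have b: "V y \<ge> \<alpha> / 2 * (norm y)\<^sup>2 - Q" for y
  proof (cases "norm y > R'")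
    case False
    then have "\<alpha> * (norm y)\<^sup>2 \<le> \<alpha> * R'\<^sup>2" using \<alpha> R' by (intro mult_left_mono power_mono) auto
    moreover have "0 \<le> \<alpha> * (norm y)\<^sup>2" using \<alpha> by simp
    ultimately have "\<alpha> / 2 * (norm y)\<^sup>2 \<le> \<alpha> * R'\<^sup>2" by linarith
    then show ?thesis using multi_well_nonneg[OF V, of y] Q by linarith
  next
    case True
    define e where "e = (1 / norm y) *\<^sub>R y"
    have y0: "y \<noteq> 0" using True R' by auto
    then have ne: "norm e = 1" by (simp add: e_def)
    define g where "g s = V (s *\<^sub>R e) - \<alpha> / 2 * s\<^sup>2" for s
    have "g R' \<le> g (norm y)"
    proof (rule DERIV_nonneg_imp_nondecreasing[where f = g])
      show "R' \<le> norm y" using True by simp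
      fix s assume s: "R' \<le> s" "s \<le> norm y"
      have "((\<lambda>s. s *\<^sub>R e) has_vector_derivative e) (at s)" by (auto intro!: derivative_eq_intros)
      from has_vector_derivative_grad_chain(1)[OF sm this]
      have "(g has_real_derivative grad V (s *\<^sub>R e) \<bullet> e - \<alpha> * s) (at s)"
        unfolding g_def by (auto intro!: derivative_eq_intros)
      moreover have "grad V (s *\<^sub>R e) \<bullet> e - \<alpha> * s \<ge> 0"
      proof -
        have "s * (e \<bullet> grad V (s *\<^sub>R e)) \<ge> s * (\<alpha> * s)"
          using co[of "s *\<^sub>R e"] s R' ne by (simp add: power2_eq_square algebra_simps)
        then show ?thesis using s R' by (simp add: inner_commute)
      qed
      ultimately show "\<exists>y. (g has_real_derivative y) (at s) \<and> 0 \<le> y" by blast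
    qed
    moreover have "g (norm y) = V y - \<alpha> / 2 * (norm y)\<^sup>2" using y0 by (simp add: g_def e_def)
    moreover have "g R' \<ge> - Q"
    proof -
      have "0 \<le> \<alpha> * R'\<^sup>2" using \<alpha> by simp
      then show ?thesis using multi_well_nonneg[OF V, of "R' *\<^sub>R e"] Q by (simp add: g_def)
    qed
    ultimately show ?thesis by linarith
  qed
  show ?thesis by (rule that[OF \<alpha> _ a b]) (use Q Q10 in linarith)
qed

lemma quadratic_form_diff_le:
  fixes A B :: "real^'n^'n"
  shows "\<bar>v \<bullet> (A *v v) - v \<bullet> (B *v v)\<bar> \<le> (\<Sum>i\<in>UNIV. \<Sum>j\<in>UNIV. \<bar>A $ i $ j - B $ i $ j\<bar>) * (norm v)\<^sup>2"
proof -
  have "v \<bullet> (A *v v) - v \<bullet> (B *v v) = (\<Sum>i\<in>UNIV. \<Sum>j\<in>UNIV. (A $ i $ j - B $ i $ j) * (v $ i * v $ j))"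
    by (simp add: inner_vec_def matrix_vector_mult_def sum_distrib_left flip: sum_subtractf)
       (simp add: algebra_simps)
  also have "\<bar>\<dots>\<bar> \<le> (\<Sum>i\<in>UNIV. \<Sum>j\<in>UNIV. \<bar>(A $ i $ j - B $ i $ j) * (v $ i * v $ j)\<bar>)"
    by (rule order_trans[OF sum_abs sum_mono]) (rule sum_abs)
  also have "\<dots> \<le> (\<Sum>i\<in>UNIV. \<Sum>j\<in>UNIV. \<bar>A $ i $ j - B $ i $ j\<bar> * (norm v)\<^sup>2)"
  proof (intro sum_mono)
    fix i j
    have "\<bar>v $ i * v $ j\<bar> \<le> norm v * norm v"
      unfolding abs_mult by (intro mult_mono component_le_norm_cart) auto
    then show "\<bar>(A $ i $ j - B $ i $ j) * (v $ i * v $ j)\<bar> \<le> \<bar>A $ i $ j - B $ i $ j\<bar> * (norm v)\<^sup>2"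
      unfolding abs_mult[of "A $ i $ j - B $ i $ j"] by (intro mult_left_mono) (auto simp: power2_eq_square)
  qed
  finally show ?thesis by (simp add: sum_distrib_right)
qed

lemma pos_definite_coercive:
  fixes A :: "real^'n^'n"
  assumes "pos_definite A"
  obtains m where "m > 0" "\<And>v. m * (norm v)\<^sup>2 \<le> v \<bullet> (A *v v)"
proof -
  have "continuous_on (sphere 0 1) (\<lambda>v. v \<bullet> (A *v v))"
    by (intro continuous_intros linear_continuous_on) (auto simp: linear_linear)
  moreover have "axis undefined 1 \<in> sphere (0::real^'n) 1" by simp
  ultimately obtain v0 where v0: "v0 \<in> sphere 0 1" "\<And>v. v \<in> sphere 0 1 \<Longrightarrow> v0 \<bullet> (A *v v0) \<le> v \<bullet> (A *v v)"
    using continuous_attains_inf[of "sphere (0::real^'n) 1" "\<lambda>v. v \<bullet> (A *v v)"] by force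
  have "v0 \<noteq> 0" using v0 by auto
  then have m: "v0 \<bullet> (A *v v0) > 0" using assms by (simp add: pos_definite_def)
  have "(v0 \<bullet> (A *v v0)) * (norm v)\<^sup>2 \<le> v \<bullet> (A *v v)" for v
  proof (cases "v = 0")
    case False
    have "v0 \<bullet> (A *v v0) \<le> (v /\<^sub>R norm v) \<bullet> (A *v (v /\<^sub>R norm v))"
      by (rule v0(2)) (use False in simp)
    also have "\<dots> = v \<bullet> (A *v v) / (norm v)\<^sup>2"
      by (simp add: matrix_vector_mult_scaleR power2_eq_square field_simps)
    finally show ?thesis using False by (simp add: field_simps)
  qed simp
  with m show ?thesis using that by blast
qed

lemma multi_well_near_well:
  fixes V :: "real^'k \<Rightarrow> real"
  assumes V: "multi_well_potential V" and \<sigma>: "\<sigma> \<in> zero_set V"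
  obtains \<theta> \<delta> where "\<theta> > 0" "\<delta> > 0"
    "\<And>y v. y \<in> ball \<sigma> \<delta> \<Longrightarrow> \<theta> * (norm v)\<^sup>2 \<le> v \<bullet> (hessian V y *v v)"
proof -
  have sm: "smooth_on UNIV V" using V by (simp add: multi_well_potential_def)
  have "pos_definite (hessian V \<sigma>)" using V \<sigma> by (simp add: multi_well_potential_def)
  then obtain m where m: "m > 0" "\<And>v. m * (norm v)\<^sup>2 \<le> v \<bullet> (hessian V \<sigma> *v v)"
    by (rule pos_definite_coercive) blast
  define D where "D y = (\<Sum>i\<in>UNIV. \<Sum>j\<in>UNIV. \<bar>hessian V y $ i $ j - hessian V \<sigma> $ i $ j\<bar>)" for y
  have "continuous_on UNIV D" unfolding D_def
    by (intro continuous_intros smooth_hessian_continuous sm)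
  then have "isCont D \<sigma>" by (simp add: continuous_on_eq_continuous_at)
  then obtain \<delta> where \<delta>: "\<delta> > 0" "\<And>y. dist y \<sigma> < \<delta> \<Longrightarrow> dist (D y) (D \<sigma>) < m / 2"
    using m(1) unfolding continuous_at_eps_delta by (metis half_gt_zero)
  show ?thesis
  proof (rule that[of "m / 2" \<delta>])
    fix y v :: "real^'k" assume "y \<in> ball \<sigma> \<delta>"
    then have "D y < m / 2" using \<delta>(2)[of y] by (simp add: dist_commute D_def dist_real_def)
    then have "D y * (norm v)\<^sup>2 \<le> m / 2 * (norm v)\<^sup>2" by (intro mult_right_mono) auto
    then show "m / 2 * (norm v)\<^sup>2 \<le> v \<bullet> (hessian V y *v v)"
      using quadratic_form_diff_le[of v "hessian V y" "hessian V \<sigma>"] m(2)[of v]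
      by (simp add: D_def)
  qed (use m \<delta> in auto)
qed

text \<open>The Polyak-Lojasiewicz inequality for a strongly convex function with value 0 at
  \<sigma>. Taylor's formula on the segment from \<open>y\<close> to \<sigma> gives V(y) \<le> |grad
  V| |d| - \<theta> |d|^2 / 2, and the square of |grad V| - \<theta> |d| being nonnegative
  eliminates the distance |d|.\<close>

lemma convex_well_gradient_bound:
  fixes V :: "real^'k \<Rightarrow> real"
  assumes sm: "smooth_on UNIV V" and \<theta>: "\<theta> > 0" and S: "convex S" "\<sigma> \<in> S" "y \<in> S" and 0: "V \<sigma> = 0"
    and H: "\<And>y v. y \<in> S \<Longrightarrow> \<theta> * (norm v)\<^sup>2 \<le> v \<bullet> (hessian V y *v v)"
  shows "2 * \<theta> * V y \<le> (norm (grad V y))\<^sup>2"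
proof -
  define d where "d = \<sigma> - y"
  \<comment> \<open>The derivatives of order 0, 1 and 2 of V along the segment, indexed by the order
    as Taylor's formula expects.\<close>
  define f where "f m t = (if m = 0 then V (y + t *\<^sub>R d) else if m = 1 then grad V (y + t *\<^sub>R d) \<bullet> d
     else (d v* hessian V (y + t *\<^sub>R d)) \<bullet> d)" for m :: nat and t
  have c: "((\<lambda>t. y + t *\<^sub>R d) has_vector_derivative d) (at t)" for t
    by (auto intro!: derivative_eq_intros)
  have d0: "(f 0 has_real_derivative f 1 t) (at t)" for t
    using has_vector_derivative_grad_chain(1)[OF sm c] unfolding f_def by simp
  have d1: "(f 1 has_real_derivative f 2 t) (at t)" for t
    using bounded_linear.has_vector_derivative[OF bounded_linear_inner_left has_vector_derivative_grad_chain(2)[OF sm c], of d t]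
    unfolding f_def by (simp add: has_real_derivative_iff_has_vector_derivative)
  obtain t where t: "t > 0" "t \<le> 1" "f 0 1 = (\<Sum>m<2. f m 0 / fact m * 1 ^ m) + f 2 t / fact 2 * 1 ^ 2"
    using Maclaurin2[of 1 f "f 0" 2] d0 d1
    by (smt (verit) One_nat_def Suc_1 less_2_cases_iff zero_less_one)
  have "y + t *\<^sub>R d = (1 - t) *\<^sub>R y + t *\<^sub>R \<sigma>" by (simp add: d_def algebra_simps)
  then have "y + t *\<^sub>R d \<in> S" using S t by (simp add: convexD_alt)
  then have "f 2 t \<ge> \<theta> * (norm d)\<^sup>2" using H by (simp add: f_def dot_lmul_matrix)
  moreover have "f 0 1 = 0" by (simp add: f_def d_def 0)
  moreover have "f 0 0 = V y" "f 1 0 = grad V y \<bullet> d" by (auto simp: f_def)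
  moreover have "f 0 1 = f 0 0 + f 1 0 + f 2 t / 2" using t(3) by (simp add: numeral_2_eq_2)
  moreover have "\<bar>grad V y \<bullet> d\<bar> \<le> norm (grad V y) * norm d" by (rule Cauchy_Schwarz_ineq2)
  ultimately have "V y \<le> norm (grad V y) * norm d - \<theta> * (norm d)\<^sup>2 / 2" by argo
  then have "2 * \<theta> * V y \<le> 2 * \<theta> * (norm (grad V y) * norm d - \<theta> * (norm d)\<^sup>2 / 2)"
    using \<theta> by (intro mult_left_mono) auto
  also have "\<dots> \<le> (norm (grad V y))\<^sup>2"
    using zero_le_power2[of "norm (grad V y) - \<theta> * norm d"]
    by (simp add: power2_eq_square algebra_simps)
  finally show ?thesis .
qed

text \<open>The level \<open>c\<close> is low enough that its sublevel set lies in small balls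
  around the finitely many wells: V \<ge> 1 far away, and on the remaining compact set it has a
  positive minimum. All three conclusions are then local properties of a single convex ball.\<close>

lemma multi_well_wells:
  fixes V :: "real^'k \<Rightarrow> real"
  assumes V: "multi_well_potential V" and \<mu>: "\<mu> > 0"
  obtains \<theta> c where "\<theta> > 0" "c > 0"
    "\<And>y. V y < c \<Longrightarrow> \<exists>\<sigma>\<in>zero_set V. norm (y - \<sigma>) < \<mu>"
    "\<And>y v. V y < c \<Longrightarrow> \<theta> * (norm v)\<^sup>2 \<le> v \<bullet> (hessian V y *v v)"
    "\<And>y. V y < c \<Longrightarrow> 2 * \<theta> * V y \<le> (norm (grad V y))\<^sup>2"
proof -
  have sm: "smooth_on UNIV V" and fin: "finite (zero_set V)" and ne: "zero_set V \<noteq> {}"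
    using V by (auto simp: multi_well_potential_def)
  have Vc: "continuous_on A V" for A using smooth_on_continuous_on[OF sm] continuous_on_subset by blast
  have "\<forall>\<sigma>\<in>zero_set V. \<exists>p. fst p > 0 \<and> snd p > 0 \<and>
    (\<forall>y\<in>ball \<sigma> (snd p). \<forall>v. fst p * (norm v)\<^sup>2 \<le> v \<bullet> (hessian V y *v v))"
    using multi_well_near_well[OF V] by (metis fst_conv snd_conv)
  then obtain p where p: "\<And>\<sigma>. \<sigma> \<in> zero_set V \<Longrightarrow> fst (p \<sigma>) > (0::real) \<and> snd (p \<sigma>) > (0::real) \<and>
    (\<forall>y\<in>ball \<sigma> (snd (p \<sigma>)). \<forall>v. fst (p \<sigma>) * (norm v)\<^sup>2 \<le> v \<bullet> (hessian V y *v v))"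
    by metis
  define \<theta> where "\<theta> = Min ((fst \<circ> p) ` zero_set V)"
  \<comment> \<open>Being at most \<open>\<mu>\<close>, this radius localises near a well; being at
    most each radius \<open>snd (p \<sigma>)\<close>, it keeps the ball inside the region of
    convexity.\<close>
  define \<kappa> where "\<kappa> = min \<mu> (Min ((snd \<circ> p) ` zero_set V))"
  have \<theta>: "\<theta> > 0" "\<And>\<sigma>. \<sigma> \<in> zero_set V \<Longrightarrow> \<theta> \<le> fst (p \<sigma>)"
    using fin ne p by (auto simp: \<theta>_def)
  have \<kappa>: "\<kappa> > 0" "\<kappa> \<le> \<mu>" "\<And>\<sigma>. \<sigma> \<in> zero_set V \<Longrightarrow> \<kappa> \<le> snd (p \<sigma>)"
    using fin ne p \<mu> by (auto simp: \<kappa>_def intro: min.coboundedI2)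
  have H: "\<theta> * (norm v)\<^sup>2 \<le> v \<bullet> (hessian V y *v v)" if "\<sigma> \<in> zero_set V" "y \<in> ball \<sigma> \<kappa>" for \<sigma> y v
  proof -
    have "\<theta> * (norm v)\<^sup>2 \<le> fst (p \<sigma>) * (norm v)\<^sup>2" using \<theta>(2)[OF that(1)] by (intro mult_right_mono) auto
    also have "\<dots> \<le> v \<bullet> (hessian V y *v v)" using p[OF that(1)] that(2) \<kappa>(3)[OF that(1)] by auto
    finally show ?thesis .
  qed
  have "filterlim V at_top at_infinity" using V by (simp add: multi_well_potential_def)
  then have "\<forall>\<^sub>F y in at_infinity. V y \<ge> 1" by (simp add: filterlim_at_top)
  then obtain R where R: "\<And>y. norm y \<ge> R \<Longrightarrow> V y \<ge> 1" by (auto simp: eventually_at_infinity)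
  define S where "S = cball 0 R - (\<Union>\<sigma>\<in>zero_set V. ball \<sigma> \<kappa>)"
  have S: "compact S" unfolding S_def by (intro compact_diff) auto
  have "\<exists>c>0. \<forall>y\<in>S. c \<le> V y"
  proof (cases "S = {}")
    case False
    obtain y0 where y0: "y0 \<in> S" "\<And>y. y \<in> S \<Longrightarrow> V y0 \<le> V y"
      using continuous_attains_inf[OF S False Vc] by blast
    have "V y0 \<noteq> 0" using y0(1) \<kappa>(1) unfolding S_def zero_set_def by auto
    then have "V y0 > 0" using multi_well_nonneg[OF V, of y0] by linarith
    then show ?thesis using y0 by blast
  qed (auto intro: exI[of _ 1])
  then obtain c0 where c0: "c0 > 0" "\<And>y. y \<in> S \<Longrightarrow> c0 \<le> V y" by blast
  define c where "c = min 1 c0"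
  have near: "\<exists>\<sigma>\<in>zero_set V. y \<in> ball \<sigma> \<kappa>" if "V y < c" for y
  proof (rule ccontr)
    assume "\<not> ?thesis"
    moreover have "norm y < R" using R[of y] that by (force simp: c_def)
    ultimately have "y \<in> S" by (auto simp: S_def)
    then show False using c0(2)[of y] that by (simp add: c_def)
  qed
  show ?thesis
  proof (rule that[OF \<theta>(1), of c])
    show "c > 0" using c0 by (simp add: c_def)
  next
    fix y assume "V y < c"
    then obtain \<sigma> where \<sigma>: "\<sigma> \<in> zero_set V" "y \<in> ball \<sigma> \<kappa>" using near by blast
    show "\<exists>\<sigma>\<in>zero_set V. norm (y - \<sigma>) < \<mu>"
      by (rule bexI[OF _ \<sigma>(1)]) (use \<sigma> \<kappa> in \<open>auto simp: dist_norm norm_minus_commute\<close>)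
    show "\<theta> * (norm v)\<^sup>2 \<le> v \<bullet> (hessian V y *v v)" for v :: "real^'k" using H \<sigma> by blast
    show "2 * \<theta> * V y \<le> (norm (grad V y))\<^sup>2"
      by (rule convex_well_gradient_bound[OF sm \<theta>(1) convex_ball _ \<sigma>(2)])
         (use \<sigma> \<kappa> H in \<open>auto simp: zero_set_def\<close>)
  qed
qed

lemma smooth_potential_bounds:
  fixes V :: "real^'k \<Rightarrow> real"
  assumes sm: "smooth_on UNIV V"
  obtains \<Lambda> where "\<Lambda> > 0" "\<And>y. norm y \<le> M \<Longrightarrow> norm (grad V y) \<le> \<Lambda>"
    "\<And>y v. norm y \<le> M \<Longrightarrow> - \<Lambda> * (norm v)\<^sup>2 \<le> v \<bullet> (hessian V y *v v)"
proof -
  define D where "D y = (\<Sum>i\<in>UNIV. \<Sum>j\<in>UNIV. \<bar>hessian V y $ i $ j - (0::real^'k^'k) $ i $ j\<bar>)" for y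
  have c: "continuous_on (cball 0 M) D" unfolding D_def
    by (intro continuous_intros smooth_hessian_continuous sm)
  from continuous_on_compact_bounded[OF compact_cball this]
  obtain L1 where "\<And>y. y \<in> cball 0 M \<Longrightarrow> norm (D y) \<le> L1" by blast
  then have L1: "\<And>y. norm y \<le> M \<Longrightarrow> \<bar>D y\<bar> \<le> L1" by simp
  from continuous_on_compact_bounded[OF compact_cball smooth_grad_continuous[OF sm]]
  obtain L2 where "\<And>y. y \<in> cball 0 M \<Longrightarrow> norm (grad V y) \<le> L2" by blast
  then have L2: "\<And>y. norm y \<le> M \<Longrightarrow> norm (grad V y) \<le> L2" by simp
  define \<Lambda> where "\<Lambda> = max 1 (max L1 L2)"
  show ?thesis
  proof (rule that[of \<Lambda>])
    fix y v :: "real^'k" assume y: "norm y \<le> M"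
    have "D y * (norm v)\<^sup>2 \<le> \<Lambda> * (norm v)\<^sup>2" using L1[OF y] by (intro mult_right_mono) (auto simp: \<Lambda>_def)
    then show "- \<Lambda> * (norm v)\<^sup>2 \<le> v \<bullet> (hessian V y *v v)"
      using quadratic_form_diff_le[of v "hessian V y" 0] by (simp add: D_def)
  qed (use L2 in \<open>force simp: \<Lambda>_def\<close>)+
qed

section \<open>Solutions on the unit disk: the equation, its derivative, and energies of interior
  sets\<close>

lemma has_pd_eq: "has_pd i f d x \<Longrightarrow> d = d' \<Longrightarrow> has_pd i f d' x"
  by simp

text \<open>The energy enters as a real bound \<open>E\<close> on closed disks strictly inside the
  unit disk. There the density is continuous, hence integrable, and all later estimates can use real
  integrals instead of extended ones.\<close>

locale allen_cahn =
  fixes V :: "real^'k \<Rightarrow> real" and \<epsilon> :: real and u :: "real^2 \<Rightarrow> real^'k" and E :: real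
  assumes V_smooth: "smooth_on UNIV V" and V_nonneg: "\<And>y. V y \<ge> 0"
    and eps_pos: "\<epsilon> > 0" and eps_le: "\<epsilon> \<le> 1"
    and u_smooth: "smooth_on (ball 0 1) u"
    and equation: "\<And>x. x \<in> ball 0 1 \<Longrightarrow> laplacian u x = (1 / \<epsilon>\<^sup>2) *\<^sub>R grad V (u x)"
    and energy_le: "\<And>r. r < 1 \<Longrightarrow>
      (LBINT x. indicator (cball 0 r) x * energy_density \<epsilon> V u x) \<le> E"
begin

abbreviation "U \<equiv> ball (0::real^2) 1"
abbreviation "a i \<equiv> partial_diff i u"
abbreviation "e \<equiv> energy_density \<epsilon> V u"
definition "gradsq x = (\<Sum>i\<in>UNIV. a i x \<bullet> a i x)"
definition "en S = (LBINT x. indicator S x * e x)"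

lemma e_eq: "e x = \<epsilon> * gradsq x / 2 + V (u x) / \<epsilon>"
  by (simp add: energy_density_def gradsq_def power2_norm_eq_inner)

lemma gradsq_nonneg: "gradsq x \<ge> 0"
  unfolding gradsq_def by (intro sum_nonneg) auto

lemma e_nonneg: "e x \<ge> 0"
  unfolding e_eq using gradsq_nonneg[of x] V_nonneg[of "u x"] eps_pos by auto

lemma gradsq_le_e: "\<epsilon> * gradsq x \<le> 2 * e x"
  unfolding e_eq using V_nonneg[of "u x"] eps_pos by auto

lemma V_le_e: "V (u x) \<le> \<epsilon> * e x"
  unfolding e_eq using gradsq_nonneg[of x] eps_pos by (auto simp: algebra_simps)

lemma a_sq_le: "a i x \<bullet> a i x \<le> gradsq x"
  unfolding gradsq_def by (rule member_le_sum) auto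

lemma pd_u: "x \<in> U \<Longrightarrow> has_pd i u (a i x) x"
  by (rule smooth_on_has_pd[OF u_smooth])

lemma pd_a: "x \<in> U \<Longrightarrow> has_pd j (a i) (partial_diff j (a i) x) x"
  by (rule smooth_on_has_pd[OF smooth_on_partial_diff[OF u_smooth]])

lemma pd_aa: "x \<in> U \<Longrightarrow> has_pd l (partial_diff j (a i)) (partial_diff l (partial_diff j (a i)) x) x"
  by (rule smooth_on_has_pd[OF smooth_on_partial_diff[OF smooth_on_partial_diff[OF u_smooth]]])

lemma cont_u: "continuous_on U u" and cont_a: "continuous_on U (a i)"
  and cont_aa: "continuous_on U (partial_diff j (a i))"
  using smooth_on_continuous_on u_smooth smooth_on_partial_diff by blast+

lemma cont_V: "continuous_on A V"
  using smooth_on_continuous_on[OF V_smooth] continuous_on_subset by blast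

lemma cont_Vu: "continuous_on U (\<lambda>x. V (u x))"
  by (rule continuous_on_compose2[OF cont_V[of UNIV] cont_u]) auto

lemma cont_gradVu: "continuous_on U (\<lambda>x. grad V (u x))"
  by (rule continuous_on_compose2[OF smooth_grad_continuous[OF V_smooth, of UNIV] cont_u]) auto

lemma cont_e: "continuous_on U e"
  unfolding energy_density_def using eps_pos by (intro continuous_intros cont_a cont_Vu) auto

lemma cont_gradsq: "continuous_on U gradsq"
  unfolding gradsq_def[abs_def] by (intro continuous_intros cont_a)

lemma mixed: "x \<in> U \<Longrightarrow> partial_diff j (a i) x = partial_diff i (a j) x"
  by (rule mixed_partial_diff[OF u_smooth]) auto

lemma laplace_u: "x \<in> U \<Longrightarrow> (\<Sum>j\<in>UNIV. partial_diff j (a j) x) = (1 / \<epsilon>\<^sup>2) *\<^sub>R grad V (u x)"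
  using equation by (simp add: laplacian_def)

text \<open>Differentiating the equation in direction \<open>i\<close> yields the linearised
  equation, once third derivatives are reordered by two applications of Schwarz's theorem.\<close>

lemma laplace_a:
  assumes x: "x \<in> U"
  shows "(\<Sum>j\<in>UNIV. partial_diff j (partial_diff j (a i)) x) = (1 / \<epsilon>\<^sup>2) *\<^sub>R (a i x v* hessian V (u x))"
proof -
  have "partial_diff j (partial_diff j (a i)) x = partial_diff i (partial_diff j (a j)) x" for j
  proof -
    have "has_pd j (partial_diff i (a j)) (partial_diff j (partial_diff j (a i)) x) x"
      by (rule has_pd_transform[OF pd_aa[OF x], of U]) (use x mixed in auto)
    then have "partial_diff j (partial_diff j (a i)) x = partial_diff j (partial_diff i (a j)) x"
      using pd_aa[OF x] has_pd_unique by blast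
    also have "\<dots> = partial_diff i (partial_diff j (a j)) x"
      by (rule mixed_partial_diff[OF smooth_on_partial_diff[OF u_smooth]]) (use x in auto)
    finally show ?thesis .
  qed
  then have "has_pd i (\<lambda>x. \<Sum>j\<in>UNIV. partial_diff j (a j) x) (\<Sum>j\<in>UNIV. partial_diff j (partial_diff j (a i)) x) x"
    using pd_aa[OF x] by (intro has_pd_sum) auto
  then have 1: "has_pd i (\<lambda>x. (1 / \<epsilon>\<^sup>2) *\<^sub>R grad V (u x)) (\<Sum>j\<in>UNIV. partial_diff j (partial_diff j (a i)) x) x"
    by (rule has_pd_transform[of _ _ _ _ U]) (use x laplace_u in auto)
  have "has_pd i (\<lambda>x. grad V (u x)) (a i x v* hessian V (u x)) x"
    by (rule has_pd_compose_potential[OF V_smooth pd_u[OF x]])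
  then have "has_pd i (\<lambda>x. (1 / \<epsilon>\<^sup>2) *\<^sub>R grad V (u x)) ((1 / \<epsilon>\<^sup>2) *\<^sub>R (a i x v* hessian V (u x))) x"
    unfolding has_pd_def by (auto intro!: derivative_eq_intros)
  with 1 show ?thesis by (rule has_pd_unique)
qed

lemma integrable_e:
  assumes "S \<in> sets borel" "S \<subseteq> K" "compact K" "K \<subseteq> U"
  shows "integrable lborel (\<lambda>x. indicator S x * e x)"
proof -
  have K: "integrable lborel (\<lambda>x. indicator K x *\<^sub>R e x)"
    by (rule borel_integrable_compact[OF assms(3)]) (use cont_e assms(4) continuous_on_subset in blast)
  have "integrable lborel (\<lambda>x. indicator S x *\<^sub>R (indicator K x *\<^sub>R e x))"
    by (rule integrable_mult_indicator[OF _ K]) (use assms in auto)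
  moreover have "(\<lambda>x. indicator S x *\<^sub>R (indicator K x *\<^sub>R e x)) = (\<lambda>x. indicator S x * e x)"
    using assms(2) by (auto simp: indicator_def fun_eq_iff)
  ultimately show ?thesis by simp
qed

lemma en_mono:
  assumes "S \<in> sets borel" "T \<in> sets borel" "S \<subseteq> T" "T \<subseteq> cball 0 r" "r < 1"
  shows "en S \<le> en T"
  unfolding en_def
  by (rule integral_mono, rule integrable_e[of _ "cball 0 r"], use assms in auto,
      rule integrable_e[of _ "cball 0 r"], use assms e_nonneg in \<open>auto simp: indicator_def\<close>)

lemma en_nonneg: "en S \<ge> 0"
  unfolding en_def using e_nonneg by (intro integral_nonneg_AE) auto

lemma en_le:
  assumes "S \<in> sets borel" "S \<subseteq> cball 0 r" "r < 1"
  shows "en S \<le> E"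
  using en_mono[OF assms(1) _ assms(2) order.refl assms(3)] energy_le[OF assms(3)]
  by (simp add: en_def)

lemma weighted_energy_le:
  assumes w: "continuous_on UNIV w" "\<And>x. x \<notin> K \<Longrightarrow> w x = 0" and K: "compact K" "K \<subseteq> S"
    and S: "S \<in> sets borel" "S \<subseteq> cball 0 r" "r < 1"
    and f: "continuous_on U f" "\<And>x. x \<in> S \<Longrightarrow> w x * f x \<le> C * e x" and C: "C \<ge> 0"
  shows "(LBINT x. w x * f x) \<le> C * en S"
proof -
  have KU: "K \<subseteq> U" using K S by (force simp: subset_iff)
  have "(LBINT x. w x * f x) \<le> (LBINT x. C * (indicator S x * e x))"
  proof (rule integral_mono)
    show "integrable lborel (\<lambda>x. w x * f x)"
      by (rule integrable_cutoff_mult[OF _ K(1) KU w f(1)]) auto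
    show "integrable lborel (\<lambda>x. C * (indicator S x * e x))"
      by (intro integrable_mult_right integrable_e[of _ "cball 0 r"]) (use S in auto)
    show "w x * f x \<le> C * (indicator S x * e x)" for x
    proof (cases "x \<in> S")
      case False
      then have "w x = 0" using K(2) w(2) by blast
      then show ?thesis using False by simp
    qed (use f(2) in simp)
  qed
  then show ?thesis by (simp add: en_def)
qed

lemma pd_usq:
  assumes "x \<in> U"
  shows "has_pd i (\<lambda>x. u x \<bullet> u x) (2 * (u x \<bullet> a i x)) x"
    and "has_pd i (\<lambda>x. 2 * (u x \<bullet> a i x)) (2 * (u x \<bullet> partial_diff i (a i) x + a i x \<bullet> a i x)) x"
  using has_pd_inner[OF pd_u[OF assms] pd_u[OF assms], of i]
    has_pd_cmult[OF has_pd_inner[OF pd_u[OF assms, of i] pd_a[OF assms, of i i]], of 2]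
  by (simp_all add: inner_commute)

text \<open>Coercivity bounds the last term below by -2 Q / \<epsilon>^2, so |u|^2 is subharmonic up
  to that constant. The same identity drives the barrier and absorbs the errors in Bernstein's
  method.\<close>

lemma laplace_usq:
  assumes "x \<in> U"
  shows "(\<Sum>i\<in>UNIV. 2 * (u x \<bullet> partial_diff i (a i) x + a i x \<bullet> a i x))
    = 2 * gradsq x + 2 / \<epsilon>\<^sup>2 * (u x \<bullet> grad V (u x))"
  using laplace_u[OF assms]
  by (simp add: sum.distrib gradsq_def inner_sum_right[symmetric] flip: sum_distrib_left)

end

subsection \<open>Pointwise bounds for solutions\<close>

locale allen_cahn_coercive = allen_cahn +
  fixes \<alpha> Q :: real
  assumes alpha_pos: "\<alpha> > 0" and Q_nonneg: "Q \<ge> 0" and E_le: "E \<le> 1"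
    and coercive: "\<And>y. y \<bullet> grad V y \<ge> \<alpha> * (norm y)\<^sup>2 - Q"
    and growth: "\<And>y. V y \<ge> \<alpha> / 2 * (norm y)\<^sup>2 - Q"
begin

definition "b\<^sub>0 = integral\<^sup>L lborel (bump (1/64) :: real^2 \<Rightarrow> real)"
definition "b\<^sub>1 = (LBINT y::real^2. (bump (1/64) y)\<^sup>2 / 4)"
definition "C\<^sub>1 = (2 / \<alpha> * (1 + Q * b\<^sub>0) + 2 * Q * b\<^sub>1) / b\<^sub>0"

lemma b0_pos: "b\<^sub>0 > 0" unfolding b\<^sub>0_def by (rule bump_integral_pos) simp
lemma b1_nonneg: "b\<^sub>1 \<ge> 0" unfolding b\<^sub>1_def by (rule integral_nonneg_AE) simp
lemma C1_nonneg: "C\<^sub>1 \<ge> 0"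
  unfolding C\<^sub>1_def using b0_pos b1_nonneg Q_nonneg alpha_pos by auto

text \<open>The mean value inequality is applied to |u|^2 at a fixed scale. Quadratic growth of V
  bounds the average of |u|^2 by the energy, and the defect Q / \<epsilon>^2 in subharmonicity costs
  the power of \<epsilon>; \<open>C\<^sub>1\<close> collects both contributions.\<close>

lemma crude_bound:
  assumes x0: "norm x0 < 61/64"
  shows "(norm (u x0))\<^sup>2 \<le> C\<^sub>1 / \<epsilon>\<^sup>2"
proof -
  \<comment> \<open>The cube of half-width 1/64 in the plane has points of norm at most 2/64, which
    fits between 61/64 and 1.\<close>
  define \<rho> :: real where "\<rho> = 1/64"
  define f where "f x = u x \<bullet> u x" for x
  have inU: "x0 + y \<in> U" if "\<forall>i. \<bar>y $ i\<bar> \<le> \<rho>" for y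
  proof -
    have "norm y \<le> (\<Sum>i\<in>UNIV. \<bar>y $ i\<bar>)" by (rule norm_le_l1_cart)
    also have "\<dots> \<le> (\<Sum>i\<in>(UNIV::2 set). \<rho>)" by (intro sum_mono) (use that in auto)
    finally have "norm y \<le> 2/64" by (simp add: \<rho>_def)
    then show ?thesis using x0 norm_triangle_ineq[of x0 y] by simp
  qed
  have fd: "(f has_derivative (\<lambda>v. \<Sum>i\<in>UNIV. v $ i * (2 * (u y \<bullet> a i y)))) (at y)" if y: "y \<in> U" for y
  proof -
    have "u differentiable (at y)" using smooth_on_differentiable[OF u_smooth y] .
    then have d: "f differentiable (at y)" unfolding f_def[abs_def] by (intro differentiable_inner)
    have "partial_diff i f y = 2 * (u y \<bullet> a i y)" for i
      using has_pd_unique[OF has_pd_partial_diff[OF d] pd_usq(1)[OF y, folded f_def]] .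
    with has_derivative_partial[OF d] show ?thesis by simp
  qed
  have L: "(\<Sum>i\<in>UNIV. 2 * (u y \<bullet> partial_diff i (a i) y + a i y \<bullet> a i y)) \<ge> - (2 * Q / \<epsilon>\<^sup>2)" if y: "y \<in> U" for y
  proof -
    have "u y \<bullet> grad V (u y) \<ge> - Q" using coercive[of "u y"] alpha_pos
      by (smt (verit) mult_nonneg_nonneg zero_le_power2)
    then have "2 / \<epsilon>\<^sup>2 * (u y \<bullet> grad V (u y)) \<ge> 2 / \<epsilon>\<^sup>2 * (- Q)" by (intro mult_left_mono) auto
    then show ?thesis unfolding laplace_usq[OF y] using gradsq_nonneg[of y] by simp
  qed
  have "f x0 * integral\<^sup>L lborel (bump \<rho> :: real^2 \<Rightarrow> real) \<le>
    (LBINT y. bump \<rho> y * f (x0 + y)) +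
    (2 * Q / \<epsilon>\<^sup>2) * (LBINT y::real^2. (bump \<rho> y)\<^sup>2 / 4)"
    by (rule mean_value_inequality[OF _ open_ball inU fd _ _ _ L])
       (use Q_nonneg eps_pos pd_usq(2) in \<open>auto simp: \<rho>_def intro!: continuous_intros cont_u cont_a cont_aa\<close>)
  then have mv: "f x0 * b\<^sub>0 \<le> (LBINT y. bump \<rho> y * f (x0 + y)) + (2 * Q / \<epsilon>\<^sup>2) * b\<^sub>1"
    by (simp add: b\<^sub>0_def b\<^sub>1_def \<rho>_def)
  have tr: "(LBINT y. bump \<rho> y * f (x0 + y)) = (LBINT x. bump \<rho> (x - x0) * f x)"
    "(LBINT y. bump \<rho> y * e (x0 + y)) = (LBINT x. bump \<rho> (x - x0) * e x)"
    and int: "integrable lborel (\<lambda>x. bump \<rho> (x - x0) * f x)" "integrable lborel (\<lambda>x. bump \<rho> (x - x0) * e x)"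
      "integrable lborel (\<lambda>x. bump \<rho> (x - x0))"
    and ee: "(LBINT x. bump \<rho> (x - x0) * e x) \<le> 1 * en (cball x0 \<rho>)"
  proof -
    have KU: "cball x0 \<rho> \<subseteq> cball 0 (62/64)"
      using x0 by (simp add: \<rho>_def cball_subset_cball_iff)
    have KU': "cball x0 \<rho> \<subseteq> U" by (rule order_trans[OF KU]) auto
    have bc: "continuous_on UNIV (\<lambda>x. bump \<rho> (x - x0))"
      by (rule continuous_on_compose2[OF continuous_on_bump[of UNIV]]) (auto intro!: continuous_intros)
    have b0: "bump \<rho> (x - x0) = 0" if "x \<notin> cball x0 \<rho>" for x
      by (rule bump_eq_0) (use that in \<open>auto simp: \<rho>_def dist_norm norm_minus_commute\<close>)
    have fc: "continuous_on U f" unfolding f_def by (intro continuous_intros cont_u)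
    have c: "continuous_on UNIV (\<lambda>x. bump \<rho> (x - x0) * f x)" "continuous_on UNIV (\<lambda>x. bump \<rho> (x - x0) * e x)"
      by (intro continuous_on_cutoff_mult[OF _ _ KU' bc b0] fc cont_e; simp)+
    show "(LBINT y. bump \<rho> y * f (x0 + y)) = (LBINT x. bump \<rho> (x - x0) * f x)"
      using lborel_integral_translate[OF borel_measurable_continuous_onI[OF c(1)], of x0]
      by (simp add: add.commute)
    show "(LBINT y. bump \<rho> y * e (x0 + y)) = (LBINT x. bump \<rho> (x - x0) * e x)"
      using lborel_integral_translate[OF borel_measurable_continuous_onI[OF c(2)], of x0]
      by (simp add: add.commute)
    show "integrable lborel (\<lambda>x. bump \<rho> (x - x0) * f x)" "integrable lborel (\<lambda>x. bump \<rho> (x - x0) * e x)"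
      by (intro integrable_cutoff_mult[OF _ _ KU' bc b0] fc cont_e; simp)+
    show "integrable lborel (\<lambda>x. bump \<rho> (x - x0))"
      by (rule integrable_continuous_compact_support[OF compact_cball bc b0])
    show "(LBINT x. bump \<rho> (x - x0) * e x) \<le> 1 * en (cball x0 \<rho>)"
    proof (rule weighted_energy_le[where K = "cball x0 \<rho>", OF bc b0 _ _ _ KU])
      fix x assume "x \<in> cball x0 \<rho>"
      have "bump \<rho> (x - x0) \<le> 1" using bump_le[of \<rho> "x - x0"] by (simp add: \<rho>_def power2_eq_square)
      then show "bump \<rho> (x - x0) * e x \<le> 1 * e x" by (intro mult_right_mono e_nonneg)
    qed (auto intro: cont_e)
  qed
  have "en (cball x0 \<rho>) \<le> E"
  proof (rule en_le)
    show "cball x0 \<rho> \<subseteq> cball 0 (62/64)"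
      using x0 by (simp add: \<rho>_def cball_subset_cball_iff)
  qed auto
  then have e1: "(LBINT x. bump \<rho> (x - x0) * e x) \<le> 1" using ee E_le by simp
  have "(LBINT x. bump \<rho> (x - x0) * f x) \<le>
    (LBINT x. 2 / \<alpha> * (\<epsilon> * (bump \<rho> (x - x0) * e x) + Q * bump \<rho> (x - x0)))"
  proof (rule integral_mono[OF int(1)])
    show "integrable lborel (\<lambda>x. 2 / \<alpha> * (\<epsilon> * (bump \<rho> (x - x0) * e x) + Q * bump \<rho> (x - x0)))"
      using int by (intro integrable_mult_right Bochner_Integration.integrable_add) auto
    fix x
    have "\<alpha> / 2 * f x \<le> \<epsilon> * e x + Q"
      using growth[of "u x"] V_le_e[of x] by (simp add: f_def power2_norm_eq_inner)
    then have "f x \<le> 2 / \<alpha> * (\<epsilon> * e x + Q)" using alpha_pos by (simp add: field_simps)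
    then have "bump \<rho> (x - x0) * f x \<le> bump \<rho> (x - x0) * (2 / \<alpha> * (\<epsilon> * e x + Q))"
      by (intro mult_left_mono bump_nonneg)
    then show "bump \<rho> (x - x0) * f x \<le> 2 / \<alpha> * (\<epsilon> * (bump \<rho> (x - x0) * e x) + Q * bump \<rho> (x - x0))"
      by (simp add: algebra_simps)
  qed
  also have "\<dots> = 2 / \<alpha> * (\<epsilon> * (LBINT x. bump \<rho> (x - x0) * e x) + Q * (LBINT x. bump \<rho> (x - x0)))"
    using int by simp
  also have "(LBINT x. bump \<rho> (x - x0)) = b\<^sub>0"
    using lborel_integral_translate[OF borel_measurable_continuous_onI[OF continuous_on_bump[of UNIV \<rho>]], of "- x0"]
    by (simp add: b\<^sub>0_def \<rho>_def)
  also have "2 / \<alpha> * (\<epsilon> * (LBINT x. bump \<rho> (x - x0) * e x) + Q * b\<^sub>0) \<le> 2 / \<alpha> * (1 + Q * b\<^sub>0)"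
  proof -
    have "\<epsilon> * (LBINT x. bump \<rho> (x - x0) * e x) \<le> \<epsilon> * 1"
      using e1 eps_pos by (intro mult_left_mono) auto
    then show ?thesis using eps_le alpha_pos by (intro mult_left_mono) auto
  qed
  finally have "f x0 * b\<^sub>0 \<le> 2 / \<alpha> * (1 + Q * b\<^sub>0) + (2 * Q / \<epsilon>\<^sup>2) * b\<^sub>1" using mv tr(1) by linarith
  also have "\<dots> \<le> 2 / \<alpha> * (1 + Q * b\<^sub>0) / \<epsilon>\<^sup>2 + (2 * Q / \<epsilon>\<^sup>2) * b\<^sub>1"
  proof -
    have "2 / \<alpha> * (1 + Q * b\<^sub>0) \<ge> 0" using alpha_pos Q_nonneg b0_pos by auto
    moreover have "\<epsilon>\<^sup>2 \<le> 1" "\<epsilon>\<^sup>2 > 0" using eps_le eps_pos by (auto simp: power_le_one)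
    moreover have "x \<le> x / \<epsilon>\<^sup>2" if "x \<ge> 0" "\<epsilon>\<^sup>2 \<le> 1" "\<epsilon>\<^sup>2 > 0" for x
      using that by (simp add: le_divide_eq mult_left_le del: zero_less_power2)
    ultimately have "2 / \<alpha> * (1 + Q * b\<^sub>0) \<le> 2 / \<alpha> * (1 + Q * b\<^sub>0) / \<epsilon>\<^sup>2" by blast
    then show ?thesis by simp
  qed
  also have "\<dots> = (2 / \<alpha> * (1 + Q * b\<^sub>0) + 2 * Q * b\<^sub>1) / \<epsilon>\<^sup>2" by (simp add: add_divide_distrib)
  also have "2 / \<alpha> * (1 + Q * b\<^sub>0) + 2 * Q * b\<^sub>1 = C\<^sub>1 * b\<^sub>0" using b0_pos by (simp add: C\<^sub>1_def)
  also have "C\<^sub>1 * b\<^sub>0 / \<epsilon>\<^sup>2 = C\<^sub>1 / \<epsilon>\<^sup>2 * b\<^sub>0" by simp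
  finally have "f x0 \<le> C\<^sub>1 / \<epsilon>\<^sup>2" using b0_pos by (rule mult_right_le_imp_le)
  then show ?thesis by (simp add: f_def power2_norm_eq_inner)
qed

text \<open>Chosen for the barrier argument: by coercivity, |u|^2 > \<open>M\<^sup>2\<close> forces
  u . grad V(u) > 16384 \<open>C\<^sub>1\<close>.\<close>

definition "M = sqrt (Q / \<alpha> + C\<^sub>1 * (16384 / \<alpha>))"

lemma M_sq: "M\<^sup>2 = Q / \<alpha> + C\<^sub>1 * (16384 / \<alpha>)"
  unfolding M_def using C1_nonneg Q_nonneg alpha_pos by (intro real_sqrt_pow2) auto

text \<open>A paraboloid around \<open>x0\<close> dominates the crude bound on a small circle. Its
  Laplacian has size \<epsilon>^-2, but so does the zero-order term of the equation, so the height
  at which the maximum principle is violated does not depend on \<epsilon>.\<close>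

lemma sup_bound:
  assumes x0: "norm x0 < 15/16"
  shows "norm (u x0) \<le> M"
proof -
  define B where "B = 16384 / \<alpha>"
  define c where "c = C\<^sub>1 / \<epsilon>\<^sup>2"
  have c0: "c \<ge> 0" using C1_nonneg by (simp add: c_def)
  have C1: "C\<^sub>1 = c * \<epsilon>\<^sup>2" using eps_pos by (simp add: c_def)
  \<comment> \<open>Since 4096 is 64^2, the paraboloid equals the crude bound \<open>c\<close> on
    the circle of radius 1/64; its Laplacian is 4 * 4096 * \<open>c\<close>, that is 16384 *
    \<open>c\<close>.\<close>
  define f where "f x = u x \<bullet> u x - (Q / \<alpha> + C\<^sub>1 * B) - c * 4096 * (norm (x - x0))\<^sup>2" for x
  have KU: "norm x < 61/64" if "x \<in> cball x0 (1/64)" for x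
    using that x0 norm_triangle_ineq[of x0 "x - x0"] by (simp add: dist_norm norm_minus_commute)
  then have KU': "cball x0 (1/64) \<subseteq> U" by force
  have "continuous_on (cball x0 (1/64)) f"
    unfolding f_def by (intro continuous_intros continuous_on_subset[OF cont_u KU'])
  then obtain z where z: "z \<in> cball x0 (1/64)" "\<And>y. y \<in> cball x0 (1/64) \<Longrightarrow> f y \<le> f z"
    using continuous_attains_sup[of "cball x0 (1/64)" f] by auto
  have "f z \<le> 0"
  proof (rule ccontr)
    assume "\<not> f z \<le> 0"
    then have fz: "f z > 0" by simp
    have pos: "Q / \<alpha> + C\<^sub>1 * B \<ge> 0" using C1_nonneg Q_nonneg alpha_pos by (auto simp: B_def)
    show False
    proof (cases "z \<in> ball x0 (1/64)")
      case False
      then have "norm (z - x0) = 1/64" using z(1) by (auto simp: dist_norm norm_minus_commute)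
      then have "c * 4096 * (norm (z - x0))\<^sup>2 = c" by (simp only: power2_eq_square; simp)
      moreover have "u z \<bullet> u z \<le> c" using crude_bound[OF KU[OF z(1)]] by (simp add: c_def power2_norm_eq_inner)
      ultimately show False using fz pos unfolding f_def by linarith
    next
      case True
      have zU: "z \<in> U" using z(1) KU' by auto
      have "2 * (u z \<bullet> partial_diff i (a i) z + a i z \<bullet> a i z) - c * 4096 * 2 \<le> 0" for i
      proof (rule interior_max_second_pd[OF open_ball True])
        show "f y \<le> f z" if "y \<in> ball x0 (1/64)" for y using that z(2) by auto
        show "has_pd i f (2 * (u y \<bullet> a i y) - c * 4096 * (2 * (y $ i - x0 $ i))) y" if "y \<in> ball x0 (1/64)" for y
        proof -
          have y: "y \<in> U" using that KU' ball_subset_cball by blast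
          show ?thesis unfolding f_def
            by (rule has_pd_eq[OF has_pd_diff[OF has_pd_diff[OF pd_usq(1)[OF y] has_pd_const] has_pd_cmult[OF has_pd_norm_sq_diff]]]) simp
        qed
        show "has_pd i (\<lambda>y. 2 * (u y \<bullet> a i y) - c * 4096 * (2 * (y $ i - x0 $ i)))
          (2 * (u z \<bullet> partial_diff i (a i) z + a i z \<bullet> a i z) - c * 4096 * 2) z"
          by (rule has_pd_eq[OF has_pd_diff[OF pd_usq(2)[OF zU] has_pd_cmult[OF has_pd_cmult[OF has_pd_diff[OF has_pd_coord has_pd_const]]]]]) simp
      qed
      then have "(\<Sum>i\<in>(UNIV::2 set). 2 * (u z \<bullet> partial_diff i (a i) z + a i z \<bullet> a i z) - c * 4096 * 2) \<le> 0"
        by (intro sum_nonpos) auto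
      then have le: "2 * gradsq z + 2 / \<epsilon>\<^sup>2 * (u z \<bullet> grad V (u z)) \<le> c * 16384"
        using laplace_usq[OF zU] by (simp add: sum_subtractf)
      have "C\<^sub>1 * B < (norm (u z))\<^sup>2 - Q / \<alpha>"
      proof -
        have "c * 4096 * (norm (z - x0))\<^sup>2 \<ge> 0" using c0 by auto
        then show ?thesis using fz by (simp add: f_def power2_norm_eq_inner)
      qed
      then have "\<alpha> * (C\<^sub>1 * B) < \<alpha> * ((norm (u z))\<^sup>2 - Q / \<alpha>)"
        using alpha_pos by (intro mult_strict_left_mono)
      also have "\<dots> \<le> u z \<bullet> grad V (u z)" using coercive[of "u z"] alpha_pos by (simp add: algebra_simps)
      finally have "16384 * C\<^sub>1 < u z \<bullet> grad V (u z)" using alpha_pos by (simp add: B_def)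
      \<comment> \<open>Twice the Laplacian of the barrier is exceeded, whereas the maximum allows
        at most once.\<close>
      then have "2 / \<epsilon>\<^sup>2 * (16384 * C\<^sub>1) < 2 / \<epsilon>\<^sup>2 * (u z \<bullet> grad V (u z))"
        using eps_pos by (intro mult_strict_left_mono) auto
      then show False using le gradsq_nonneg[of z] c0 by (simp add: c_def)
    qed
  qed
  then have "f x0 \<le> 0" using z(2)[of x0] by simp
  then have "(norm (u x0))\<^sup>2 \<le> M\<^sup>2" by (simp add: f_def M_sq B_def power2_norm_eq_inner)
  moreover have "M \<ge> 0" unfolding M_def using C1_nonneg Q_nonneg alpha_pos by auto
  ultimately show ?thesis by (rule power2_le_imp_le)
qed

end

locale allen_cahn_bounded = allen_cahn_coercive +
  fixes \<Lambda> :: real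
  assumes Lam_pos: "\<Lambda> > 0"
    and hess_ge: "\<And>y v. norm y \<le> M \<Longrightarrow> - \<Lambda> * (norm v)\<^sup>2 \<le> v \<bullet> (hessian V y *v v)"
begin

text \<open>The first summand is the bound at an interior maximum of the Bernstein function; the
  second is its zero-order part divided by \<rho>^4, where \<rho> = \<epsilon>/16 explains the
  factor 256.\<close>

definition "G = 2 * Q + 256 * (32 + \<Lambda>) * M\<^sup>2"

lemma G_nonneg: "G \<ge> 0"
  using Q_nonneg Lam_pos by (simp add: G_def)

lemma hess_form_ge:
  assumes "norm y \<le> M" shows "v \<bullet> (v v* hessian V y) \<ge> - \<Lambda> * (v \<bullet> v)"
  using hess_ge[OF assms, of v] dot_lmul_matrix[of v "hessian V y" v]
  by (simp add: inner_commute power2_norm_eq_inner)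

text \<open>The maximised function is \<phi>^2 |grad u|^2 + A |u|^2 with A = (32 + \<Lambda>)
  \<rho>^2. At an interior maximum its Laplacian is nonpositive; 2 A |grad u|^2 from the second
  summand outweighs the losses from the cutoff and from the possibly negative Hessian of V. The
  radius is a multiple of \<epsilon> so that \<phi>^2 / \<epsilon>^2 is bounded by a multiple of
  \<rho>^2.\<close>

lemma bernstein_interior:
  fixes \<rho> :: real
  defines "\<rho> \<equiv> \<epsilon> / 16"
  defines "\<phi> \<equiv> \<lambda>x0 x::real^2. \<rho>\<^sup>2 - (norm (x - x0))\<^sup>2"
  assumes z: "norm z < 15/16" and zb: "z \<in> ball x0 \<rho>" and KU: "ball x0 \<rho> \<subseteq> U"
    and mx: "\<And>y. y \<in> ball x0 \<rho> \<Longrightarrow>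
      \<phi> x0 y * \<phi> x0 y * gradsq y + (32 + \<Lambda>) * \<rho>\<^sup>2 * (u y \<bullet> u y)
      \<le> \<phi> x0 z * \<phi> x0 z * gradsq z + (32 + \<Lambda>) * \<rho>\<^sup>2 * (u z \<bullet> u z)"
  shows "gradsq z \<le> 2 * Q / \<epsilon>\<^sup>2"
proof -
  define A where "A = (32 + \<Lambda>) * \<rho>\<^sup>2"
  have \<rho>: "\<rho> > 0" using eps_pos by (simp add: \<rho>_def)
  have A: "A > 0" using \<rho> Lam_pos by (auto simp: A_def)
  define f where "f y = \<phi> x0 y * \<phi> x0 y * gradsq y + A * (u y \<bullet> u y)" for y
  define g1 where "g1 j y = (\<Sum>i\<in>UNIV. 2 * (a i y \<bullet> partial_diff j (a i) y))" for j y
  define g2 where "g2 j y = (\<Sum>i\<in>UNIV. 2 * (a i y \<bullet> partial_diff j (partial_diff j (a i)) y +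
     partial_diff j (a i) y \<bullet> partial_diff j (a i) y))" for j y
  have zU: "z \<in> U" using z by simp
  have pg: "has_pd j gradsq (g1 j y) y" if "y \<in> U" for j y
    unfolding gradsq_def g1_def
    by (intro has_pd_sum has_pd_eq[OF has_pd_inner[OF pd_a[OF that] pd_a[OF that]]]) (simp add: inner_commute)
  have pg1: "has_pd j (g1 j) (g2 j y) y" if "y \<in> U" for j y
    unfolding g1_def g2_def
    by (intro has_pd_sum has_pd_cmult has_pd_inner pd_a pd_aa that)
  have p\<phi>: "has_pd j (\<phi> x0) (- 2 * (y $ j - x0 $ j)) y" for j y
    unfolding \<phi>_def by (rule has_pd_eq[OF has_pd_diff[OF has_pd_const has_pd_norm_sq_diff]]) simp
  have p\<phi>1: "has_pd j (\<lambda>y. - 2 * (y $ j - x0 $ j)) (- 2) y" for j y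
    by (rule has_pd_eq[OF has_pd_cmult[OF has_pd_diff[OF has_pd_coord has_pd_const]]]) simp
  define d where "d j = - 2 * (z $ j - x0 $ j)" for j
  have second: "(2 * (d j)\<^sup>2 - 4 * \<phi> x0 z) * gradsq z + 4 * \<phi> x0 z * d j * g1 j z + \<phi> x0 z * \<phi> x0 z * g2 j z
      + A * (2 * (u z \<bullet> partial_diff j (a j) z + a j z \<bullet> a j z)) \<le> 0" for j
  proof (rule interior_max_second_pd[OF open_ball zb])
    show "f y \<le> f z" if "y \<in> ball x0 \<rho>" for y using mx[OF that] by (simp add: f_def A_def)
    show "has_pd j f (\<phi> x0 y * \<phi> x0 y * g1 j y + (\<phi> x0 y * (- 2 * (y $ j - x0 $ j)) + (- 2 * (y $ j - x0 $ j)) * \<phi> x0 y) * gradsq y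
       + A * (2 * (u y \<bullet> a j y))) y" if "y \<in> ball x0 \<rho>" for y
      unfolding f_def using that KU
      by (intro has_pd_add has_pd_mult has_pd_cmult p\<phi> pg pd_usq) auto
    show "has_pd j (\<lambda>y. \<phi> x0 y * \<phi> x0 y * g1 j y + (\<phi> x0 y * (- 2 * (y $ j - x0 $ j)) + (- 2 * (y $ j - x0 $ j)) * \<phi> x0 y) * gradsq y
       + A * (2 * (u y \<bullet> a j y)))
      ((2 * (d j)\<^sup>2 - 4 * \<phi> x0 z) * gradsq z + 4 * \<phi> x0 z * d j * g1 j z + \<phi> x0 z * \<phi> x0 z * g2 j z
      + A * (2 * (u z \<bullet> partial_diff j (a j) z + a j z \<bullet> a j z))) z"
      by (rule has_pd_eq, (rule has_pd_add has_pd_mult has_pd_cmult[of _ "\<lambda>y. 2 * (u y \<bullet> a j y)"] p\<phi> p\<phi>1 pg[OF zU] pg1[OF zU] pd_usq(2)[OF zU])+)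
         (simp add: d_def power2_eq_square algebra_simps)
  qed
  define \<phi>z where "\<phi>z = \<phi> x0 z"
  have nz: "norm (z - x0) < \<rho>" using zb by (simp add: dist_norm norm_minus_commute)
  have \<phi>z: "0 \<le> \<phi>z" "\<phi>z \<le> \<rho>\<^sup>2"
    using nz by (auto simp: \<phi>z_def \<phi>_def intro!: power_mono)
  define q where "q j = (\<Sum>i\<in>UNIV. a i z \<bullet> partial_diff j (partial_diff j (a i)) z)" for j
  \<comment> \<open>The square of \<phi> times a second derivative plus 2 d times a first derivative
    absorbs the mixed term at the cost of 8 d^2 |grad u|^2; this turns the coefficient 2 d^2 into -6
    d^2.\<close>
  have step: "2 * \<phi>z\<^sup>2 * q j + A * (2 * (u z \<bullet> partial_diff j (a j) z + a j z \<bullet> a j z))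
      - (6 * (d j)\<^sup>2 + 4 * \<phi>z) * gradsq z \<le> 0" for j
  proof -
    have "0 \<le> (\<Sum>i\<in>UNIV. 2 * ((\<phi>z *\<^sub>R partial_diff j (a i) z + (2 * d j) *\<^sub>R a i z) \<bullet> (\<phi>z *\<^sub>R partial_diff j (a i) z + (2 * d j) *\<^sub>R a i z)))"
      by (intro sum_nonneg) auto
    also have "\<dots> = (\<Sum>i\<in>UNIV. 2 * \<phi>z\<^sup>2 * (partial_diff j (a i) z \<bullet> partial_diff j (a i) z)
        + 4 * \<phi>z * d j * (2 * (a i z \<bullet> partial_diff j (a i) z)) + 8 * (d j)\<^sup>2 * (a i z \<bullet> a i z))"
      by (rule sum.cong[OF refl]) (simp add: inner_simps inner_commute power2_eq_square algebra_simps)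
    also have "\<dots> = (\<phi>z\<^sup>2 * g2 j z - 2 * \<phi>z\<^sup>2 * q j) + 4 * \<phi>z * d j * g1 j z + 8 * (d j)\<^sup>2 * gradsq z"
      by (simp add: g2_def g1_def q_def gradsq_def sum.distrib sum_distrib_left algebra_simps)
    finally show ?thesis using second[of j] by (simp add: \<phi>z_def power2_eq_square algebra_simps)
  qed
  have "(\<Sum>j\<in>UNIV. 2 * \<phi>z\<^sup>2 * q j + A * (2 * (u z \<bullet> partial_diff j (a j) z + a j z \<bullet> a j z))
      - (6 * (d j)\<^sup>2 + 4 * \<phi>z) * gradsq z) \<le> 0"
    by (intro sum_nonpos step)
  then have tot: "2 * \<phi>z\<^sup>2 * (\<Sum>j\<in>UNIV. q j) + A * (2 * gradsq z + 2 / \<epsilon>\<^sup>2 * (u z \<bullet> grad V (u z)))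
      - (6 * (\<Sum>j\<in>UNIV. (d j)\<^sup>2) + 8 * \<phi>z) * gradsq z \<le> 0"
    unfolding laplace_usq[OF zU, symmetric]
    by (simp add: sum.distrib sum_subtractf sum_distrib_left sum_distrib_right algebra_simps)
  have sd: "(\<Sum>j\<in>UNIV. (d j)\<^sup>2) \<le> 4 * \<rho>\<^sup>2"
  proof -
    have "(\<Sum>j\<in>UNIV. (d j)\<^sup>2) = 4 * (norm (z - x0))\<^sup>2"
      unfolding d_def power_mult_distrib power2_norm_eq_inner inner_vec_def sum_distrib_left
      by (rule sum.cong) (simp_all add: power2_eq_square)
    also have "\<dots> \<le> 4 * \<rho>\<^sup>2" using nz by (intro mult_left_mono power_mono) auto
    finally show ?thesis .
  qed
  have qs: "(\<Sum>j\<in>UNIV. q j) \<ge> - \<Lambda> / \<epsilon>\<^sup>2 * gradsq z"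
  proof -
    have "(\<Sum>j\<in>UNIV. q j) = (\<Sum>i\<in>UNIV. a i z \<bullet> (\<Sum>j\<in>UNIV. partial_diff j (partial_diff j (a i)) z))"
      unfolding q_def inner_sum_right by (rule sum.swap)
    also have "\<dots> = (\<Sum>i\<in>UNIV. 1 / \<epsilon>\<^sup>2 * (a i z \<bullet> (a i z v* hessian V (u z))))"
      by (simp add: laplace_a[OF zU])
    also have "\<dots> \<ge> (\<Sum>i\<in>UNIV. 1 / \<epsilon>\<^sup>2 * (- \<Lambda> * (a i z \<bullet> a i z)))"
      by (intro sum_mono mult_left_mono hess_form_ge sup_bound z) auto
    also have "(\<Sum>i\<in>UNIV. 1 / \<epsilon>\<^sup>2 * (- \<Lambda> * (a i z \<bullet> a i z))) = - \<Lambda> / \<epsilon>\<^sup>2 * gradsq z"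
      by (simp add: gradsq_def sum_distrib_left)
    finally show ?thesis .
  qed
  have uV: "u z \<bullet> grad V (u z) \<ge> - Q" using coercive[of "u z"] alpha_pos
    by (smt (verit) mult_nonneg_nonneg zero_le_power2)
  have "\<phi>z\<^sup>2 / \<epsilon>\<^sup>2 \<le> \<rho>\<^sup>2 / 2"
  proof -
    have "\<phi>z\<^sup>2 \<le> (\<rho>\<^sup>2)\<^sup>2" using \<phi>z by (intro power_mono)
    then have "\<phi>z\<^sup>2 / \<epsilon>\<^sup>2 \<le> (\<rho>\<^sup>2)\<^sup>2 / \<epsilon>\<^sup>2" by (intro divide_right_mono) auto
    also have "\<dots> = \<rho>\<^sup>2 / 256" using eps_pos by (simp add: \<rho>_def power2_eq_square)
    also have "\<dots> \<le> \<rho>\<^sup>2 / 2" by simp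
    finally show ?thesis .
  qed
  then have "(2 * \<Lambda> * gradsq z) * (\<phi>z\<^sup>2 / \<epsilon>\<^sup>2) \<le> (2 * \<Lambda> * gradsq z) * (\<rho>\<^sup>2 / 2)"
    using Lam_pos gradsq_nonneg[of z] by (intro mult_left_mono) auto
  moreover have "2 * \<phi>z\<^sup>2 * (\<Sum>j\<in>UNIV. q j) \<ge> 2 * \<phi>z\<^sup>2 * (- \<Lambda> / \<epsilon>\<^sup>2 * gradsq z)"
    using qs by (intro mult_left_mono) auto
  moreover have "2 * \<phi>z\<^sup>2 * (- \<Lambda> / \<epsilon>\<^sup>2 * gradsq z) = - ((2 * \<Lambda> * gradsq z) * (\<phi>z\<^sup>2 / \<epsilon>\<^sup>2))" by simp
  moreover have "(6 * (\<Sum>j\<in>UNIV. (d j)\<^sup>2) + 8 * \<phi>z) * gradsq z \<le> (32 * \<rho>\<^sup>2) * gradsq z"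
    using sd \<phi>z gradsq_nonneg[of z] by (intro mult_right_mono) auto
  moreover have "2 / \<epsilon>\<^sup>2 * (u z \<bullet> grad V (u z)) \<ge> 2 / \<epsilon>\<^sup>2 * (- Q)" using uV by (intro mult_left_mono) auto
  then have "A * (2 * gradsq z + 2 / \<epsilon>\<^sup>2 * (u z \<bullet> grad V (u z))) \<ge> A * (2 * gradsq z + 2 / \<epsilon>\<^sup>2 * (- Q))"
    using A by (intro mult_left_mono) auto
  \<comment> \<open>The two losses add up to exactly half of the gain 2 A |grad u|^2. The 32 is 6 *
    4 + 8: from the gradient of the cutoff and from its second derivatives.\<close>
  moreover have "32 * \<rho>\<^sup>2 * gradsq z + (2 * \<Lambda> * gradsq z) * (\<rho>\<^sup>2 / 2) = A * gradsq z"
    by (simp add: A_def algebra_simps)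
  ultimately have "A * (2 * gradsq z + 2 / \<epsilon>\<^sup>2 * (- Q)) - A * gradsq z \<le> 0" using tot by linarith
  then have "A * (gradsq z - 2 * Q / \<epsilon>\<^sup>2) \<le> 0" by (simp add: algebra_simps)
  then show ?thesis using A by (simp add: mult_le_0_iff)
qed

text \<open>The maximum of the Bernstein function lies either in the interior, where the gradient is
  controlled, or on the boundary, where the cutoff vanishes and only the bounded term in |u|^2 is
  left. Evaluating at the centre, where the cutoff is \<rho>^2, gives the bound; since \<rho> \<le>
  1/16 the ball stays within the radius 15/16 of the sup bound.\<close>

lemma gradient_bound:
  assumes x0: "norm x0 < 7/8"
  shows "gradsq x0 \<le> G / \<epsilon>\<^sup>2"
proof -
  define \<rho> where "\<rho> = \<epsilon> / 16"
  define \<phi> where "\<phi> x = \<rho>\<^sup>2 - (norm (x - x0))\<^sup>2" for x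
  define f where "f y = \<phi> y * \<phi> y * gradsq y + (32 + \<Lambda>) * \<rho>\<^sup>2 * (u y \<bullet> u y)" for y
  have \<rho>: "\<rho> > 0" "\<rho> \<le> 1/16" using eps_pos eps_le by (auto simp: \<rho>_def)
  have K: "norm x < 15/16" if "x \<in> cball x0 \<rho>" for x
    using that x0 \<rho> norm_triangle_ineq[of x0 "x - x0"] by (simp add: dist_norm norm_minus_commute)
  then have KU: "cball x0 \<rho> \<subseteq> U" by force
  have "continuous_on (cball x0 \<rho>) f"
    unfolding f_def \<phi>_def
    by (intro continuous_intros continuous_on_subset[OF cont_u KU] continuous_on_subset[OF cont_gradsq KU])
  then obtain z where z: "z \<in> cball x0 \<rho>" "\<And>y. y \<in> cball x0 \<rho> \<Longrightarrow> f y \<le> f z"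
    using continuous_attains_sup[of "cball x0 \<rho>" f] \<rho> by auto
  have uz: "(32 + \<Lambda>) * \<rho>\<^sup>2 * (u z \<bullet> u z) \<le> (32 + \<Lambda>) * \<rho>\<^sup>2 * M\<^sup>2"
  proof -
    have "(norm (u z))\<^sup>2 \<le> M\<^sup>2" by (intro power_mono sup_bound K z) auto
    then show ?thesis using Lam_pos by (intro mult_left_mono) (auto simp: power2_norm_eq_inner)
  qed
  have "f z \<le> \<rho>\<^sup>2 * \<rho>\<^sup>2 * (2 * Q / \<epsilon>\<^sup>2) + (32 + \<Lambda>) * \<rho>\<^sup>2 * M\<^sup>2"
  proof (cases "z \<in> ball x0 \<rho>")
    case True
    have "gradsq z \<le> 2 * Q / \<epsilon>\<^sup>2"
      by (rule bernstein_interior[OF K[OF z(1)]])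
         (use True KU z in \<open>auto simp: f_def \<phi>_def \<rho>_def\<close>)
    moreover have "0 \<le> \<phi> z" "\<phi> z \<le> \<rho>\<^sup>2"
      using z(1) by (auto simp: \<phi>_def dist_norm norm_minus_commute intro!: power_mono)
    ultimately have "\<phi> z * \<phi> z * gradsq z \<le> \<rho>\<^sup>2 * \<rho>\<^sup>2 * (2 * Q / \<epsilon>\<^sup>2)"
      using gradsq_nonneg[of z] by (intro mult_mono) auto
    then show ?thesis using uz by (simp add: f_def)
  next
    case False
    then have "\<phi> z = 0" using z(1) by (auto simp: \<phi>_def dist_norm norm_minus_commute)
    moreover have "0 \<le> \<rho>\<^sup>2 * \<rho>\<^sup>2 * (2 * Q / \<epsilon>\<^sup>2)" using Q_nonneg by auto
    ultimately show ?thesis using uz by (simp add: f_def)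
  qed
  moreover have "f x0 \<ge> \<rho>\<^sup>2 * \<rho>\<^sup>2 * gradsq x0" using Lam_pos by (simp add: f_def \<phi>_def)
  ultimately have "\<rho>\<^sup>2 * \<rho>\<^sup>2 * gradsq x0 \<le> \<rho>\<^sup>2 * \<rho>\<^sup>2 * (2 * Q / \<epsilon>\<^sup>2) + (32 + \<Lambda>) * \<rho>\<^sup>2 * M\<^sup>2"
    using z(2)[of x0] \<rho> by simp
  also have "\<dots> = \<rho>\<^sup>2 * \<rho>\<^sup>2 * (G / \<epsilon>\<^sup>2)"
    using eps_pos by (simp add: G_def \<rho>_def power2_eq_square field_simps)
  finally have "\<rho>\<^sup>2 * \<rho>\<^sup>2 * gradsq x0 \<le> \<rho>\<^sup>2 * \<rho>\<^sup>2 * (G / \<epsilon>\<^sup>2)" .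
  moreover have "\<rho>\<^sup>2 * \<rho>\<^sup>2 > 0" using \<rho> by simp
  ultimately show ?thesis by (rule mult_left_le_imp_le)
qed

end

subsection \<open>Cutoffs and strip weights\<close>

lemma has_pd_compose_coord:
  assumes "(g has_real_derivative g') (at (x $ i))"
  shows "has_pd j (\<lambda>x. g (x $ i)) (if j = i then g' else 0) x"
  by (rule has_pd_eq[OF has_pd_compose_DERIV[OF has_pd_coord assms]]) simp

lemma C1_fun_coord:
  assumes "\<And>t. (g has_real_derivative g' t) (at t)" "continuous_on UNIV g'"
  shows "C1_fun (\<lambda>x. g (x $ i)) (\<lambda>j x. if j = i then g' (x $ i) else 0)"
proof -
  have "continuous_on UNIV g"
    by (intro continuous_at_imp_continuous_on ballI DERIV_isCont[OF assms(1)])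
  then have "continuous_on UNIV (\<lambda>x. g (x $ i))" "continuous_on UNIV (\<lambda>x. g' (x $ i))"
    using assms(2) by - (rule continuous_on_compose2[of UNIV], simp, intro continuous_intros, simp)+
  then have "continuous_on UNIV (\<lambda>x. if j = i then g' (x $ i) else 0)" for j by (cases "j = i") auto
  then show ?thesis unfolding C1_fun_def
    by (intro conjI allI has_pd_compose_coord assms(1) \<open>continuous_on UNIV (\<lambda>x. g (x $ i))\<close>)
qed

text \<open>The squared bump divided by its value \<rho>^4 at the centre. On the ball of radius 5/6
  \<rho> it is at least (11/36)^2, slightly more than 1/11. The ratio 5/6 is the one between the
  radii 3/4 and 5/8.\<close>

lemma exists_cutoff:
  fixes x0 :: "real^'n"
  assumes \<rho>: "\<rho> > 0"
  obtains \<psi> \<psi>' where "C1_fun \<psi> \<psi>'" "\<And>x. 0 \<le> \<psi> x" "\<And>x. \<psi> x \<le> 1" "\<And>x. x \<notin> ball x0 \<rho> \<Longrightarrow> \<psi> x = 0"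
    "\<And>i x. \<bar>\<psi>' i x\<bar> \<le> 4 / \<rho>" "\<And>x. x \<in> ball x0 (5 / 6 * \<rho>) \<Longrightarrow> \<psi> x \<ge> 1 / 11"
proof -
  define \<psi> where "\<psi> x = (bump \<rho> (x - x0))\<^sup>2 * (1 / \<rho>^4)" for x
  define \<psi>' where "\<psi>' i x = - 4 * (x $ i - x0 $ i) * bump \<rho> (x - x0) * (1 / \<rho>^4)" for i x
  have "C1_fun (\<lambda>x::real^'n. 1 / \<rho>^4) (\<lambda>i x. 0)" by (simp add: C1_fun_def has_pd_const)
  from C1_fun_mult[OF C1_fun_bump_sq this] have C1: "C1_fun \<psi> \<psi>'"
    unfolding \<psi>_def[abs_def] \<psi>'_def[abs_def] by simp
  have p4: "\<rho>^4 = \<rho> * \<rho>\<^sup>2 * \<rho>" by (simp add: power2_eq_square power4_eq_xxxx)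
  have zero: "bump \<rho> (x - x0) = 0" if "x \<notin> ball x0 \<rho>" for x
    by (rule bump_eq_0) (use that \<rho> in \<open>auto simp: dist_norm norm_minus_commute\<close>)
  show ?thesis
  proof (rule that[OF C1])
    show "0 \<le> \<psi> x" for x by (simp add: \<psi>_def)
    have "(bump \<rho> (x - x0))\<^sup>2 \<le> \<rho>^4" for x
      using power_mono[OF bump_le bump_nonneg, of \<rho> "x - x0" 2] by simp
    then show "\<psi> x \<le> 1" for x using \<rho> by (simp add: \<psi>_def)
    show "\<psi> x = 0" if "x \<notin> ball x0 \<rho>" for x using zero[OF that] by (simp add: \<psi>_def)
    show "\<bar>\<psi>' i x\<bar> \<le> 4 / \<rho>" for i x
    proof (cases "x \<in> ball x0 \<rho>")
      case True
      have "\<bar>(x - x0) $ i\<bar> \<le> norm (x - x0)" by (rule component_le_norm_cart)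
      then have "\<bar>x $ i - x0 $ i\<bar> \<le> \<rho>" using True by (simp add: dist_norm norm_minus_commute)
      moreover have "\<bar>bump \<rho> (x - x0)\<bar> \<le> \<rho>\<^sup>2" using bump_le[of \<rho> "x - x0"] bump_nonneg[of \<rho> "x - x0"] by simp
      ultimately have "\<bar>x $ i - x0 $ i\<bar> * \<bar>bump \<rho> (x - x0)\<bar> \<le> \<rho> * \<rho>\<^sup>2"
        using \<rho> by (intro mult_mono) auto
      then have "4 * (\<bar>x $ i - x0 $ i\<bar> * \<bar>bump \<rho> (x - x0)\<bar>) * (1 / \<rho>^4) \<le> 4 * (\<rho> * \<rho>\<^sup>2) * (1 / \<rho>^4)"
        using \<rho> by (intro mult_right_mono mult_left_mono) auto
      moreover have "\<bar>\<psi>' i x\<bar> = 4 * (\<bar>x $ i - x0 $ i\<bar> * \<bar>bump \<rho> (x - x0)\<bar>) * (1 / \<rho>^4)"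
        using \<rho> unfolding \<psi>'_def abs_mult by simp
      ultimately have "\<bar>\<psi>' i x\<bar> \<le> 4 * (\<rho> * \<rho>\<^sup>2) * (1 / \<rho>^4)" by simp
      also have "\<dots> = 4 / \<rho>" using \<rho> unfolding p4 by simp
      finally show ?thesis .
    qed (use zero \<rho> in \<open>simp add: \<psi>'_def\<close>)
    show "\<psi> x \<ge> 1 / 11" if "x \<in> ball x0 (5 / 6 * \<rho>)" for x
    proof -
      have "(norm (x - x0))\<^sup>2 \<le> (5 / 6 * \<rho>)\<^sup>2"
        using that by (intro power_mono) (auto simp: dist_norm norm_minus_commute)
      then have "11 / 36 * \<rho>\<^sup>2 \<le> \<rho>\<^sup>2 - (norm (x - x0))\<^sup>2" by (simp add: power2_eq_square)
      also have "\<rho>\<^sup>2 - (norm (x - x0))\<^sup>2 \<le> bump \<rho> (x - x0)" by (simp add: bump_def)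
      finally have "bump \<rho> (x - x0) \<ge> 11 / 36 * \<rho>\<^sup>2" .
      then have "(bump \<rho> (x - x0))\<^sup>2 \<ge> (11 / 36 * \<rho>\<^sup>2)\<^sup>2" by (intro power_mono) auto
      then have "\<psi> x \<ge> (11 / 36 * \<rho>\<^sup>2)\<^sup>2 * (1 / \<rho>^4)" unfolding \<psi>_def by (intro mult_right_mono) auto
      also have "(11 / 36 * \<rho>\<^sup>2)\<^sup>2 * (1 / \<rho>^4) = (11/36)\<^sup>2"
        using \<rho> by (simp only: power_mult_distrib) simp
      finally show ?thesis by (simp add: power2_eq_square)
    qed
  qed
qed

text \<open>One-dimensional weights for the strip argument: \<open>z\<close> vanishes on
  \<open>P\<close> and is 1 at distance 3 h, so an antiderivative of 1 - z^2 has slope 1 on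
  \<open>P\<close> and its oscillation is at most the measure of the neighbourhood, however many
  pieces that has.\<close>

lemma thin_weight:
  fixes P :: "real set"
  assumes P: "bounded P" and h: "h > 0"
  obtains z z' \<phi> where "\<And>t. (z has_real_derivative z' t) (at t)" "continuous_on UNIV z'"
    "\<And>t. \<bar>z' t\<bar> \<le> 1 / h" "\<And>t. 0 \<le> z t" "\<And>t. z t \<le> 1" "\<And>t. t \<in> P \<Longrightarrow> z t = 0"
    "\<And>t. (\<phi> has_real_derivative 1 - (z t)\<^sup>2) (at t)"
    "\<And>t. \<bar>\<phi> t\<bar> \<le> measure lborel (\<Union>s\<in>P. ball s (3 * h))"
proof (cases "P = {}")
  \<comment> \<open>Treated separately because \<open>infdist\<close> to the empty set is 0 by
    convention, so the general construction would produce z = 0 instead of z = 1.\<close>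
  case True
  then show ?thesis using h by (intro that[of "\<lambda>_. 1" "\<lambda>_. 0" "\<lambda>_. 0"]) (auto intro!: derivative_eq_intros)
next
  case False
  have anti: "\<exists>F. \<forall>t. (F has_real_derivative f t) (at t)" if "continuous_on UNIV f" for f :: "real \<Rightarrow> real"
    using einterval_antiderivative[of "-\<infinity>" "\<infinity>" f] that
    by (auto simp: continuous_on_eq_continuous_at has_real_derivative_iff_has_vector_derivative)
  \<comment> \<open>This Lipschitz profile is 0 within distance h of \<open>P\<close> and 1 beyond 2
    h. Averaging it over windows of half-width h makes it C^1, and the margins of width h preserve
    the values 0 on \<open>P\<close> and 1 beyond 3 h.\<close>
  define z0 where "z0 s = max 0 (min 1 (infdist s P / h - 1))" for s
  have z0c: "continuous_on A z0" for A
    unfolding z0_def using h by (intro continuous_intros) auto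
  have z01: "0 \<le> z0 s" "z0 s \<le> 1" for s by (auto simp: z0_def)
  obtain Z where Z: "\<And>t. (Z has_real_derivative z0 t) (at t)" using anti[OF z0c] by blast
  define z where "z t = (Z (t + h) - Z (t - h)) / (2 * h)" for t
  define z' where "z' t = (z0 (t + h) - z0 (t - h)) / (2 * h)" for t
  have zd: "(z has_real_derivative z' t) (at t)" for t
  proof -
    have "((\<lambda>t. Z (t + h)) has_real_derivative z0 (t + h) * 1) (at t)"
      "((\<lambda>t. Z (t - h)) has_real_derivative z0 (t - h) * 1) (at t)"
      by (rule DERIV_chain2[OF Z]; auto intro!: derivative_eq_intros)+
    from DERIV_cdivide[OF DERIV_diff[OF this]] show ?thesis unfolding z_def[abs_def] z'_def by simp
  qed
  \<comment> \<open>An average is attained by the mean value theorem, so every pointwise property of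
    \<open>z\<close> is read off from \<open>z0\<close> at a point nearer than h.\<close>
  have zeq: "\<exists>s. \<bar>s - t\<bar> < h \<and> z t = z0 s" for t
  proof -
    obtain s where "t - h < s" "s < t + h" "Z (t + h) - Z (t - h) = (t + h - (t - h)) * z0 s"
      using MVT2[of "t - h" "t + h" Z z0] Z h by auto
    then show ?thesis using h by (intro exI[of _ s]) (auto simp: z_def)
  qed
  have z01': "0 \<le> z t" "z t \<le> 1" for t using zeq[of t] z01 by auto
  have z1: "z t = 1" if "t \<notin> (\<Union>s\<in>P. ball s (3 * h))" for t
  proof -
    obtain s where s: "\<bar>s - t\<bar> < h" "z t = z0 s" using zeq by blast
    have "infdist s P \<ge> 2 * h" unfolding infdist_notempty[OF False]
    proof (rule cINF_greatest[OF False])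
      fix p assume "p \<in> P"
      then have "dist t p \<ge> 3 * h" using that by (auto simp: dist_commute)
      then show "2 * h \<le> dist s p" using s by (auto simp: dist_real_def)
    qed
    then have "infdist s P / h - 1 \<ge> 1" using h by (simp add: le_divide_eq)
    then show ?thesis using s by (simp add: z0_def)
  qed
  have "continuous_on UNIV z" by (intro continuous_at_imp_continuous_on ballI DERIV_isCont[OF zd])
  then have "continuous_on A z" for A by (rule continuous_on_subset) simp
  then have qc: "continuous_on A (\<lambda>t. 1 - (z t)\<^sup>2)" for A
    by (intro continuous_intros)
  obtain F where F: "\<And>t. (F has_real_derivative 1 - (z t)\<^sup>2) (at t)" using anti[OF qc] by blast
  define N where "N = (\<Union>s\<in>P. ball s (3 * h))"
  have Nfin: "emeasure lborel N < \<infinity>"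
  proof (rule emeasure_bounded_finite)
    obtain R where R: "\<And>s. s \<in> P \<Longrightarrow> \<bar>s\<bar> \<le> R" using P unfolding bounded_iff by auto
    have "N \<subseteq> cball 0 (R + 3 * h)" using R by (force simp: N_def dist_real_def)
    then show "bounded N" using bounded_cball bounded_subset by blast
  qed
  have Nb: "N \<in> sets borel" unfolding N_def by (intro borel_open open_UN) auto
  have inc: "\<bar>F t - F s\<bar> \<le> measure lborel N" if st: "s \<le> t" for s t
  proof -
    have "((\<lambda>t. 1 - (z t)\<^sup>2) has_integral (F t - F s)) {s..t}"
      by (rule fundamental_theorem_of_calculus[OF st])
         (use F in \<open>auto simp: has_real_derivative_iff_has_vector_derivative intro: has_vector_derivative_at_within\<close>)
    moreover have int: "set_integrable lborel {s..t} (\<lambda>t. 1 - (z t)\<^sup>2)"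
      unfolding set_integrable_def by (rule borel_integrable_compact[OF compact_Icc qc])
    ultimately have eq: "F t - F s = (LBINT x. indicator {s..t} x *\<^sub>R (1 - (z x)\<^sup>2))"
      using set_borel_integral_eq_integral(2)[OF int] by (simp add: set_lebesgue_integral_def integral_unique)
    have q: "0 \<le> 1 - (z x)\<^sup>2" "1 - (z x)\<^sup>2 \<le> indicator N x" for x
      using z01'[of x] z1[of x] by (auto simp: power_le_one N_def indicator_def)
    have "F t - F s \<ge> 0" unfolding eq using q(1) by (intro integral_nonneg_AE) auto
    moreover have "F t - F s \<le> integral\<^sup>L lborel (indicator N)" unfolding eq
    proof (rule integral_mono)
      show "integrable lborel (\<lambda>x. indicator {s..t} x *\<^sub>R (1 - (z x)\<^sup>2))" using int by (simp add: set_integrable_def)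
      show "integrable lborel (indicator N :: real \<Rightarrow> real)" using Nb Nfin by (intro integrable_real_indicator) auto
      show "indicator {s..t} x *\<^sub>R (1 - (z x)\<^sup>2) \<le> indicator N x" for x
        using q[of x] by (cases "x \<in> {s..t}") auto
    qed
    ultimately show ?thesis by simp
  qed
  show ?thesis
  proof (rule that[of z z' "\<lambda>t. F t - F 0"])
    show "continuous_on UNIV z'" unfolding z'_def[abs_def]
      using h by (intro continuous_intros continuous_on_compose2[OF z0c[of UNIV]]) auto
    show "\<bar>z' t\<bar> \<le> 1 / h" for t
    proof -
      have "\<bar>z0 (t + h) - z0 (t - h)\<bar> \<le> 1" using z01[of "t + h"] z01[of "t - h"] by linarith
      then have "\<bar>z' t\<bar> \<le> 1 / (2 * h)" using h by (simp add: z'_def abs_mult divide_right_mono)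
      also have "\<dots> \<le> 1 / h" using h by (simp add: field_simps)
      finally show ?thesis .
    qed
    show "z t = 0" if "t \<in> P" for t
    proof -
      obtain s where s: "\<bar>s - t\<bar> < h" "z t = z0 s" using zeq by blast
      have "infdist s P \<le> dist s t" by (rule infdist_le[OF that])
      then have "infdist s P / h - 1 \<le> 0" using s h by (simp add: dist_real_def divide_le_eq)
      then have "max 0 (min 1 (infdist s P / h - 1)) = 0" by linarith
      then show ?thesis using s by (simp add: z0_def)
    qed
    show "((\<lambda>t. F t - F 0) has_real_derivative 1 - (z t)\<^sup>2) (at t)" for t
      using F by (auto intro!: derivative_eq_intros)
    show "\<bar>F t - F 0\<bar> \<le> measure lborel (\<Union>s\<in>P. ball s (3 * h))" for t
      using inc[of 0 t] inc[of t 0] unfolding N_def by linarith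
  qed (use zd z01' in auto)
qed

subsection \<open>Energy identities\<close>

locale allen_cahn_wells = allen_cahn_bounded +
  fixes \<theta> c :: real
  assumes theta_pos: "\<theta> > 0" and c_pos: "c > 0"
    and grad_le: "\<And>y. norm y \<le> M \<Longrightarrow> norm (grad V y) \<le> \<Lambda>"
    and well_convex: "\<And>y v. V y < c \<Longrightarrow> \<theta> * (norm v)\<^sup>2 \<le> v \<bullet> (hessian V y *v v)"
    and well_grad: "\<And>y. V y < c \<Longrightarrow> 2 * \<theta> * V y \<le> (norm (grad V y))\<^sup>2"
begin

text \<open>A continuous stand-in for V restricted to the bad set: it vanishes for V \<le> c/2, is
  at least both V and c once V \<ge> c, and never exceeds 2 V since V \<ge> 0.\<close>

definition "P y = max 0 (2 * V y - c)"
definition "C\<^sub>F = \<Lambda> * G / c + \<theta> * (G / (2 * c) + 1)"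

lemma CF_nonneg: "C\<^sub>F \<ge> 0"
  unfolding C\<^sub>F_def using G_nonneg Lam_pos theta_pos c_pos by auto

lemma P_nonneg: "P y \<ge> 0" by (simp add: P_def)

lemma cont_Pu: "continuous_on U (\<lambda>x. P (u x))"
  unfolding P_def by (intro continuous_intros cont_Vu)

definition "hessform x = (\<Sum>i\<in>UNIV. a i x \<bullet> (a i x v* hessian V (u x)))"

lemma cont_hess_a: "continuous_on U (\<lambda>x. a i x v* hessian V (u x))"
proof -
  have "continuous_on U (\<lambda>x. hessian V (u x) $ l $ j)" for l j
    by (rule continuous_on_compose2[OF smooth_hessian_continuous[OF V_smooth, of UNIV] cont_u]) simp
  then show ?thesis
    unfolding vector_matrix_mult_def
    by (rule_tac continuous_on_vec_lambda, rule_tac continuous_on_sum, rule_tac continuous_on_mult)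
       (auto intro!: continuous_on_component cont_a)
qed

text \<open>For V(u) < c, convexity and the gradient inequality of the well give the energy density.
  Otherwise P(u) \<ge> c, and the gradient bound G / \<epsilon>^2 is at most G P(u) / (c
  \<epsilon>^2); the two parts of \<open>C\<^sub>F\<close> pay for the negative part of the Hessian
  form and for the density itself.\<close>

lemma stability_pointwise:
  assumes x: "norm x < 7/8"
  shows "\<theta> * e x / \<epsilon> \<le> (norm (grad V (u x)))\<^sup>2 / (2 * \<epsilon>\<^sup>2) + hessform x + C\<^sub>F * P (u x) / \<epsilon>\<^sup>2"
proof (cases "V (u x) < c")
  case True
  have "(\<Sum>i\<in>UNIV. \<theta> * (a i x \<bullet> a i x)) \<le> hessform x"
    unfolding hessform_def
  proof (rule sum_mono)
    fix i
    show "\<theta> * (a i x \<bullet> a i x) \<le> a i x \<bullet> (a i x v* hessian V (u x))"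
      using well_convex[OF True, of "a i x"] dot_lmul_matrix[of "a i x" "hessian V (u x)" "a i x"]
      by (simp add: inner_commute power2_norm_eq_inner)
  qed
  then have 1: "\<theta> * gradsq x \<le> hessform x" by (simp add: gradsq_def sum_distrib_left)
  have "\<theta> * V (u x) \<le> (norm (grad V (u x)))\<^sup>2 / 2" using well_grad[OF True] by simp
  then have "\<theta> * V (u x) / \<epsilon>\<^sup>2 \<le> (norm (grad V (u x)))\<^sup>2 / 2 / \<epsilon>\<^sup>2" by (rule divide_right_mono) simp
  then have 2: "\<theta> * V (u x) / \<epsilon>\<^sup>2 \<le> (norm (grad V (u x)))\<^sup>2 / (2 * \<epsilon>\<^sup>2)" by simp
  have 3: "C\<^sub>F * P (u x) / \<epsilon>\<^sup>2 \<ge> 0" using CF_nonneg P_nonneg by auto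
  have "\<theta> * e x / \<epsilon> = \<theta> * gradsq x / 2 + \<theta> * V (u x) / \<epsilon>\<^sup>2"
    using eps_pos by (simp add: e_eq power2_eq_square field_simps)
  moreover have "\<theta> * gradsq x \<ge> 0" using theta_pos gradsq_nonneg by auto
  ultimately show ?thesis using 1 2 3 by linarith
next
  case False
  have M: "norm (u x) \<le> M" using x by (intro sup_bound) auto
  have P: "V (u x) \<le> P (u x)" "c \<le> P (u x)" using False by (auto simp: P_def)
  have "(\<Sum>i\<in>UNIV. - \<Lambda> * (a i x \<bullet> a i x)) \<le> hessform x"
    unfolding hessform_def by (intro sum_mono hess_form_ge M)
  then have 1: "- \<Lambda> * gradsq x \<le> hessform x" by (simp add: gradsq_def sum_distrib_left)
  have g: "gradsq x \<le> G / \<epsilon>\<^sup>2" by (rule gradient_bound[OF x])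
  have "1 \<le> P (u x) / c" using P c_pos by (simp add: le_divide_eq)
  then have "G / \<epsilon>\<^sup>2 * 1 \<le> G / \<epsilon>\<^sup>2 * (P (u x) / c)" using G_nonneg by (intro mult_left_mono) auto
  then have g': "gradsq x \<le> G / c * (P (u x) / \<epsilon>\<^sup>2)" using g by (simp add: mult.commute)
  have v: "V (u x) / \<epsilon>\<^sup>2 \<le> P (u x) / \<epsilon>\<^sup>2" using P by (intro divide_right_mono) auto
  have "\<theta> * e x / \<epsilon> = \<theta> * (gradsq x / 2 + V (u x) / \<epsilon>\<^sup>2)"
    using eps_pos by (simp add: e_eq power2_eq_square field_simps)
  also have "\<dots> \<le> \<theta> * (G / c * (P (u x) / \<epsilon>\<^sup>2) / 2 + P (u x) / \<epsilon>\<^sup>2)"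
  proof (rule mult_left_mono)
    show "gradsq x / 2 + V (u x) / \<epsilon>\<^sup>2 \<le> G / c * (P (u x) / \<epsilon>\<^sup>2) / 2 + P (u x) / \<epsilon>\<^sup>2"
      by (rule add_mono[OF divide_right_mono[OF g'] v]) simp
  qed (use theta_pos in simp)
  also have "\<dots> = \<theta> * (G / (2 * c) + 1) * (P (u x) / \<epsilon>\<^sup>2)" by (simp add: algebra_simps)
  finally have e: "\<theta> * e x / \<epsilon> \<le> \<theta> * (G / (2 * c) + 1) * (P (u x) / \<epsilon>\<^sup>2)" .
  have "\<Lambda> * gradsq x \<le> \<Lambda> * (G / c * (P (u x) / \<epsilon>\<^sup>2))" using g' Lam_pos by (intro mult_left_mono) auto
  then have "hessform x \<ge> - (\<Lambda> * G / c * (P (u x) / \<epsilon>\<^sup>2))" using 1 by simp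
  moreover have "C\<^sub>F * P (u x) / \<epsilon>\<^sup>2 = \<Lambda> * G / c * (P (u x) / \<epsilon>\<^sup>2) + \<theta> * (G / (2 * c) + 1) * (P (u x) / \<epsilon>\<^sup>2)"
    unfolding C\<^sub>F_def times_divide_eq_right[symmetric, of _ "P (u x)"] by (rule distrib_right)
  moreover have "(norm (grad V (u x)))\<^sup>2 / (2 * \<epsilon>\<^sup>2) \<ge> 0" by simp
  ultimately show ?thesis using e by linarith
qed

text \<open>The equation is tested with \<open>w\<^sup>2 \<nabla>V(u)\<close>, which needs no choice of a well.\<close>

lemma caccioppoli:
  assumes w: "C1_fun w w'" "\<And>x. x \<notin> K \<Longrightarrow> w x = 0" and K: "compact K" "K \<subseteq> ball 0 (7/8)"
    and W: "\<And>i x. \<bar>w' i x\<bar> \<le> W"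
  shows "\<theta> * (LBINT x. (w x)\<^sup>2 * e x) \<le>
    C\<^sub>F / \<epsilon> * (LBINT x. (w x)\<^sup>2 * P (u x)) + 8 * \<epsilon>\<^sup>2 * W\<^sup>2 * en K"
proof -
  have KU: "K \<subseteq> U" using K(2) by force
  have w2: "C1_fun (\<lambda>x. (w x)\<^sup>2) (\<lambda>i x. 2 * w x * w' i x)"
    using C1_fun_mult[OF w(1) w(1)] by (simp add: power2_eq_square algebra_simps)
  have w20: "(w x)\<^sup>2 = 0" if "x \<notin> K" for x using w(2)[OF that] by simp
  have w2c: "continuous_on UNIV (\<lambda>x. (w x)\<^sup>2)" using w2 by (simp add: C1_fun_def)
  have w2'0: "2 * w x * w' i x = 0" if "x \<notin> K" for x i using w(2)[OF that] by simp
  have w2'c: "continuous_on UNIV (\<lambda>x. 2 * w x * w' i x)" for i using w2 by (simp add: C1_fun_def)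
  \<comment> \<open>This is the partial derivative of V(u), so the divergence of \<open>h\<close> is
    the Laplacian of V(u), the sum of |grad V(u)|^2 / \<epsilon>^2 and the Hessian form.\<close>
  define h where "h i x = a i x \<bullet> grad V (u x)" for i x
  define h' where "h' i x = a i x \<bullet> (a i x v* hessian V (u x)) + partial_diff i (a i) x \<bullet> grad V (u x)" for i x
  have hc: "continuous_on U (h i)" for i unfolding h_def by (intro continuous_intros cont_a cont_gradVu)
  have hpd: "has_pd i (h i) (h' i x) x" if "x \<in> U" for i x
    unfolding h_def h'_def by (intro has_pd_inner pd_a has_pd_compose_potential V_smooth pd_u that)
  have h'c: "continuous_on U (h' i)" for i
    unfolding h'_def by (intro continuous_intros cont_a cont_aa cont_gradVu cont_hess_a)
  have ibp: "(LBINT x. (w x)\<^sup>2 * h' i x) = - (LBINT x. 2 * w x * w' i x * h i x)" for i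
    using cutoff_integration_by_parts[OF open_ball K(1) KU w2 w20 hc h'c hpd] by blast
  have i1: "integrable lborel (\<lambda>x. (w x)\<^sup>2 * h' i x)" for i
    by (rule integrable_cutoff_mult[OF open_ball K(1) KU w2c w20 h'c])
  have i2: "integrable lborel (\<lambda>x. 2 * w x * w' i x * h i x)" for i
    by (rule integrable_cutoff_mult[OF open_ball K(1) KU w2'c w2'0 hc])
  have i3: "integrable lborel (\<lambda>x. (w x)\<^sup>2 * e x)"
    by (rule integrable_cutoff_mult[OF open_ball K(1) KU w2c w20 cont_e])
  have i4: "integrable lborel (\<lambda>x. (w x)\<^sup>2 * P (u x))"
    by (rule integrable_cutoff_mult[OF open_ball K(1) KU w2c w20 cont_Pu])
  have i5: "integrable lborel (\<lambda>x. indicator K x * e x)"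
    by (rule integrable_e[OF _ order.refl K(1) KU]) (use K(1) in \<open>auto intro: borel_compact\<close>)
  define T where "T x = (\<Sum>i\<in>UNIV. (w x)\<^sup>2 * h' i x + 2 * w x * w' i x * h i x)" for x
  have Ti: "integrable lborel T" unfolding T_def using i1 i2 by auto
  have T0: "integral\<^sup>L lborel T = 0"
    unfolding T_def using i1 i2 ibp by (subst Bochner_Integration.integral_sum) auto
  \<comment> \<open>The difference of the two sides of the claim, divided by \<epsilon>. It is
    compared pointwise with \<open>T\<close>, whose integral is 0.\<close>
  define L where "L x = \<theta> / \<epsilon> * ((w x)\<^sup>2 * e x) - C\<^sub>F / \<epsilon>\<^sup>2 * ((w x)\<^sup>2 * P (u x)) - 8 * \<epsilon> * W\<^sup>2 * (indicator K x * e x)" for x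
  have "integral\<^sup>L lborel L \<le> integral\<^sup>L lborel T"
  proof (rule integral_mono[OF _ Ti])
    show "integrable lborel L" unfolding L_def using i3 i4 i5 by auto
    fix x
    show "L x \<le> T x"
    proof (cases "x \<in> K")
      case False
      then show ?thesis using w20 w2'0 by (simp add: L_def T_def)
    next
      case True
      then have xU: "x \<in> U" and x: "norm x < 7/8" using KU K(2) by auto
      define N where "N = (norm (grad V (u x)))\<^sup>2"
      have sh': "(\<Sum>i\<in>UNIV. h' i x) = N / \<epsilon>\<^sup>2 + hessform x"
        using laplace_u[OF xU]
        by (simp add: h'_def sum.distrib hessform_def N_def power2_norm_eq_inner flip: inner_sum_left)
      \<comment> \<open>The square is weighted so that the two directions together use half of the
        term N / \<epsilon>^2; the other half enters the pointwise estimate.\<close>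
      have step: "2 * w x * w' i x * h i x \<ge> - ((w x)\<^sup>2 * N / (4 * \<epsilon>\<^sup>2)) - 4 * \<epsilon>\<^sup>2 * W\<^sup>2 * (a i x \<bullet> a i x)" for i
      proof -
        have "0 \<le> ((w x / (2 * \<epsilon>)) *\<^sub>R grad V (u x) + (2 * \<epsilon> * w' i x) *\<^sub>R a i x)
          \<bullet> ((w x / (2 * \<epsilon>)) *\<^sub>R grad V (u x) + (2 * \<epsilon> * w' i x) *\<^sub>R a i x)" by simp
        also have "\<dots> = (w x)\<^sup>2 * N / (4 * \<epsilon>\<^sup>2) + 2 * w x * w' i x * h i x + 4 * \<epsilon>\<^sup>2 * ((w' i x)\<^sup>2 * (a i x \<bullet> a i x))"
          unfolding N_def power2_norm_eq_inner h_def
          using eps_pos by (simp add: inner_simps inner_commute power2_eq_square field_simps)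
        finally have 1: "0 \<le> (w x)\<^sup>2 * N / (4 * \<epsilon>\<^sup>2) + 2 * w x * w' i x * h i x + 4 * \<epsilon>\<^sup>2 * ((w' i x)\<^sup>2 * (a i x \<bullet> a i x))" .
        have "(w' i x)\<^sup>2 \<le> W\<^sup>2" using power_mono[OF W abs_ge_zero, of i x 2] by simp
        then have "(w' i x)\<^sup>2 * (a i x \<bullet> a i x) \<le> W\<^sup>2 * (a i x \<bullet> a i x)" by (intro mult_right_mono) auto
        then have "4 * \<epsilon>\<^sup>2 * ((w' i x)\<^sup>2 * (a i x \<bullet> a i x)) \<le> 4 * \<epsilon>\<^sup>2 * (W\<^sup>2 * (a i x \<bullet> a i x))"
          by (intro mult_left_mono) auto
        then show ?thesis using 1 by simp
      qed
      have Teq: "T x = (w x)\<^sup>2 * (N / \<epsilon>\<^sup>2 + hessform x) + (\<Sum>i\<in>UNIV. 2 * w x * w' i x * h i x)"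
        unfolding T_def sum.distrib sh'[symmetric] sum_distrib_left ..
      have "(\<Sum>i\<in>UNIV. 2 * w x * w' i x * h i x) \<ge>
        (\<Sum>i\<in>(UNIV::2 set). - ((w x)\<^sup>2 * N / (4 * \<epsilon>\<^sup>2)) - 4 * \<epsilon>\<^sup>2 * W\<^sup>2 * (a i x \<bullet> a i x))"
        by (intro sum_mono step)
      also have "(\<Sum>i\<in>(UNIV::2 set). - ((w x)\<^sup>2 * N / (4 * \<epsilon>\<^sup>2)) - 4 * \<epsilon>\<^sup>2 * W\<^sup>2 * (a i x \<bullet> a i x))
        = - ((w x)\<^sup>2 * N / (2 * \<epsilon>\<^sup>2)) - 4 * \<epsilon>\<^sup>2 * W\<^sup>2 * gradsq x"
        by (simp add: sum_subtractf gradsq_def sum_distrib_left)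
      finally have T: "T x \<ge> (w x)\<^sup>2 * (N / \<epsilon>\<^sup>2 + hessform x) - (w x)\<^sup>2 * N / (2 * \<epsilon>\<^sup>2) - 4 * \<epsilon>\<^sup>2 * W\<^sup>2 * gradsq x"
        unfolding Teq by simp
      have "(w x)\<^sup>2 * (\<theta> * e x / \<epsilon>) \<le> (w x)\<^sup>2 * (N / (2 * \<epsilon>\<^sup>2) + hessform x + C\<^sub>F * P (u x) / \<epsilon>\<^sup>2)"
        using stability_pointwise[OF x] by (intro mult_left_mono) (auto simp: N_def)
      moreover have "(w x)\<^sup>2 * (N / \<epsilon>\<^sup>2 + hessform x) - (w x)\<^sup>2 * N / (2 * \<epsilon>\<^sup>2) = (w x)\<^sup>2 * (N / (2 * \<epsilon>\<^sup>2) + hessform x)"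
        by (simp add: algebra_simps)
      moreover have "4 * \<epsilon> * W\<^sup>2 * (\<epsilon> * gradsq x) \<le> 4 * \<epsilon> * W\<^sup>2 * (2 * e x)"
        using gradsq_le_e[of x] eps_pos by (intro mult_left_mono) auto
      then have "4 * \<epsilon>\<^sup>2 * W\<^sup>2 * gradsq x \<le> 8 * \<epsilon> * W\<^sup>2 * e x" by (simp add: power2_eq_square algebra_simps)
      moreover have "L x = (w x)\<^sup>2 * (\<theta> * e x / \<epsilon>) - (w x)\<^sup>2 * (C\<^sub>F * P (u x) / \<epsilon>\<^sup>2) - 8 * \<epsilon> * W\<^sup>2 * e x"
        using True by (simp add: L_def mult.assoc mult.left_commute)
      moreover have "(w x)\<^sup>2 * (N / (2 * \<epsilon>\<^sup>2) + hessform x + C\<^sub>F * P (u x) / \<epsilon>\<^sup>2)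
        = (w x)\<^sup>2 * (N / (2 * \<epsilon>\<^sup>2) + hessform x) + (w x)\<^sup>2 * (C\<^sub>F * P (u x) / \<epsilon>\<^sup>2)"
        by (rule distrib_left)
      ultimately show ?thesis using T by linarith
    qed
  qed
  then have "integral\<^sup>L lborel L \<le> 0" using T0 by simp
  moreover have "integral\<^sup>L lborel L = \<theta> / \<epsilon> * (LBINT x. (w x)\<^sup>2 * e x)
     - C\<^sub>F / \<epsilon>\<^sup>2 * (LBINT x. (w x)\<^sup>2 * P (u x)) - 8 * \<epsilon> * W\<^sup>2 * en K"
    unfolding L_def en_def using i3 i4 i5 by simp
  ultimately have "\<theta> / \<epsilon> * (LBINT x. (w x)\<^sup>2 * e x)
     - C\<^sub>F / \<epsilon>\<^sup>2 * (LBINT x. (w x)\<^sup>2 * P (u x)) - 8 * \<epsilon> * W\<^sup>2 * en K \<le> 0" by simp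
  then have "\<epsilon> * (\<theta> / \<epsilon> * (LBINT x. (w x)\<^sup>2 * e x)
     - C\<^sub>F / \<epsilon>\<^sup>2 * (LBINT x. (w x)\<^sup>2 * P (u x)) - 8 * \<epsilon> * W\<^sup>2 * en K) \<le> 0"
    using eps_pos by (simp add: mult_le_0_iff)
  then show ?thesis using eps_pos by (simp add: power2_eq_square right_diff_distrib)
qed

text \<open>The stress-energy tensor \<open>e \<delta>\<^sub>i\<^sub>j - \<epsilon> \<partial>\<^sub>iu \<bullet> \<partial>\<^sub>ju\<close> is divergence free; it is tested with \<open>w\<close> in direction \<open>i\<close>.\<close>

lemma pohozaev:
  assumes w: "C1_fun w w'" "\<And>x. x \<notin> K \<Longrightarrow> w x = 0" and K: "compact K" "K \<subseteq> U"
  shows "(LBINT x. w' i x * e x - \<epsilon> * (\<Sum>j\<in>UNIV. w' j x * (a i x \<bullet> a j x))) = 0"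
    and "integrable lborel (\<lambda>x. w' i x * e x - \<epsilon> * (\<Sum>j\<in>UNIV. w' j x * (a i x \<bullet> a j x)))"
proof -
  have w'0: "w' j x = 0" if "x \<notin> K" for j x
    using C1_fun_pd_eq_0[OF w(1) compact_imp_closed[OF K(1)] w(2) that] .
  have wc: "continuous_on UNIV w" "continuous_on UNIV (w' j)" for j using w(1) by (auto simp: C1_fun_def)
  \<comment> \<open>Row \<open>i\<close> of the stress-energy tensor.\<close>
  define h where "h j x = (if j = i then e x else 0) - \<epsilon> * (a i x \<bullet> a j x)" for j x
  define e' where "e' x = \<epsilon> * (\<Sum>j\<in>UNIV. a j x \<bullet> partial_diff i (a j) x) + (grad V (u x) \<bullet> a i x) / \<epsilon>" for x
  define h' where "h' j x = (if j = i then e' x else 0) - \<epsilon> * (a i x \<bullet> partial_diff j (a j) x + partial_diff j (a i) x \<bullet> a j x)" for j x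
  have ipd: "has_pd i e (e' x) x" if x: "x \<in> U" for x
  proof -
    have "has_pd i gradsq (\<Sum>j\<in>UNIV. 2 * (a j x \<bullet> partial_diff i (a j) x)) x"
      unfolding gradsq_def
      by (intro has_pd_sum has_pd_eq[OF has_pd_inner[OF pd_a[OF x] pd_a[OF x]]]) (simp add: inner_commute)
    from has_pd_add[OF has_pd_cmult[OF this, of "\<epsilon> / 2"] has_pd_cmult[OF has_pd_compose_potential(1)[OF V_smooth pd_u[OF x, of i]], of "1 / \<epsilon>"]]
    have "has_pd i (\<lambda>x. \<epsilon> / 2 * gradsq x + 1 / \<epsilon> * V (u x)) (e' x) x"
      by (rule has_pd_eq) (simp add: e'_def sum_distrib_left)
    then show ?thesis by (simp add: e_eq[abs_def] cong del: if_weak_cong)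
  qed
  have hc: "continuous_on U (h j)" for j unfolding h_def
    by (cases "j = i") (auto intro!: continuous_intros cont_a cont_e)
  have e'c: "continuous_on U e'" unfolding e'_def using eps_pos
    by (intro continuous_intros cont_a cont_aa cont_gradVu) auto
  have h'c: "continuous_on U (h' j)" for j unfolding h'_def
    by (cases "j = i") (auto intro!: continuous_intros cont_a cont_aa e'c)
  have hpd: "has_pd j (h j) (h' j x) x" if x: "x \<in> U" for j x
  proof -
    have "has_pd j (\<lambda>x. if j = i then e x else 0) (if j = i then e' x else 0) x"
      using ipd[OF x] has_pd_const[of j 0 x] by (cases "j = i") auto
    then show ?thesis unfolding h_def h'_def
      by (intro has_pd_diff has_pd_cmult has_pd_inner pd_a x)
  qed
  \<comment> \<open>The derivative of V(u) cancels by the equation, and the derivative of the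
    gradient part by symmetry of second derivatives.\<close>
  have div: "(\<Sum>j\<in>UNIV. h' j x) = 0" if x: "x \<in> U" for x
  proof -
    have "(\<Sum>j\<in>UNIV. h' j x) = e' x - \<epsilon> * (a i x \<bullet> (\<Sum>j\<in>UNIV. partial_diff j (a j) x)) - \<epsilon> * (\<Sum>j\<in>UNIV. partial_diff j (a i) x \<bullet> a j x)"
      by (simp add: h'_def sum_subtractf sum.distrib inner_sum_right algebra_simps flip: sum_distrib_left)
    also have "\<dots> = 0"
      unfolding laplace_u[OF x] e'_def using eps_pos
      by (simp add: mixed[OF x, of _ i] inner_commute power2_eq_square)
    finally show ?thesis .
  qed
  have ibp: "(LBINT x. w x * h' j x) = - (LBINT x. w' j x * h j x)" for j
    using cutoff_integration_by_parts[OF open_ball K w hc h'c hpd] by blast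
  have i1: "integrable lborel (\<lambda>x. w x * h' j x)" for j
    by (rule integrable_cutoff_mult[OF open_ball K wc(1) w(2) h'c])
  have i2: "integrable lborel (\<lambda>x. w' j x * h j x)" for j
    by (rule integrable_cutoff_mult[OF open_ball K wc(2) w'0 hc])
  have eq: "(\<lambda>x. \<Sum>j\<in>UNIV. w' j x * h j x) = (\<lambda>x. w' i x * e x - \<epsilon> * (\<Sum>j\<in>UNIV. w' j x * (a i x \<bullet> a j x)))"
  proof
    fix x
    have "w' j x * h j x = (if j = i then w' i x * e x else 0) - \<epsilon> * (w' j x * (a i x \<bullet> a j x))" for j
      by (simp add: h_def algebra_simps)
    then show "(\<Sum>j\<in>UNIV. w' j x * h j x) = w' i x * e x - \<epsilon> * (\<Sum>j\<in>UNIV. w' j x * (a i x \<bullet> a j x))"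
      by (simp add: sum_subtractf sum_distrib_left)
  qed
  have "integrable lborel (\<lambda>x. \<Sum>j\<in>UNIV. w' j x * h j x)" using i2 by auto
  then show "integrable lborel (\<lambda>x. w' i x * e x - \<epsilon> * (\<Sum>j\<in>UNIV. w' j x * (a i x \<bullet> a j x)))"
    unfolding eq .
  have "(LBINT x. \<Sum>j\<in>UNIV. w' j x * h j x) = - (LBINT x. \<Sum>j\<in>UNIV. w x * h' j x)"
    using i1 i2 ibp by (simp add: Bochner_Integration.integral_sum sum_negf)
  also have "(\<lambda>x. \<Sum>j\<in>UNIV. w x * h' j x) = (\<lambda>x. 0)"
  proof
    fix x show "(\<Sum>j\<in>UNIV. w x * h' j x) = 0"
      using div[of x] w(2)[of x] K(2) by (cases "x \<in> K") (auto simp flip: sum_distrib_left)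
  qed
  finally show "(LBINT x. w' i x * e x - \<epsilon> * (\<Sum>j\<in>UNIV. w' j x * (a i x \<bullet> a j x))) = 0"
    unfolding eq by simp
qed

end

section \<open>Energy concentration at the bad set, its projections, and its potential
  energy\<close>

context allen_cahn_wells
begin

text \<open>V(u) has Lipschitz constant at most \<open>2 * \<Lambda> * sqrt G / \<epsilon>\<close>,
  so over a ball of radius \<delta> \<epsilon> it drops by at most c/4. The summand 1 keeps the
  quotient defined if G = 0. The constant \<kappa> below is then c/4 times the area \<pi>
  \<delta>^2.\<close>

definition "\<delta> = min (1/16) (c / (8 * \<Lambda> * (sqrt G + 1)))"
definition "\<kappa> = c * pi * \<delta>\<^sup>2 / 4"

lemma delta_pos: "\<delta> > 0" and delta_le: "\<delta> \<le> 1/16"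
proof -
  have "8 * \<Lambda> * (sqrt G + 1) > 0"
    using Lam_pos G_nonneg by (intro mult_pos_pos add_nonneg_pos) auto
  then have "c / (8 * \<Lambda> * (sqrt G + 1)) > 0" by (rule divide_pos_pos[OF c_pos])
  then show "\<delta> > 0" by (simp add: \<delta>_def)
  show "\<delta> \<le> 1/16" unfolding \<delta>_def by (rule min.cobounded1)
qed

lemma kappa_pos: "\<kappa> > 0"
  unfolding \<kappa>_def using delta_pos c_pos by auto

lemma delta_small: "2 * \<Lambda> * sqrt G * \<delta> \<le> c / 4"
proof -
  have G: "sqrt G \<ge> 0" using G_nonneg by simp
  have "2 * \<Lambda> * sqrt G * \<delta> \<le> 2 * \<Lambda> * sqrt G * (c / (8 * \<Lambda> * (sqrt G + 1)))"
    using G Lam_pos by (intro mult_left_mono) (auto simp: \<delta>_def)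
  also have "\<dots> = c / 4 * (sqrt G / (sqrt G + 1))"
  proof -
    define q where "q = sqrt G + 1"
    then have "q > 0" using G by linarith
    then show ?thesis using Lam_pos unfolding q_def[symmetric] by (simp add: field_simps)
  qed
  also have "\<dots> \<le> c / 4 * 1" using G c_pos by (intro mult_left_mono) (simp_all add: divide_le_eq add_nonneg_pos)
  finally show ?thesis by simp
qed

lemma Vu_lipschitz:
  assumes x: "x \<in> ball 0 (7/8)" and y: "y \<in> ball 0 (7/8)"
  shows "\<bar>V (u x) - V (u y)\<bar> \<le> 2 * \<Lambda> * sqrt G / \<epsilon> * norm (x - y)"
proof -
  have "norm (V (u x) - V (u y)) \<le> 2 * \<Lambda> * sqrt G / \<epsilon> * norm (x - y)"
  proof (rule differentiable_bound[OF convex_ball _ _ x y])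
    fix z assume z: "z \<in> ball (0::real^2) (7/8)"
    then have zU: "z \<in> U" and nz: "norm z < 7/8" "norm z < 15/16" by auto
    have "(u has_derivative (\<lambda>v. \<Sum>i\<in>UNIV. v $ i *\<^sub>R a i z)) (at z)"
      by (rule has_derivative_partial[OF smooth_on_differentiable[OF u_smooth zU]])
    moreover have "V differentiable (at (u z))" using V_smooth by (simp add: smooth_on_differentiable)
    from has_derivative_partial[OF this] grad_inner[OF this]
    have "(V has_derivative (\<lambda>h. grad V (u z) \<bullet> h)) (at (u z))" by simp
    ultimately have "(V \<circ> u has_derivative (\<lambda>h. grad V (u z) \<bullet> h) \<circ> (\<lambda>v. \<Sum>i\<in>UNIV. v $ i *\<^sub>R a i z)) (at z)"
      by (rule diff_chain_at)
    then show "((\<lambda>x. V (u x)) has_derivative (\<lambda>v. grad V (u z) \<bullet> (\<Sum>i\<in>UNIV. v $ i *\<^sub>R a i z))) (at z within ball 0 (7/8))"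
      by (simp add: o_def has_derivative_at_withinI)
    show "onorm (\<lambda>v. grad V (u z) \<bullet> (\<Sum>i\<in>UNIV. v $ i *\<^sub>R a i z)) \<le> 2 * \<Lambda> * sqrt G / \<epsilon>"
    proof (rule onorm_le)
      fix v :: "real^2"
      have ai: "norm (a i z) \<le> sqrt G / \<epsilon>" for i
      proof -
        have "(norm (a i z))\<^sup>2 \<le> G / \<epsilon>\<^sup>2"
          using a_sq_le[of i z] gradient_bound[OF nz(1)] by (simp add: power2_norm_eq_inner)
        then have "norm (a i z) \<le> sqrt (G / \<epsilon>\<^sup>2)" by (rule real_le_rsqrt)
        then show ?thesis using eps_pos by (simp add: real_sqrt_divide)
      qed
      have "norm (\<Sum>i\<in>UNIV. v $ i *\<^sub>R a i z) \<le> (\<Sum>i\<in>UNIV. norm (v $ i *\<^sub>R a i z))" by (rule norm_sum)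
      also have "\<dots> \<le> (\<Sum>i\<in>(UNIV::2 set). norm v * (sqrt G / \<epsilon>))"
        unfolding norm_scaleR by (intro sum_mono mult_mono ai component_le_norm_cart) auto
      finally have 1: "norm (\<Sum>i\<in>UNIV. v $ i *\<^sub>R a i z) \<le> 2 * (norm v * (sqrt G / \<epsilon>))" by simp
      have "norm (grad V (u z) \<bullet> (\<Sum>i\<in>UNIV. v $ i *\<^sub>R a i z)) \<le> norm (grad V (u z)) * norm (\<Sum>i\<in>UNIV. v $ i *\<^sub>R a i z)"
        by (simp add: Cauchy_Schwarz_ineq2)
      also have "\<dots> \<le> \<Lambda> * (2 * (norm v * (sqrt G / \<epsilon>)))"
        by (intro mult_mono grad_le sup_bound nz 1) (use Lam_pos in auto)
      finally show "norm (grad V (u z) \<bullet> (\<Sum>i\<in>UNIV. v $ i *\<^sub>R a i z)) \<le> 2 * \<Lambda> * sqrt G / \<epsilon> * norm v"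
        by (simp add: algebra_simps)
    qed
  qed
  then show ?thesis by simp
qed

text \<open>V(u) stays at least c/4 on the ball, so the density there is at least c / (4
  \<epsilon>), while the area is of order \<epsilon>^2.\<close>

lemma energy_density_lower:
  assumes V: "V (u x) > c / 2" and sub: "ball x (\<delta> * \<epsilon>) \<subseteq> ball 0 (7/8)"
  shows "\<kappa> * \<epsilon> \<le> en (ball x (\<delta> * \<epsilon>))"
proof -
  have r: "\<delta> * \<epsilon> > 0" using delta_pos eps_pos by simp
  have x: "x \<in> ball 0 (7/8)" using sub r by (meson centre_in_ball subsetD)
  have low: "c / (4 * \<epsilon>) \<le> e y" if y: "y \<in> ball x (\<delta> * \<epsilon>)" for y
  proof -
    have "norm (x - y) \<le> \<delta> * \<epsilon>" using y by (simp add: dist_norm)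
    then have "2 * \<Lambda> * sqrt G / \<epsilon> * norm (x - y) \<le> 2 * \<Lambda> * sqrt G / \<epsilon> * (\<delta> * \<epsilon>)"
      using Lam_pos G_nonneg eps_pos by (intro mult_left_mono) auto
    also have "\<dots> \<le> c / 4" using delta_small eps_pos by simp
    finally have "V (u y) \<ge> c / 4"
      using Vu_lipschitz[OF x, of y] y sub V by force
    then have "c / 4 \<le> \<epsilon> * e y" using V_le_e[of y] by linarith
    then show ?thesis using eps_pos by (simp add: field_simps)
  qed
  have "\<kappa> * \<epsilon> = c / (4 * \<epsilon>) * measure lborel (ball x (\<delta> * \<epsilon>))"
    using r eps_pos by (simp add: content_ball unit_ball_vol_2 \<kappa>_def power2_eq_square field_simps)
  also have "\<dots> = (LBINT y. c / (4 * \<epsilon>) * indicator (ball x (\<delta> * \<epsilon>)) y)" by simp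
  also have "\<dots> \<le> en (ball x (\<delta> * \<epsilon>))"
    unfolding en_def
  proof (rule integral_mono)
    show "integrable lborel (\<lambda>y. c / (4 * \<epsilon>) * indicator (ball x (\<delta> * \<epsilon>)) y)"
      by (intro integrable_mult_right integrable_real_indicator) (use emeasure_lborel_ball_finite in auto)
    show "integrable lborel (\<lambda>y. indicator (ball x (\<delta> * \<epsilon>)) y * e y)"
      by (rule integrable_e[of _ "cball 0 (7/8)"]) (use sub in \<open>auto simp: subset_iff less_imp_le\<close>)
    show "c / (4 * \<epsilon>) * indicator (ball x (\<delta> * \<epsilon>)) y \<le> indicator (ball x (\<delta> * \<epsilon>)) y * e y" for y
      using low[of y] by (cases "y \<in> ball x (\<delta> * \<epsilon>)") (auto simp: indicator_def)
  qed
  finally show ?thesis .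
qed

text \<open>Every point of the projection of the bad set sees energy at least \<open>\<kappa> \<epsilon>\<close> in a strip of width
  \<open>8 h\<close>, so Fubini's theorem bounds the measure of the projection.\<close>

lemma projection_measure:
  fixes i :: 2
  assumes S: "ball x0 r \<subseteq> ball 0 (7/8)" and \<rho>: "\<rho> + \<delta> * \<epsilon> \<le> r" and h: "\<delta> * \<epsilon> \<le> h"
  defines "N \<equiv> (\<Union>s\<in>(\<lambda>x. x $ i) ` {x \<in> cball x0 \<rho>. V (u x) > c / 2}. ball s (3 * h))"
  shows "measure lborel N * (\<kappa> * \<epsilon>) \<le> 8 * h * en (ball x0 r)"
proof -
  define S' where "S' = ball x0 r"
  have h0: "h > 0" using h delta_pos eps_pos by (meson less_le_trans mult_pos_pos)
  have ke: "\<kappa> * \<epsilon> \<ge> 0" using kappa_pos eps_pos by simp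
  have intS: "integrable lborel (\<lambda>y. indicator T y * e y)" if "T \<in> sets borel" "T \<subseteq> S'" for T
    by (rule integrable_e[of _ "cball 0 (7/8)"]) (use that S in \<open>auto simp: subset_iff S'_def less_imp_le\<close>)
  have nnT: "(\<integral>\<^sup>+y. ennreal (indicator T y * e y) \<partial>lborel) = ennreal (en T)" if "T \<in> sets borel" "T \<subseteq> S'" for T
    unfolding en_def by (rule nn_integral_eq_integral[OF intS[OF that]]) (use e_nonneg in auto)
  have gm[measurable]: "(\<lambda>y. indicator S' y * e y) \<in> borel_measurable lborel"
    using intS[of S'] by (auto simp: S'_def)
  \<comment> \<open>The strip condition uses 4 h: a point of \<open>N\<close> is within 3 h of a
    projected bad point, whose energy ball has radius at most h.\<close>
  define A where "A = {p::real \<times> (real^2). \<bar>snd p $ i - fst p\<bar> < 4 * h}"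
  have "open A" unfolding A_def by (intro open_Collect_less continuous_intros)
  then have Am[measurable]: "A \<in> sets (lborel \<Otimes>\<^sub>M lborel)"
    using borel_open borel_prod sets_pair_measure_cong[OF sets_lborel sets_lborel] by metis
  have Nm[measurable]: "N \<in> sets borel" unfolding N_def by (intro borel_open open_UN) auto
  have "ennreal (\<kappa> * \<epsilon>) * emeasure lborel N = (\<integral>\<^sup>+t. ennreal (\<kappa> * \<epsilon>) * indicator N t \<partial>lborel)"
    by (simp add: nn_integral_cmult_indicator)
  also have "\<dots> \<le> (\<integral>\<^sup>+t. (\<integral>\<^sup>+y. ennreal (indicator S' y * e y) * indicator A (t, y) \<partial>lborel) \<partial>lborel)"
  proof (rule nn_integral_mono)
    fix t
    show "ennreal (\<kappa> * \<epsilon>) * indicator N t \<le> (\<integral>\<^sup>+y. ennreal (indicator S' y * e y) * indicator A (t, y) \<partial>lborel)"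
    proof (cases "t \<in> N")
      case True
      then obtain x where x: "x \<in> cball x0 \<rho>" "V (u x) > c / 2" "\<bar>x $ i - t\<bar> < 3 * h"
        unfolding N_def by (auto simp: dist_real_def)
      define T where "T = ball x (\<delta> * \<epsilon>)"
      have TS: "T \<subseteq> S'"
      proof
        fix y assume "y \<in> T"
        then show "y \<in> S'" using x(1) \<rho> dist_triangle[of x0 y x] by (auto simp: T_def S'_def)
      qed
      have TA: "(t, y) \<in> A" if "y \<in> T" for y
      proof -
        have "\<bar>(y - x) $ i\<bar> \<le> norm (y - x)" by (rule component_le_norm_cart)
        moreover have "norm (y - x) < \<delta> * \<epsilon>" using that by (simp add: T_def dist_norm norm_minus_commute)
        ultimately show ?thesis using x(3) h by (simp add: A_def)
      qed
      have "ennreal (\<kappa> * \<epsilon>) * indicator N t = ennreal (\<kappa> * \<epsilon>)" using True by simp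
      also have "\<dots> \<le> ennreal (en T)"
        by (rule ennreal_leI) (unfold T_def, rule energy_density_lower[OF x(2)], use TS S in \<open>auto simp: T_def S'_def\<close>)
      also have "\<dots> = (\<integral>\<^sup>+y. ennreal (indicator T y * e y) \<partial>lborel)" using TS by (subst nnT) (auto simp: T_def)
      also have "\<dots> \<le> (\<integral>\<^sup>+y. ennreal (indicator S' y * e y) * indicator A (t, y) \<partial>lborel)"
        by (rule nn_integral_mono) (use TS TA in \<open>auto simp: indicator_def\<close>)
      finally show ?thesis .
    qed simp
  qed
  \<comment> \<open>After the exchange each point \<open>y\<close> is counted for the parameters
    \<open>t\<close> in an interval of length 8 h.\<close>
  also have "\<dots> = (\<integral>\<^sup>+y. (\<integral>\<^sup>+t. ennreal (indicator S' y * e y) * indicator A (t, y) \<partial>lborel) \<partial>lborel)"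
    by (rule lborel_pair.Fubini'[symmetric]) measurable
  also have "\<dots> = (\<integral>\<^sup>+y. ennreal (8 * h) * ennreal (indicator S' y * e y) \<partial>lborel)"
  proof (rule nn_integral_cong)
    fix y :: "real^2"
    have "(\<integral>\<^sup>+t. ennreal (indicator S' y * e y) * indicator A (t, y) \<partial>lborel)
      = (\<integral>\<^sup>+t. ennreal (indicator S' y * e y) * indicator {y $ i - 4 * h<..<y $ i + 4 * h} t \<partial>lborel)"
      by (rule nn_integral_cong) (auto simp: indicator_def A_def)
    also have "\<dots> = ennreal (indicator S' y * e y) * emeasure lborel {y $ i - 4 * h<..<y $ i + 4 * h}"
      by (rule nn_integral_cmult_indicator) simp
    also have "emeasure lborel {y $ i - 4 * h<..<y $ i + 4 * h} = ennreal (8 * h)"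
      using h0 by simp
    finally show "(\<integral>\<^sup>+t. ennreal (indicator S' y * e y) * indicator A (t, y) \<partial>lborel) = ennreal (8 * h) * ennreal (indicator S' y * e y)"
      by (simp add: mult.commute)
  qed
  also have "\<dots> = ennreal (8 * h) * ennreal (en S')"
    by (subst nn_integral_cmult) (use gm in simp, subst nnT, auto simp: S'_def)
  also have "\<dots> = ennreal (8 * h * en S')" using h0 by (simp add: ennreal_mult')
  finally have *: "ennreal (\<kappa> * \<epsilon>) * emeasure lborel N \<le> ennreal (8 * h * en S')" .
  \<comment> \<open>Boundedness makes the measure finite, which allows the return from extended to
    real numbers.\<close>
  have "bounded N"
  proof -
    have "N \<subseteq> cball 0 (norm x0 + \<rho> + 3 * h)"
    proof
      fix t assume "t \<in> N"
      then obtain x where x: "x \<in> cball x0 \<rho>" "\<bar>x $ i - t\<bar> < 3 * h"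
        unfolding N_def by (auto simp: dist_real_def)
      have "\<bar>x $ i\<bar> \<le> norm x" by (rule component_le_norm_cart)
      moreover have "norm x \<le> norm x0 + \<rho>"
        using x(1) norm_triangle_ineq[of x0 "x - x0"] by (simp add: dist_norm norm_minus_commute)
      ultimately show "t \<in> cball 0 (norm x0 + \<rho> + 3 * h)" using x(2) by auto
    qed
    then show ?thesis using bounded_cball bounded_subset by blast
  qed
  then have "emeasure lborel N = ennreal (measure lborel N)"
    by (intro emeasure_eq_ennreal_measure) (use emeasure_bounded_finite in force)
  then have "ennreal (\<kappa> * \<epsilon> * measure lborel N) \<le> ennreal (8 * h * en S')"
    using * ke by (simp add: ennreal_mult')
  moreover have "8 * h * en S' \<ge> 0" using h0 en_nonneg by auto
  ultimately show ?thesis by (simp add: S'_def mult.commute)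
qed

lemma potential_estimate:
  assumes \<psi>: "C1_fun \<psi> \<psi>'" "\<And>x. x \<notin> K \<Longrightarrow> \<psi> x = 0" "\<And>x. 0 \<le> \<psi> x" "\<And>x. \<psi> x \<le> 1" "\<And>i x. \<bar>\<psi>' i x\<bar> \<le> X"
    and K: "compact K" "K \<subseteq> U"
    and z: "\<And>i::2. continuous_on UNIV (z i)"
    and \<phi>: "\<And>i t. (\<phi> i has_real_derivative 1 - (z i t)\<^sup>2) (at t)" "\<And>i t. \<bar>\<phi> i t\<bar> \<le> \<Phi>"
  shows "(LBINT x. (\<psi> x)\<^sup>2 * P (u x)) / \<epsilon> \<le>
    (\<Sum>i\<in>UNIV. (LBINT x. (\<psi> x * z i (x $ i))\<^sup>2 * e x)) + 20 * \<Phi> * X * en K"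
proof -
  have X: "X \<ge> 0" using \<psi>(5)[of undefined undefined] by linarith
  have \<Phi>0: "\<Phi> \<ge> 0" using \<phi>(2)[of undefined undefined] by linarith
  define w where "w i x = (\<psi> x)\<^sup>2 * \<phi> i (x $ i)" for i :: 2 and x
  define w' where "w' i j x = (\<psi> x)\<^sup>2 * (if j = i then 1 - (z i (x $ i))\<^sup>2 else 0) + 2 * \<psi> x * \<psi>' j x * \<phi> i (x $ i)" for i j :: 2 and x
  have \<psi>2: "C1_fun (\<lambda>x. (\<psi> x)\<^sup>2) (\<lambda>i x. 2 * \<psi> x * \<psi>' i x)"
    using C1_fun_mult[OF \<psi>(1) \<psi>(1)] by (simp add: power2_eq_square algebra_simps)
  have w: "C1_fun (w i) (w' i)" for i
    unfolding w_def[abs_def] w'_def[abs_def]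
    by (rule C1_fun_mult[OF \<psi>2 C1_fun_coord[OF \<phi>(1)]]) (intro continuous_intros z)
  have w0: "w i x = 0" if "x \<notin> K" for i x using \<psi>(2)[OF that] by (simp add: w_def)
  define T where "T i x = w' i i x * e x - \<epsilon> * (\<Sum>j\<in>UNIV. w' i j x * (a i x \<bullet> a j x))" for i x
  have Tint: "integrable lborel (T i)" "integral\<^sup>L lborel (T i) = 0" for i
    unfolding T_def using pohozaev[OF w[of i] w0 K, of i] by auto
  have \<psi>c: "continuous_on UNIV (\<lambda>x. (\<psi> x)\<^sup>2)" using \<psi>2 by (simp add: C1_fun_def)
  have \<psi>20: "(\<psi> x)\<^sup>2 = 0" if "x \<notin> K" for x using \<psi>(2)[OF that] by simp
  have zc: "continuous_on UNIV (\<lambda>x. z i (x $ i))" for i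
    by (rule continuous_on_compose2[OF z[of i]]) (auto intro!: continuous_intros)
  have i1: "integrable lborel (\<lambda>x. (\<psi> x)\<^sup>2 * P (u x))"
    by (rule integrable_cutoff_mult[OF open_ball K \<psi>c \<psi>20 cont_Pu])
  have i2: "integrable lborel (\<lambda>x. (\<psi> x * z i (x $ i))\<^sup>2 * e x)" for i
  proof (rule integrable_cutoff_mult[OF open_ball K _ _ cont_e])
    show "continuous_on UNIV (\<lambda>x. (\<psi> x * z i (x $ i))\<^sup>2)"
      using \<psi>(1) by (intro continuous_intros zc) (simp add: C1_fun_def)
  qed (use \<psi>(2) in simp)
  have i3: "integrable lborel (\<lambda>x. indicator K x * e x)"
    by (rule integrable_e[OF _ order.refl K]) (use K(1) in \<open>auto intro: borel_compact\<close>)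
  define R where "R x = 1 / \<epsilon> * ((\<psi> x)\<^sup>2 * P (u x)) - (\<Sum>i\<in>UNIV. (\<psi> x * z i (x $ i))\<^sup>2 * e x) - 20 * \<Phi> * X * (indicator K x * e x)" for x
  have "integral\<^sup>L lborel R \<le> (LBINT x. \<Sum>i\<in>UNIV. T i x)"
  proof (rule integral_mono)
    show "integrable lborel R" unfolding R_def using i1 i2 i3 by auto
    show "integrable lborel (\<lambda>x. \<Sum>i\<in>UNIV. T i x)" using Tint by auto
    fix x
    show "R x \<le> (\<Sum>i\<in>UNIV. T i x)"
    proof (cases "x \<in> K")
      case False
      then show ?thesis using \<psi>(2)[OF False] by (simp add: R_def T_def w'_def)
    next
      case True
      \<comment> \<open>Replacing the slope 1 - z^2 by 1 costs (\<psi> z)^2 times e - \<epsilon> |a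
        i|^2; the negative part of this cost is dropped.\<close>
      have step: "T i x \<ge> (\<psi> x)\<^sup>2 * (e x - \<epsilon> * (a i x \<bullet> a i x)) - (\<psi> x * z i (x $ i))\<^sup>2 * e x - 10 * \<Phi> * X * e x" for i
      proof -
        define s where "s = \<psi>' i x * e x - \<epsilon> * (\<Sum>j\<in>UNIV. \<psi>' j x * (a i x \<bullet> a j x))"
        have Teq: "T i x = (\<psi> x)\<^sup>2 * (1 - (z i (x $ i))\<^sup>2) * (e x - \<epsilon> * (a i x \<bullet> a i x)) + 2 * \<psi> x * \<phi> i (x $ i) * s"
        proof -
          have "(\<Sum>j\<in>UNIV. w' i j x * (a i x \<bullet> a j x)) =
             (\<Sum>j\<in>UNIV. if j = i then (\<psi> x)\<^sup>2 * (1 - (z i (x $ i))\<^sup>2) * (a i x \<bullet> a i x) else 0)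
             + 2 * \<psi> x * \<phi> i (x $ i) * (\<Sum>j\<in>UNIV. \<psi>' j x * (a i x \<bullet> a j x))"
            unfolding sum_distrib_left sum.distrib[symmetric]
            by (rule sum.cong) (auto simp: w'_def algebra_simps)
          then have "(\<Sum>j\<in>UNIV. w' i j x * (a i x \<bullet> a j x)) = (\<psi> x)\<^sup>2 * (1 - (z i (x $ i))\<^sup>2) * (a i x \<bullet> a i x)
             + 2 * \<psi> x * \<phi> i (x $ i) * (\<Sum>j\<in>UNIV. \<psi>' j x * (a i x \<bullet> a j x))" by simp
          moreover have "w' i i x = (\<psi> x)\<^sup>2 * (1 - (z i (x $ i))\<^sup>2) + 2 * \<psi> x * \<psi>' i x * \<phi> i (x $ i)"
            by (simp add: w'_def)
          ultimately show ?thesis unfolding T_def s_def by (simp only:) (simp add: algebra_simps)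
        qed
        have aij: "\<bar>a i x \<bullet> a j x\<bar> \<le> gradsq x" for j
        proof -
          have "2 * \<bar>a i x \<bullet> a j x\<bar> \<le> 2 * (norm (a i x) * norm (a j x))" by (simp add: Cauchy_Schwarz_ineq2)
          also have "\<dots> \<le> (norm (a i x))\<^sup>2 + (norm (a j x))\<^sup>2"
            using sum_squares_bound[of "norm (a i x)" "norm (a j x)"] by simp
          also have "\<dots> \<le> 2 * gradsq x" using a_sq_le[of i x] a_sq_le[of j x] by (simp add: power2_norm_eq_inner)
          finally show ?thesis by simp
        qed
        \<comment> \<open>One \<open>X * e x\<close> from the diagonal and two from each of the two
          products, as \<epsilon> |grad u|^2 \<le> 2 e. The resulting 5 becomes 10 with the factor 2
          \<psi> \<phi>, and 20 after summing directions.\<close>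
        have "\<bar>s\<bar> \<le> X * e x + \<epsilon> * (\<Sum>j\<in>(UNIV::2 set). X * gradsq x)"
        proof -
          have "\<bar>\<psi>' i x * e x\<bar> \<le> X * e x"
            unfolding abs_mult using \<psi>(5)[of i x] e_nonneg[of x] by (intro mult_mono) auto
          moreover have "\<bar>\<Sum>j\<in>UNIV. \<psi>' j x * (a i x \<bullet> a j x)\<bar> \<le> (\<Sum>j\<in>(UNIV::2 set). X * gradsq x)"
            by (rule order_trans[OF sum_abs sum_mono]) (unfold abs_mult, intro mult_mono \<psi>(5) aij X, auto)
          then have "\<bar>\<epsilon> * (\<Sum>j\<in>UNIV. \<psi>' j x * (a i x \<bullet> a j x))\<bar> \<le> \<epsilon> * (\<Sum>j\<in>(UNIV::2 set). X * gradsq x)"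
            unfolding abs_mult using eps_pos by simp
          ultimately show ?thesis unfolding s_def by linarith
        qed
        also have "\<dots> = X * e x + 2 * X * (\<epsilon> * gradsq x)" by simp
        also have "\<dots> \<le> X * e x + 2 * X * (2 * e x)"
          using gradsq_le_e X by (intro add_left_mono mult_left_mono) auto
        finally have s: "\<bar>s\<bar> \<le> 5 * X * e x" by simp
        have "\<bar>\<psi> x * \<phi> i (x $ i)\<bar> \<le> 1 * \<Phi>"
          unfolding abs_mult using \<psi>(3,4)[of x] \<phi>(2)[of i "x $ i"] by (intro mult_mono) auto
        then have "\<bar>\<psi> x * \<phi> i (x $ i)\<bar> * \<bar>s\<bar> \<le> \<Phi> * (5 * X * e x)"
          using s \<Phi>0 by (intro mult_mono) auto
        note bnd = this
        have A: "2 * \<psi> x * \<phi> i (x $ i) * s \<ge> - (10 * \<Phi> * X * e x)"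
        proof -
          have "\<bar>\<psi> x * \<phi> i (x $ i) * s\<bar> \<le> \<Phi> * (5 * X * e x)" using bnd by (simp only: abs_mult[of _ s])
          then have "- (\<Phi> * (5 * X * e x)) \<le> \<psi> x * \<phi> i (x $ i) * s" by linarith
          then show ?thesis by (simp add: algebra_simps)
        qed
        have "(\<psi> x * z i (x $ i))\<^sup>2 * (\<epsilon> * (a i x \<bullet> a i x)) \<ge> 0" using eps_pos by auto
        moreover have "(\<psi> x)\<^sup>2 * (1 - (z i (x $ i))\<^sup>2) * (e x - \<epsilon> * (a i x \<bullet> a i x)) =
          (\<psi> x)\<^sup>2 * (e x - \<epsilon> * (a i x \<bullet> a i x)) - (\<psi> x * z i (x $ i))\<^sup>2 * e x + (\<psi> x * z i (x $ i))\<^sup>2 * (\<epsilon> * (a i x \<bullet> a i x))"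
          by (simp add: power_mult_distrib algebra_simps)
        ultimately show ?thesis using A Teq by linarith
      qed
      have "(\<Sum>i\<in>UNIV. (\<psi> x)\<^sup>2 * (e x - \<epsilon> * (a i x \<bullet> a i x))) = (\<psi> x)\<^sup>2 * (2 * e x - \<epsilon> * gradsq x)"
        by (simp add: gradsq_def sum_subtractf flip: sum_distrib_left)
      also have "2 * e x - \<epsilon> * gradsq x = 2 * V (u x) / \<epsilon>" by (simp add: e_eq)
      finally have s1: "(\<Sum>i\<in>UNIV. (\<psi> x)\<^sup>2 * (e x - \<epsilon> * (a i x \<bullet> a i x))) = (\<psi> x)\<^sup>2 * (2 * V (u x) / \<epsilon>)" .
      have "P (u x) \<le> 2 * V (u x)" using V_nonneg[of "u x"] c_pos by (simp add: P_def)
      then have "(\<psi> x)\<^sup>2 * (P (u x) / \<epsilon>) \<le> (\<psi> x)\<^sup>2 * (2 * V (u x) / \<epsilon>)"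
        using eps_pos by (intro mult_left_mono divide_right_mono) auto
      then have "R x \<le> (\<psi> x)\<^sup>2 * (2 * V (u x) / \<epsilon>) - (\<Sum>i\<in>UNIV. (\<psi> x * z i (x $ i))\<^sup>2 * e x) - 20 * \<Phi> * X * e x"
        using True by (simp add: R_def)
      also have "\<dots> = (\<Sum>i\<in>UNIV. (\<psi> x)\<^sup>2 * (e x - \<epsilon> * (a i x \<bullet> a i x)) - (\<psi> x * z i (x $ i))\<^sup>2 * e x - 10 * \<Phi> * X * e x)"
        unfolding sum_subtractf s1 by simp
      also have "\<dots> \<le> (\<Sum>i\<in>UNIV. T i x)" by (intro sum_mono step)
      finally show ?thesis .
    qed
  qed
  also have "\<dots> = 0" using Tint by (subst Bochner_Integration.integral_sum) auto
  finally have "integral\<^sup>L lborel R \<le> 0" .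
  moreover have "integral\<^sup>L lborel R = 1 / \<epsilon> * (LBINT x. (\<psi> x)\<^sup>2 * P (u x))
    - (\<Sum>i\<in>UNIV. (LBINT x. (\<psi> x * z i (x $ i))\<^sup>2 * e x)) - 20 * \<Phi> * X * en K"
    unfolding R_def en_def using i1 i2 i3 by (simp add: Bochner_Integration.integral_sum)
  ultimately show ?thesis by simp
qed

end

subsection \<open>Decay of the energy\<close>

lemma enn2real_energy_ge:
  assumes V: "\<And>y. V y \<ge> 0" and \<epsilon>: "\<epsilon> > 0" and fin: "energy \<epsilon> V u T < \<infinity>" and ST: "S \<subseteq> T"
  shows "(LBINT x. indicator S x * energy_density \<epsilon> V u x) \<le> enn2real (energy \<epsilon> V u T)"
\<comment> \<open>If integrability fails, the real integral is 0 by convention and the inequality is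
  trivial.\<close>
proof (cases "integrable lborel (\<lambda>x. indicator S x * energy_density \<epsilon> V u x)")
  case True
  have e: "energy_density \<epsilon> V u x \<ge> 0" for x
    unfolding energy_density_def using V[of "u x"] \<epsilon>
    by (intro add_nonneg_nonneg divide_nonneg_nonneg mult_nonneg_nonneg sum_nonneg) auto
  have "ennreal ((LBINT x. indicator S x * energy_density \<epsilon> V u x)) =
    (\<integral>\<^sup>+x. ennreal (indicator S x * energy_density \<epsilon> V u x) \<partial>lborel)"
    by (rule nn_integral_eq_integral[OF True, symmetric]) (use e in auto)
  also have "\<dots> \<le> (\<integral>\<^sup>+x\<in>T. ennreal (energy_density \<epsilon> V u x) \<partial>lborel)"
    by (rule nn_integral_mono) (use ST in \<open>auto simp: indicator_def\<close>)
  also have "\<dots> = energy \<epsilon> V u T" by (simp add: energy_def nn_integral_completion)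
  finally have "ennreal ((LBINT x. indicator S x * energy_density \<epsilon> V u x)) \<le> energy \<epsilon> V u T" .
  then have "enn2real (ennreal ((LBINT x. indicator S x * energy_density \<epsilon> V u x))) \<le> enn2real (energy \<epsilon> V u T)"
    by (rule enn2real_mono) (use fin in simp)
  moreover have "(LBINT x. indicator S x * energy_density \<epsilon> V u x) \<ge> 0"
    by (rule integral_nonneg_AE) (use e in auto)
  ultimately show ?thesis by simp
qed (simp add: not_integrable_integral_eq)

text \<open>The connected image is covered by two disjoint open sets: one of the balls and the union
  of all others.\<close>

lemma connected_in_one_ball:
  assumes S: "connected S" "S \<noteq> {}" and f: "continuous_on S f"
    and near: "\<And>x. x \<in> S \<Longrightarrow> \<exists>\<sigma>\<in>Z. f x \<in> ball \<sigma> m"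
    and disj: "\<And>\<sigma> \<tau>. \<sigma> \<in> Z \<Longrightarrow> \<tau> \<in> Z \<Longrightarrow> \<sigma> \<noteq> \<tau> \<Longrightarrow> ball \<sigma> m \<inter> ball \<tau> m = {}"
  shows "\<exists>\<sigma>\<in>Z. f ` S \<subseteq> ball \<sigma> m"
proof -
  obtain x \<sigma> where x: "x \<in> S" "\<sigma> \<in> Z" "f x \<in> ball \<sigma> m" using S near by blast
  have "ball \<sigma> m \<inter> f ` S = {} \<or> (\<Union>\<tau>\<in>Z - {\<sigma>}. ball \<tau> m) \<inter> f ` S = {}"
    by (rule connectedD[OF connected_continuous_image[OF f S(1)]])
       (use near disj[OF x(2)] in \<open>auto, blast+\<close>)
  then have "(\<Union>\<tau>\<in>Z - {\<sigma>}. ball \<tau> m) \<inter> f ` S = {}" using x by blast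
  then have "f ` S \<subseteq> ball \<sigma> m" using near by fastforce
  then show ?thesis using x by blast
qed

text \<open>The order of choice matters: K is taken large for the 1 / K^2 term, then \<eta> small in
  terms of K. Each term is made at most 1/4, and \<eta> \<le> \<kappa> / (16 K) prepares the final
  contradiction at scale \<epsilon>.\<close>

lemma decay_constants:
  fixes \<theta> \<kappa> C :: real
  assumes "\<theta> > 0" "\<kappa> > 0" "C \<ge> 0"
  obtains K \<eta> where "K \<ge> 1" "\<eta> > 0" "\<eta> \<le> 1" "8 * K * \<eta> < \<kappa>"
    "121 / \<theta> * ((64 * C / \<theta> + 8) / K\<^sup>2 + 1000 * C * K * \<eta> / \<kappa>) \<le> 1 / 2"
proof -
  define A where "A = 121 / \<theta> * (64 * C / \<theta> + 8)"
  define K where "K = max 1 (4 * A)"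
  define B where "B = 121 / \<theta> * (1000 * C * K / \<kappa>)"
  define \<eta> where "\<eta> = min 1 (min (\<kappa> / (16 * K)) (1 / (4 * (B + 1))))"
  have K: "K \<ge> 1" "4 * A \<le> K" by (auto simp: K_def)
  have B: "B \<ge> 0" using assms K by (auto simp: B_def)
  have \<eta>: "\<eta> > 0" "\<eta> \<le> 1" "\<eta> \<le> \<kappa> / (16 * K)" "\<eta> \<le> 1 / (4 * (B + 1))"
    using assms K B by (auto simp: \<eta>_def)
  have "K * 1 \<le> K * K" using K(1) by (intro mult_left_mono) auto
  then have "4 * A \<le> K\<^sup>2" unfolding power2_eq_square using K(2) by linarith
  then have 1: "A / K\<^sup>2 \<le> 1 / 4" using K by (simp add: divide_le_eq)
  have "B * \<eta> \<le> B * (1 / (4 * (B + 1)))" using B \<eta> by (intro mult_left_mono) auto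
  also have "\<dots> \<le> 1 / 4" using B by (simp add: divide_simps)
  finally have 2: "B * \<eta> \<le> 1 / 4" .
  have "8 * K * \<eta> \<le> 8 * K * (\<kappa> / (16 * K))" using K \<eta> by (intro mult_left_mono) auto
  also have "\<dots> < \<kappa>" using K assms by simp
  finally have 3: "8 * K * \<eta> < \<kappa>" .
  have "121 / \<theta> * ((64 * C / \<theta> + 8) / K\<^sup>2 + 1000 * C * K * \<eta> / \<kappa>) = A / K\<^sup>2 + B * \<eta>"
    by (simp add: A_def B_def distrib_left)
  also have "\<dots> \<le> 1 / 2" using 1 2 by linarith
  finally show ?thesis using that[OF K(1) \<eta>(1,2) 3] by blast
qed

context allen_cahn_wells
begin

lemma cutoff_energy_lower:
  assumes \<psi>: "continuous_on UNIV \<psi>" "\<And>x. x \<notin> K \<Longrightarrow> \<psi> x = 0" "\<And>x. x \<in> S \<Longrightarrow> \<psi> x \<ge> 1 / 11"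
    and K: "compact K" "K \<subseteq> U" and S: "S \<in> sets borel" "S \<subseteq> K"
  shows "en S \<le> 121 * (LBINT x. (\<psi> x)\<^sup>2 * e x)"
proof -
  have int: "integrable lborel (\<lambda>x. (\<psi> x)\<^sup>2 * e x)"
    by (rule integrable_cutoff_mult[OF open_ball K _ _ cont_e]) (use \<psi>(1,2) in \<open>auto intro!: continuous_intros\<close>)
  have "en S \<le> (LBINT x. 121 * ((\<psi> x)\<^sup>2 * e x))"
    unfolding en_def
  proof (rule integral_mono[OF integrable_e[OF S(1) S(2) K]])
    show "integrable lborel (\<lambda>x. 121 * ((\<psi> x)\<^sup>2 * e x))" using int by simp
    fix x
    show "indicator S x * e x \<le> 121 * ((\<psi> x)\<^sup>2 * e x)"
    proof (cases "x \<in> S")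
      case True
      have "(1 / 11)\<^sup>2 \<le> (\<psi> x)\<^sup>2" using \<psi>(3)[OF True] by (intro power_mono) auto
      then have "1 * e x \<le> 121 * (\<psi> x)\<^sup>2 * e x" using e_nonneg by (intro mult_right_mono) (auto simp: power2_eq_square)
      then show ?thesis using True by simp
    qed (use e_nonneg in simp)
  qed
  then show ?thesis by simp
qed

text \<open>The weighted energy inequality is used with the weights \<psi> z, which vanish on the
  bad set and so leave only an error of order 1 / K^2, and again with \<psi> alone. Between the two,
  the potential estimate bounds the bad term. Its quadratic error becomes linear because
  \<open>\<eta>\<close> bounds energy per radius.\<close>

lemma decay:
  assumes K: "K \<ge> 1" and x0: "norm x0 < 3/4" and r: "0 < r" "r \<le> 1/8" and small: "8 * K * \<epsilon> \<le> r"
    and \<eta>: "en (ball x0 r) \<le> \<eta> * r"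
    and D: "121 / \<theta> * ((64 * C\<^sub>F / \<theta> + 8) / K\<^sup>2 + 1000 * C\<^sub>F * K * \<eta> / \<kappa>) \<le> 1 / 2"
  shows "en (ball x0 (r / 2)) \<le> en (ball x0 r) / 2"
proof -
  \<comment> \<open>With 3/4 r the cutoff is bounded below on radius 5/8 r, hence on r/2, and a
    margin r/4 is left for the energy balls of radius \<delta> \<epsilon>.\<close>
  define \<rho> where "\<rho> = 3 / 4 * r"
  define h where "h = K * \<epsilon>"
  define E' where "E' = en (ball x0 r)"
  have E'0: "E' \<ge> 0" unfolding E'_def by (rule en_nonneg)
  have \<rho>: "\<rho> > 0" "\<rho> < r" using r by (auto simp: \<rho>_def)
  have K0: "K > 0" using K by simp
  have h: "h > 0" "\<delta> * \<epsilon> \<le> h"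
    using K eps_pos delta_le by (auto simp: h_def intro: mult_right_mono)
  have "8 * 1 * \<epsilon> \<le> 8 * K * \<epsilon>" using K eps_pos by (intro mult_right_mono) auto
  then have eK: "8 * \<epsilon> \<le> r" using small by linarith
  have \<rho>\<delta>: "\<rho> + \<delta> * \<epsilon> \<le> r"
  proof -
    have "\<delta> * \<epsilon> \<le> 1 * \<epsilon>" using delta_le eps_pos by (intro mult_right_mono) auto
    then show ?thesis using eK r by (simp add: \<rho>_def)
  qed
  have sub: "ball x0 r \<subseteq> ball 0 (7/8)"
    using x0 r by (simp add: ball_subset_ball_iff)
  define S where "S = cball x0 \<rho>"
  have Sr: "S \<subseteq> ball x0 r" using \<rho> by (auto simp: S_def)
  then have S78: "S \<subseteq> ball 0 (7/8)" using sub by blast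
  have S: "compact S" "S \<subseteq> U" using S78 by (force simp: S_def)+
  have enS: "en S \<le> E'" unfolding E'_def
    by (rule en_mono[OF _ _ Sr, of "7/8"]) (use sub in \<open>auto simp: S_def subset_iff less_imp_le\<close>)
  obtain \<psi> \<psi>' where \<psi>: "C1_fun \<psi> \<psi>'" "\<And>x. 0 \<le> \<psi> x" "\<And>x. \<psi> x \<le> 1" "\<And>x. x \<notin> ball x0 \<rho> \<Longrightarrow> \<psi> x = 0"
    "\<And>i x. \<bar>\<psi>' i x\<bar> \<le> 4 / \<rho>" "\<And>x. x \<in> ball x0 (5 / 6 * \<rho>) \<Longrightarrow> \<psi> x \<ge> 1 / 11"
    using exists_cutoff[OF \<rho>(1)] by metis
  have \<psi>0: "\<psi> x = 0" if "x \<notin> S" for x using \<psi>(4)[of x] that by (auto simp: S_def)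
  define F where "F = {x \<in> cball x0 \<rho>. V (u x) > c / 2}"
  define N where "N i = (\<Union>s\<in>(\<lambda>x. x $ i) ` F. ball s (3 * h))" for i
  have "bounded ((\<lambda>x. x $ i) ` F)" for i :: 2
  proof -
    have "bounded F" unfolding F_def by (rule bounded_subset[OF bounded_cball]) auto
    then show ?thesis by (rule bounded_linear_image) (rule bounded_linear_vec_nth)
  qed
  then have "\<exists>z z' \<phi>. (\<forall>t. (z has_real_derivative z' t) (at t)) \<and> continuous_on UNIV z' \<and>
    (\<forall>t. \<bar>z' t\<bar> \<le> 1 / h) \<and> (\<forall>t. 0 \<le> z t) \<and> (\<forall>t. z t \<le> 1) \<and> (\<forall>t\<in>(\<lambda>x. x $ i) ` F. z t = 0) \<and>
    (\<forall>t. (\<phi> has_real_derivative 1 - (z t)\<^sup>2) (at t)) \<and> (\<forall>t. \<bar>\<phi> t\<bar> \<le> measure lborel (N i))" for i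
    using thin_weight[OF _ h(1), of "(\<lambda>x. x $ i) ` F"] unfolding N_def by (metis (no_types, lifting))
  then obtain z z' \<phi> where z: "\<And>i t. (z i has_real_derivative z' i t) (at t)" "\<And>i. continuous_on UNIV (z' i)"
    "\<And>i t. \<bar>z' i t\<bar> \<le> 1 / h" "\<And>i t. 0 \<le> z i t" "\<And>i t. z i t \<le> 1" "\<And>i x. x \<in> F \<Longrightarrow> z i (x $ i) = 0"
    and \<phi>: "\<And>i t. (\<phi> i has_real_derivative 1 - (z i t)\<^sup>2) (at t)" "\<And>i t. \<bar>\<phi> i t\<bar> \<le> measure lborel (N i)"
    by (metis (no_types, lifting) imageI)
  define \<Phi> where "\<Phi> = 8 * K * E' / \<kappa>"
  have "measure lborel (N i) \<le> \<Phi>" for i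
  proof -
    have "measure lborel (N i) * (\<kappa> * \<epsilon>) \<le> 8 * h * E'"
      unfolding N_def F_def E'_def by (rule projection_measure[OF sub \<rho>\<delta> h(2)])
    also have "\<dots> = \<Phi> * (\<kappa> * \<epsilon>)" using kappa_pos by (simp add: \<Phi>_def h_def)
    finally show ?thesis using kappa_pos eps_pos by simp
  qed
  then have \<phi>': "\<bar>\<phi> i t\<bar> \<le> \<Phi>" for i t using \<phi>(2) order_trans by blast
  have zc: "continuous_on UNIV (z i)" for i
    by (intro continuous_at_imp_continuous_on ballI DERIV_isCont[OF z(1)])
  define W where "W = 1 / h + 4 / \<rho>"
  have er: "\<epsilon> / \<rho> \<le> 1 / (6 * K)" using small r K0 by (simp add: \<rho>_def field_simps)
  have eW: "\<epsilon>\<^sup>2 * W\<^sup>2 \<le> 4 / K\<^sup>2"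
  proof -
    have "\<epsilon> * W = 1 / K + 4 * (\<epsilon> / \<rho>)" using eps_pos by (simp add: W_def h_def distrib_left)
    also have "\<dots> \<le> 1 / K + 4 * (1 / (6 * K))" using er by linarith
    also have "\<dots> \<le> 2 / K" using K0 by (simp add: field_simps)
    finally have "\<epsilon> * W \<le> 2 / K" .
    then have "(\<epsilon> * W)\<^sup>2 \<le> (2 / K)\<^sup>2" using h \<rho> eps_pos by (intro power_mono) (auto simp: W_def)
    then show ?thesis by (simp add: power_mult_distrib power_divide)
  qed
  have strip: "(LBINT x. (\<psi> x * z i (x $ i))\<^sup>2 * e x) \<le> 32 / (\<theta> * K\<^sup>2) * E'" for i
  proof -
    have "\<theta> * (LBINT x. (\<psi> x * z i (x $ i))\<^sup>2 * e x) \<le>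
      C\<^sub>F / \<epsilon> * (LBINT x. (\<psi> x * z i (x $ i))\<^sup>2 * P (u x)) + 8 * \<epsilon>\<^sup>2 * W\<^sup>2 * en S"
    proof (rule caccioppoli[OF C1_fun_mult[OF \<psi>(1) C1_fun_coord[OF z(1,2)]] _ S(1) S78])
      show "\<psi> x * z i (x $ i) = 0" if "x \<notin> S" for x using \<psi>0[OF that] by simp
      fix j x
      have "\<bar>\<psi> x * (if j = i then z' i (x $ i) else 0)\<bar> \<le> 1 * (1 / h)"
        unfolding abs_mult using \<psi>(2,3)[of x] z(3)[of i "x $ i"] h by (intro mult_mono) auto
      moreover have "\<bar>\<psi>' j x * z i (x $ i)\<bar> \<le> 4 / \<rho> * 1"
        unfolding abs_mult using \<psi>(5)[of j x] z(4,5)[of i "x $ i"] \<rho> by (intro mult_mono) auto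
      ultimately show "\<bar>\<psi> x * (if j = i then z' i (x $ i) else 0) + \<psi>' j x * z i (x $ i)\<bar> \<le> W"
        unfolding W_def by linarith
    qed
    \<comment> \<open>Three cases: outside \<open>S\<close> the cutoff is 0, on the bad set
      \<open>z\<close> is 0, and elsewhere in \<open>S\<close> the truncated potential is 0.\<close>
    also have "(\<lambda>x. (\<psi> x * z i (x $ i))\<^sup>2 * P (u x)) = (\<lambda>x. 0)"
    proof
      fix x
      show "(\<psi> x * z i (x $ i))\<^sup>2 * P (u x) = 0"
        using \<psi>0[of x] z(6)[of x i] by (cases "x \<in> F") (auto simp: F_def S_def P_def)
    qed
    also have "C\<^sub>F / \<epsilon> * (LBINT x::real^2. 0) + 8 * \<epsilon>\<^sup>2 * W\<^sup>2 * en S = 8 * (\<epsilon>\<^sup>2 * W\<^sup>2) * en S" by simp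
    also have "\<dots> \<le> 8 * (4 / K\<^sup>2) * E'" using eW enS en_nonneg by (intro mult_mono) auto
    finally have "\<theta> * (LBINT x. (\<psi> x * z i (x $ i))\<^sup>2 * e x) \<le> \<theta> * (32 / (\<theta> * K\<^sup>2) * E')"
      using theta_pos by simp
    then show ?thesis using theta_pos by (rule mult_left_le_imp_le)
  qed
  have "(LBINT x. (\<psi> x)\<^sup>2 * P (u x)) / \<epsilon> \<le>
    (\<Sum>i\<in>UNIV. (LBINT x. (\<psi> x * z i (x $ i))\<^sup>2 * e x)) + 20 * \<Phi> * (4 / \<rho>) * en S"
    by (rule potential_estimate[OF \<psi>(1) \<psi>0 \<psi>(2,3,5) S zc \<phi>(1) \<phi>'])
  also have "\<dots> \<le> (\<Sum>i\<in>(UNIV::2 set). 32 / (\<theta> * K\<^sup>2) * E') + 1000 * K * \<eta> / \<kappa> * E'"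
  proof (intro add_mono sum_mono strip)
    \<comment> \<open>\<open>\<Phi>\<close> is proportional to the energy, at most \<eta> r, and
      \<rho> is 3/4 r, so the radius cancels; 2560/3 is rounded up to 1000.\<close>
    have "20 * \<Phi> * (4 / \<rho>) = 80 * 8 * K / (\<kappa> * \<rho>) * E'" by (simp add: \<Phi>_def)
    also have "\<dots> \<le> 80 * 8 * K / (\<kappa> * \<rho>) * (\<eta> * r)"
      using \<eta> K0 kappa_pos \<rho> by (intro mult_left_mono) (auto simp: E'_def)
    also have "\<dots> = 2560 / 3 * (K * \<eta> / \<kappa>)" using r by (simp add: \<rho>_def)
    also have "\<dots> \<le> 1000 * (K * \<eta> / \<kappa>)"
    proof -
      have "0 \<le> \<eta> * r" using \<eta> E'0 by (simp add: E'_def)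
      then have "\<eta> \<ge> 0" using r by (simp add: zero_le_mult_iff)
      then have "K * \<eta> / \<kappa> \<ge> 0" using K0 kappa_pos by simp
      then show ?thesis by linarith
    qed
    finally have f: "20 * \<Phi> * (4 / \<rho>) \<le> 1000 * K * \<eta> / \<kappa>" by simp
    have "20 * \<Phi> * (4 / \<rho>) \<ge> 0" using E'0 K0 kappa_pos \<rho> by (simp add: \<Phi>_def)
    then show "20 * \<Phi> * (4 / \<rho>) * en S \<le> 1000 * K * \<eta> / \<kappa> * E'"
      using f enS en_nonneg by (intro mult_mono) auto
  qed
  also have "\<dots> = (64 / (\<theta> * K\<^sup>2) + 1000 * K * \<eta> / \<kappa>) * E'" by (simp add: distrib_right)
  finally have pot: "(LBINT x. (\<psi> x)\<^sup>2 * P (u x)) / \<epsilon> \<le> (64 / (\<theta> * K\<^sup>2) + 1000 * K * \<eta> / \<kappa>) * E'" .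
  have "\<theta> * (LBINT x. (\<psi> x)\<^sup>2 * e x) \<le>
    C\<^sub>F / \<epsilon> * (LBINT x. (\<psi> x)\<^sup>2 * P (u x)) + 8 * \<epsilon>\<^sup>2 * (4 / \<rho>)\<^sup>2 * en S"
    by (rule caccioppoli[OF \<psi>(1) \<psi>0 S(1) S78 \<psi>(5)])
  also have "\<dots> \<le> C\<^sub>F * ((64 / (\<theta> * K\<^sup>2) + 1000 * K * \<eta> / \<kappa>) * E') + 8 / K\<^sup>2 * E'"
  proof (rule add_mono)
    show "C\<^sub>F / \<epsilon> * (LBINT x. (\<psi> x)\<^sup>2 * P (u x)) \<le> C\<^sub>F * ((64 / (\<theta> * K\<^sup>2) + 1000 * K * \<eta> / \<kappa>) * E')"
      using mult_left_mono[OF pot CF_nonneg] by simp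
    have "4 * (\<epsilon> / \<rho>) \<le> 1 / K"
    proof -
      have "4 * (\<epsilon> / \<rho>) \<le> 4 * (1 / (6 * K))" using er by linarith
      also have "\<dots> \<le> 1 / K" using K0 by (simp add: field_simps)
      finally show ?thesis .
    qed
    then have "(4 * (\<epsilon> / \<rho>))\<^sup>2 \<le> (1 / K)\<^sup>2" using eps_pos \<rho> by (intro power_mono) auto
    then have "8 * \<epsilon>\<^sup>2 * (4 / \<rho>)\<^sup>2 \<le> 8 / K\<^sup>2" by (simp add: power_mult_distrib power_divide)
    then show "8 * \<epsilon>\<^sup>2 * (4 / \<rho>)\<^sup>2 * en S \<le> 8 / K\<^sup>2 * E'" using enS en_nonneg by (intro mult_mono) auto
  qed
  also have "\<dots> = ((64 * C\<^sub>F / \<theta> + 8) / K\<^sup>2 + 1000 * C\<^sub>F * K * \<eta> / \<kappa>) * E'"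
    by (simp add: add_divide_distrib algebra_simps)
  finally have "(LBINT x. (\<psi> x)\<^sup>2 * e x) \<le> ((64 * C\<^sub>F / \<theta> + 8) / K\<^sup>2 + 1000 * C\<^sub>F * K * \<eta> / \<kappa>) * E' / \<theta>"
    using theta_pos by (simp add: le_divide_eq mult.commute)
  moreover have "en (ball x0 (r / 2)) \<le> 121 * (LBINT x. (\<psi> x)\<^sup>2 * e x)"
  proof (rule cutoff_energy_lower[OF _ \<psi>0 _ S])
    show "continuous_on UNIV \<psi>" using \<psi>(1) by (simp add: C1_fun_def)
    show "1 / 11 \<le> \<psi> x" if "x \<in> ball x0 (r / 2)" for x
      by (rule \<psi>(6)) (use that r in \<open>auto simp: \<rho>_def\<close>)
    show "ball x0 (r / 2) \<subseteq> S" using r by (auto simp: S_def \<rho>_def)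
  qed auto
  ultimately have "en (ball x0 (r / 2)) \<le> 121 * (((64 * C\<^sub>F / \<theta> + 8) / K\<^sup>2 + 1000 * C\<^sub>F * K * \<eta> / \<kappa>) * E' / \<theta>)" by linarith
  also have "\<dots> = 121 / \<theta> * ((64 * C\<^sub>F / \<theta> + 8) / K\<^sup>2 + 1000 * C\<^sub>F * K * \<eta> / \<kappa>) * E'" by simp
  also have "\<dots> \<le> 1 / 2 * E'" using D E'0 by (rule mult_right_mono)
  finally show ?thesis by (simp add: E'_def)
qed

text \<open>The bound \<open>en (ball x0 r) \<le> \<eta> r\<close> is propagated through dyadic radii down to \<open>r\<close> comparable to \<open>\<epsilon>\<close>,
  where it contradicts the lower bound for the energy around a point far from the wells.\<close>

lemma small_potential:
  assumes K: "K \<ge> 1" and x0: "norm x0 < 3/4" and \<eta>: "\<eta> > 0" "E \<le> \<eta> / 8" "8 * K * \<eta> < \<kappa>"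
    and D: "121 / \<theta> * ((64 * C\<^sub>F / \<theta> + 8) / K\<^sup>2 + 1000 * C\<^sub>F * K * \<eta> / \<kappa>) \<le> 1 / 2"
  shows "V (u x0) \<le> c / 2"
proof (rule ccontr)
  assume V: "\<not> V (u x0) \<le> c / 2"
  \<comment> \<open>Starting at 1/8 keeps all balls inside radius 7/8 and makes the hypothesis E
    \<le> \<eta> / 8 the initial bound.\<close>
  define r where "r j = 1 / 8 * (1 / 2 :: real) ^ j" for j
  have r: "r j > 0" "r j \<le> 1 / 8" "r (Suc j) = r j / 2" for j by (auto simp: r_def power_le_one)
  have sub: "ball x0 (r j) \<subseteq> ball 0 (7/8)" for j
    using x0 r(2)[of j] by (simp add: ball_subset_ball_iff)
  then have sub': "ball x0 (r j) \<subseteq> cball 0 (7/8)" for j by (rule order_trans) auto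
  have "\<exists>j. \<not> 8 * K * \<epsilon> \<le> r j"
  proof -
    obtain j where "(1 / 2 :: real) ^ j < 64 * K * \<epsilon>"
      using real_arch_pow_inv[of "64 * K * \<epsilon>" "1/2"] K eps_pos by auto
    then show ?thesis by (intro exI[of _ j]) (simp add: r_def)
  qed
  \<comment> \<open>The first radius below 8 K \<epsilon>: decay applies at all earlier ones, and at
    this one the bound \<eta> r is comparable to \<epsilon>.\<close>
  then obtain j where j: "\<not> 8 * K * \<epsilon> \<le> r j" "\<And>i. i < j \<Longrightarrow> 8 * K * \<epsilon> \<le> r i"
    using exists_least_iff[of "\<lambda>j. \<not> 8 * K * \<epsilon> \<le> r j"] by blast
  have bound: "en (ball x0 (r i)) \<le> \<eta> * r i" if "i \<le> j" for i
    using that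
  proof (induction i)
    case 0
    have "en (ball x0 (r 0)) \<le> E" by (rule en_le[OF _ sub']) auto
    then show ?case using \<eta>(2) by (simp add: r_def)
  next
    case (Suc i)
    have IH: "en (ball x0 (r i)) \<le> \<eta> * r i" using Suc by simp
    have "8 * K * \<epsilon> \<le> r i" by (rule j(2)) (use Suc in simp)
    from decay[OF K x0 r(1,2) this IH D] IH show ?case by (simp add: r(3))
  qed
  \<comment> \<open>The final ball must still contain the energy ball. If the iteration never
    starts, this follows from \<delta> \<le> 1/16 and \<epsilon> \<le> 1; otherwise the preceding
    radius was at least 8 \<epsilon>.\<close>
  have "\<delta> * \<epsilon> \<le> r j"
  proof (cases j)
    case 0
    have "\<delta> * \<epsilon> \<le> 1 / 16 * 1" using delta_le delta_pos eps_pos eps_le by (intro mult_mono) auto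
    then show ?thesis using 0 by (simp add: r_def)
  next
    case (Suc i)
    have "8 * 1 * \<epsilon> \<le> 8 * K * \<epsilon>" using K eps_pos by (intro mult_right_mono) auto
    also have "\<dots> \<le> r i" by (rule j(2)) (use Suc in simp)
    also have "\<dots> = 2 * r j" using Suc r(3)[of i] by simp
    finally have "\<epsilon> \<le> r j" using eps_pos by simp
    moreover have "\<delta> * \<epsilon> \<le> 1 * \<epsilon>" using delta_le eps_pos by (intro mult_right_mono) auto
    ultimately show ?thesis by simp
  qed
  then have sb: "ball x0 (\<delta> * \<epsilon>) \<subseteq> ball x0 (r j)" by (rule subset_ball)
  have "\<kappa> * \<epsilon> \<le> en (ball x0 (\<delta> * \<epsilon>))"
    by (rule energy_density_lower) (use V sb sub in auto)
  also have "\<dots> \<le> en (ball x0 (r j))" by (rule en_mono[OF _ _ sb sub']) auto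
  also have "\<dots> \<le> \<eta> * r j" by (rule bound) simp
  also have "\<dots> \<le> \<eta> * (8 * K * \<epsilon>)" using j(1) \<eta>(1) by (intro mult_left_mono) auto
  also have "\<dots> = (8 * K * \<eta>) * \<epsilon>" by simp
  also have "\<dots> < \<kappa> * \<epsilon>" using \<eta>(3) eps_pos by (rule mult_strict_right_mono)
  finally show False by simp
qed

text \<open>With an empty bad set the term in \<open>P\<close> disappears and only the cutoff error
  of order \<epsilon>^2 remains. The constant is 121 * 8 * (16/3)^2, about 27534, rounded
  up.\<close>

lemma interior_energy_bound:
  assumes V: "\<And>x. x \<in> ball 0 (3/4) \<Longrightarrow> V (u x) \<le> c / 2"
  shows "en (ball 0 (5/8)) \<le> 30000 / \<theta> * \<epsilon>\<^sup>2 * en (cball 0 (3/4))"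
proof -
  define S where "S = cball (0::real^2) (3/4)"
  obtain \<psi> \<psi>' where \<psi>: "C1_fun \<psi> \<psi>'" "\<And>x::real^2. x \<notin> ball 0 (3/4) \<Longrightarrow> \<psi> x = 0"
    "\<And>i x. \<bar>\<psi>' i x\<bar> \<le> 4 / (3/4)" "\<And>x. x \<in> ball 0 (5 / 6 * (3/4)) \<Longrightarrow> \<psi> x \<ge> 1 / 11"
    using exists_cutoff[of "3/4" "0::real^2"] by (metis (no_types, lifting) zero_less_divide_iff zero_less_numeral)
  have \<psi>0: "\<psi> x = 0" if "x \<notin> S" for x using \<psi>(2)[of x] that by (auto simp: S_def)
  have S: "compact S" "S \<subseteq> ball 0 (7/8)" "S \<subseteq> U" by (auto simp: S_def)
  have "\<theta> * (LBINT x. (\<psi> x)\<^sup>2 * e x) \<le>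
    C\<^sub>F / \<epsilon> * (LBINT x. (\<psi> x)\<^sup>2 * P (u x)) + 8 * \<epsilon>\<^sup>2 * (4 / (3/4))\<^sup>2 * en S"
    by (rule caccioppoli[OF \<psi>(1) \<psi>0 S(1,2) \<psi>(3)])
  also have "(\<lambda>x. (\<psi> x)\<^sup>2 * P (u x)) = (\<lambda>x. 0)"
  proof
    fix x show "(\<psi> x)\<^sup>2 * P (u x) = 0"
      using \<psi>(2)[of x] V[of x] by (cases "x \<in> ball 0 (3/4)") (auto simp: P_def)
  qed
  finally have "\<theta> * (LBINT x. (\<psi> x)\<^sup>2 * e x) \<le> 2048 / 9 * \<epsilon>\<^sup>2 * en S" by (simp add: power2_eq_square)
  then have 1: "(LBINT x. (\<psi> x)\<^sup>2 * e x) \<le> 2048 / 9 * \<epsilon>\<^sup>2 * en S / \<theta>"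
    using theta_pos by (simp add: le_divide_eq mult.commute)
  have "en (ball 0 (5/8)) \<le> 121 * (LBINT x. (\<psi> x)\<^sup>2 * e x)"
    by (rule cutoff_energy_lower[OF _ \<psi>0 _ S(1,3)])
       (use \<psi>(1,4) in \<open>auto simp: C1_fun_def S_def\<close>)
  also have "\<dots> \<le> 121 * (2048 / 9 * \<epsilon>\<^sup>2 * en S / \<theta>)" using 1 by simp
  also have "\<dots> = 247808 / 9 * (\<epsilon>\<^sup>2 * en S / \<theta>)" by simp
  also have "\<dots> \<le> 30000 * (\<epsilon>\<^sup>2 * en S / \<theta>)"
    using en_nonneg theta_pos by (intro mult_right_mono) auto
  finally show ?thesis by (simp add: S_def)
qed

lemma ennreal_en:
  assumes "S \<in> sets borel" "S \<subseteq> cball 0 r" "r < 1"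
  shows "ennreal (en S) = energy \<epsilon> V u S"
proof -
  have "integrable lborel (\<lambda>x. indicator S x * e x)"
    by (rule integrable_e[of _ "cball 0 r"]) (use assms in auto)
  then have "ennreal (en S) = (\<integral>\<^sup>+x. ennreal (indicator S x * e x) \<partial>lborel)"
    unfolding en_def by (rule nn_integral_eq_integral[symmetric]) (use e_nonneg in auto)
  also have "\<dots> = (\<integral>\<^sup>+x\<in>S. ennreal (e x) \<partial>lborel)"
    by (rule nn_integral_cong) (auto simp: indicator_def)
  also have "\<dots> = energy \<epsilon> V u S" by (simp add: energy_def nn_integral_completion)
  finally show ?thesis .
qed

end

section \<open>Constants depending only on the potential, and the conclusion for solutions of small
  energy\<close>

theorem theorem6:
  fixes V :: "real^'k \<Rightarrow> real" and \<mu>\<^sub>0 :: real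
  assumes "multi_well_potential V" and "well_radius V \<mu>\<^sub>0"
  shows "\<exists>\<eta>\<^sub>1>0. \<exists>C>0. \<forall>(\<epsilon>::real) (u :: real^2 \<Rightarrow> real^'k).
    0 < \<epsilon> \<longrightarrow> \<epsilon> \<le> 1 \<longrightarrow> solution_on (disk 1) \<epsilon> V u \<longrightarrow>
    energy \<epsilon> V u (disk 1) \<le> ennreal (2 * \<eta>\<^sub>1) \<longrightarrow>
      (\<exists>\<sigma>\<in>zero_set V. \<forall>x\<in>disk (3/4). norm (u x - \<sigma>) \<le> \<mu>\<^sub>0 / 2) \<and>
      energy \<epsilon> V u (disk (5/8)) \<le> ennreal (C * \<epsilon>) * energy \<epsilon> V u (disk 1)"
proof -
  have V_smooth: "smooth_on UNIV V" using assms(1) by (simp add: multi_well_potential_def)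
  have \<mu>: "\<mu>\<^sub>0 / 2 > 0" using assms(2) by (simp add: well_radius_def)
  obtain \<alpha> Q where g: "\<alpha> > 0" "Q \<ge> 0" "\<And>y. y \<bullet> grad V y \<ge> \<alpha> * (norm y)\<^sup>2 - Q"
    "\<And>y. V y \<ge> \<alpha> / 2 * (norm y)\<^sup>2 - Q"
    using multi_well_growth[OF assms(1)] by metis
  \<comment> \<open>Outside its locale, \<open>M\<close> takes only \<alpha> and Q as arguments.
    This is what makes \<Lambda>, and below \<kappa> and \<open>C\<^sub>F\<close>, independent of
    \<epsilon> and of the solution.\<close>
  obtain \<Lambda> where L: "\<Lambda> > 0" "\<And>y. norm y \<le> allen_cahn_coercive.M \<alpha> Q \<Longrightarrow> norm (grad V y) \<le> \<Lambda>"
    "\<And>y v. norm y \<le> allen_cahn_coercive.M \<alpha> Q \<Longrightarrow> - \<Lambda> * (norm v)\<^sup>2 \<le> v \<bullet> (hessian V y *v v)"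
    using smooth_potential_bounds[OF V_smooth, of "allen_cahn_coercive.M \<alpha> Q"] by metis
  obtain \<theta> c where w: "\<theta> > 0" "c > 0"
    "\<And>y. V y < c \<Longrightarrow> \<exists>\<sigma>\<in>zero_set V. norm (y - \<sigma>) < \<mu>\<^sub>0 / 2"
    "\<And>y v. V y < c \<Longrightarrow> \<theta> * (norm v)\<^sup>2 \<le> v \<bullet> (hessian V y *v v)"
    "\<And>y. V y < c \<Longrightarrow> 2 * \<theta> * V y \<le> (norm (grad V y))\<^sup>2"
    using multi_well_wells[OF assms(1) \<mu>] by metis
  define k where "k = allen_cahn_wells.\<kappa> \<alpha> Q \<Lambda> c"
  define F where "F = allen_cahn_wells.C\<^sub>F \<alpha> Q \<Lambda> \<theta> c"
  \<comment> \<open>Positivity of \<open>k\<close> and \<open>F\<close> is only available once a solution is given, hence the conditional choice.\<close>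
  have "\<exists>K \<eta>. \<eta> > 0 \<and> (k > 0 \<and> F \<ge> 0 \<longrightarrow> K \<ge> 1 \<and> \<eta> \<le> 1 \<and> 8 * K * \<eta> < k \<and>
    121 / \<theta> * ((64 * F / \<theta> + 8) / K\<^sup>2 + 1000 * F * K * \<eta> / k) \<le> 1 / 2)"
  proof (cases "k > 0 \<and> F \<ge> 0")
    case True
    then show ?thesis using decay_constants[of \<theta> k F] w(1) by metis
  next
    case False
    then show ?thesis by (intro exI[of _ "1::real"]) auto
  qed
  then obtain K \<eta> where \<eta>: "\<eta> > 0" and K\<eta>: "k > 0 \<Longrightarrow> F \<ge> 0 \<Longrightarrow> K \<ge> 1 \<and> \<eta> \<le> 1 \<and> 8 * K * \<eta> < k \<and>
    121 / \<theta> * ((64 * F / \<theta> + 8) / K\<^sup>2 + 1000 * F * K * \<eta> / k) \<le> 1 / 2"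
    by blast
  define \<eta>\<^sub>1 where "\<eta>\<^sub>1 = min 1 \<eta> / 16"
  have "(\<exists>\<sigma>\<in>zero_set V. \<forall>x\<in>disk (3/4). norm (u x - \<sigma>) \<le> \<mu>\<^sub>0 / 2) \<and>
      energy \<epsilon> V u (disk (5/8)) \<le> ennreal (30000 / \<theta> * \<epsilon>) * energy \<epsilon> V u (disk 1)"
    if \<epsilon>: "0 < \<epsilon>" "\<epsilon> \<le> 1" and sol: "solution_on (disk 1) \<epsilon> V u"
      and en: "energy \<epsilon> V u (disk 1) \<le> ennreal (2 * \<eta>\<^sub>1)" for \<epsilon> :: real and u :: "real^2 \<Rightarrow> real^'k"
  proof -
    define E where "E = enn2real (energy \<epsilon> V u (disk 1))"
    have fin: "energy \<epsilon> V u (disk 1) < \<infinity>" using en by (rule le_less_trans) simp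
    have E: "E \<le> 2 * \<eta>\<^sub>1"
      unfolding E_def by (rule enn2real_leI[OF _ en]) (use \<eta> in \<open>simp add: \<eta>\<^sub>1_def\<close>)
    interpret allen_cahn_wells V \<epsilon> u E \<alpha> Q \<Lambda> \<theta> c
    proof unfold_locales
      show "smooth_on (disk 1) u" using sol by (simp add: solution_on_def)
      show "laplacian u x = (1 / \<epsilon>\<^sup>2) *\<^sub>R grad V (u x)" if "x \<in> disk 1" for x
        using sol that unfolding solution_on_def by (metis neg_equal_iff_equal)
      show "(LBINT x. indicator (cball 0 r) x * energy_density \<epsilon> V u x) \<le> E" if "r < 1" for r
        unfolding E_def
        by (rule enn2real_energy_ge[OF multi_well_nonneg[OF assms(1)] \<epsilon>(1) fin]) (use that in auto)
      show "E \<le> 1" using E by (simp add: \<eta>\<^sub>1_def)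
    qed (use V_smooth multi_well_nonneg[OF assms(1)] \<epsilon> g L w in auto)
    have K: "K \<ge> 1" "8 * K * \<eta> < k" "\<eta> \<le> 1"
      "121 / \<theta> * ((64 * F / \<theta> + 8) / K\<^sup>2 + 1000 * F * K * \<eta> / k) \<le> 1 / 2"
      using K\<eta> kappa_pos CF_nonneg by (auto simp: k_def F_def)
    \<comment> \<open>The denominator 16 in \<open>\<eta>\<^sub>1\<close> is 2 times 8: the factor 2
      from the energy hypothesis and the 8 from the starting radius 1/8.\<close>
    have "E \<le> \<eta> / 8" using E K(3) by (simp add: \<eta>\<^sub>1_def)
    then have Vsmall: "V (u x) \<le> c / 2" if "x \<in> disk (3/4)" for x
      using small_potential[OF K(1) _ \<eta>, of x] K(2,4) that by (simp add: k_def F_def)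
    have "\<exists>\<sigma>\<in>zero_set V. u ` disk (3/4) \<subseteq> ball \<sigma> (\<mu>\<^sub>0 / 2)"
    proof (rule connected_in_one_ball[OF convex_connected[OF convex_ball]])
      show "continuous_on (disk (3/4)) u" by (rule continuous_on_subset[OF cont_u]) auto
      show "\<exists>\<sigma>\<in>zero_set V. u x \<in> ball \<sigma> (\<mu>\<^sub>0 / 2)" if "x \<in> disk (3/4)" for x
        using w(3)[of "u x"] Vsmall[OF that] w(2) by (auto simp: dist_norm norm_minus_commute)
      show "ball \<sigma> (\<mu>\<^sub>0 / 2) \<inter> ball \<tau> (\<mu>\<^sub>0 / 2) = {}"
        if "\<sigma> \<in> zero_set V" "\<tau> \<in> zero_set V" "\<sigma> \<noteq> \<tau>" for \<sigma> \<tau>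
      proof -
        have "ball \<sigma> (2 * \<mu>\<^sub>0) \<inter> ball \<tau> (2 * \<mu>\<^sub>0) = {}" using assms(2) that by (auto simp: well_radius_def)
        moreover have "ball \<sigma> (\<mu>\<^sub>0 / 2) \<subseteq> ball \<sigma> (2 * \<mu>\<^sub>0)" "ball \<tau> (\<mu>\<^sub>0 / 2) \<subseteq> ball \<tau> (2 * \<mu>\<^sub>0)"
          using \<mu> by (auto intro!: subset_ball)
        ultimately show ?thesis by blast
      qed
    qed simp
    then have "\<exists>\<sigma>\<in>zero_set V. \<forall>x\<in>disk (3/4). norm (u x - \<sigma>) \<le> \<mu>\<^sub>0 / 2"
      by (force simp: image_subset_iff dist_norm norm_minus_commute)
    moreover have "energy \<epsilon> V u (disk (5/8)) \<le> ennreal (30000 / \<theta> * \<epsilon>) * energy \<epsilon> V u (disk 1)"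
    proof -
      have "energy \<epsilon> V u (disk (5/8)) = ennreal (en (disk (5/8)))"
        by (rule ennreal_en[symmetric, of _ "5/8"]) auto
      also have "en (disk (5/8)) \<le> 30000 / \<theta> * \<epsilon>\<^sup>2 * en (cball 0 (3/4))"
        by (rule interior_energy_bound[OF Vsmall])
      \<comment> \<open>The interior estimate has a factor \<epsilon>^2, which is weakened to
        \<epsilon> using \<epsilon> \<le> 1.\<close>
      also have "\<dots> \<le> 30000 / \<theta> * \<epsilon> * en (cball 0 (3/4))"
      proof -
        have "\<epsilon> * \<epsilon> \<le> \<epsilon> * 1" using \<epsilon> by (intro mult_left_mono) auto
        then show ?thesis using theta_pos en_nonneg
          by (intro mult_right_mono mult_left_mono) (auto simp: power2_eq_square)
      qed
      finally have "energy \<epsilon> V u (disk (5/8)) \<le> ennreal (30000 / \<theta> * \<epsilon> * en (cball 0 (3/4)))"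
        by (simp add: ennreal_leI)
      also have "\<dots> = ennreal (30000 / \<theta> * \<epsilon>) * ennreal (en (cball 0 (3/4)))"
        using theta_pos \<epsilon> by (intro ennreal_mult en_nonneg) auto
      also have "ennreal (en (cball 0 (3/4))) = energy \<epsilon> V u (cball 0 (3/4))"
        by (rule ennreal_en[of _ "3/4"]) auto
      also have "\<dots> \<le> energy \<epsilon> V u (disk 1)"
        unfolding energy_def by (intro nn_integral_mono) (auto simp: indicator_def)
      finally show ?thesis by (simp add: mult_left_mono)
    qed
    ultimately show ?thesis by blast
  qed
  moreover have "\<eta>\<^sub>1 > 0" using \<eta> by (simp add: \<eta>\<^sub>1_def)
  moreover have "30000 / \<theta> > 0" using w(1) by simp
  ultimately show ?thesis by blast
qed

end
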